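(* In the noise-limited network described in the context, the secure connectivity probability in the presence of non-colluding eavesdroppers, $$\tau_n=\Pr\left(\frac{M_sL(x^*,o)h_{x^*o}}{\max_{z\in\Phi_E}G_b(\theta_z)L(x^*,z)g_{x^*z}}\ge 1\right),$$ is given by $$\tau_n=\sum_{j\in\{L,N\}}A_j\int_0^{\infty}f_{r_j}(r)\int_0^{+\infty}\frac{e^{-\Lambda_E\left(0,\frac{r^{\alpha_j}}{M_s w C_j}\right)}\,w^{N_j-1}e^{-w}}{\Gamma(N_j)}\,dw\,dr ,$$ where $f_{r_L}$ is supported on $[0,D]$, and, for $t>0$, $$\Lambda_E(0,t)=2\pi\lambda_E\left(\sum_{j\in\{L,N\}}q_j\big(\Omega_{j,\mathrm{in}}(M_s,t)+\Omega_{j,\mathrm{in}}(m_s,t)\big)+\Omega_{N,\mathrm{out}}(M_s,t)+\Omega_{N,\mathrm{out}}(m_s,t)\right),$$ with $q_L=C$, $q_N=1-C$ and, for $V\in\{M_s,m_s\}$, $$\Omega_{j,\mathrm{in}}(V,t)=\mathrm{Pr}_{G_b}(V)\frac{(VC_jt)^{2/\alpha_j}}{\alpha_j}\sum_{m=0}^{N_j-1}\frac{\gamma\left(m+\frac{2}{\alpha_j},\frac{D^{\alpha_j}}{VC_jt}\right)}{m!},\qquad \Omega_{j,\mathrm{out}}(V,t)=\mathrm{Pr}_{G_b}(V)\frac{(VC_jt)^{2/\alpha_j}}{\alpha_j}\sum_{m=0}^{N_j-1}\frac{\Gamma\left(m+\frac{2}{\alpha_j},\frac{D^{\alpha_j}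}{VC_jt}\right)}{m!}.$$
   Context: Notation: $\gamma(\cdot,\cdot)$ and $\Gamma(\cdot,\cdot)$ are the lower and upper incomplete gamma functions; $\mathrm{gamma}(k,1)$ is the gamma distribution with shape $k$ and scale $1$; $o$ is the origin of $\mathbb{R}^2$. Base stations (BSs). BS locations form a homogeneous Poisson point process (PPP) $\Phi_B$ on $\mathbb{R}^2$ of intensity $\lambda_B>0$. The typical user is at $o$. Blockage. Let $D>0$ and $0\le C\le 1$. Every link (BS to user, or BS to eavesdropper) of length $r$ is line-of-sight (LOS) with probability $q_L(r)=C$ if $r\le D$ and $0$ if $r>D$, and non-line-of-sight (NLOS) otherwise, independently over links. $\Phi_L$ and $\Phi_N$ are the sets of BSs whose link to $o$ is LOS, respectively NLOS; they are independent PPPs. Path loss. $L(x,y)=C_L\|x-y\|^{-\alpha_L}$ if the link $x\to y$ is LOS and $L(x,y)=C_N\|x-y\|^{-\alpha_N}$ if it is NLOS, where $C_L>C_N>0$ and $0<\alpha_L<\alpha_N$. Association. The typical user is served by the BS $x^*=\arg\max_{x\in\Phi_B}L(x,o)$. For $j\in\{L,N\}$, $A_j=\Pr(x^*\in\Phi_j)$, $r_j$ is the distance $\|x^*\|$ conditioned on $x^*\in\Phi_j$, and $f_{r_j}$ is its probability density (a term with $A_j=0$ is read as $0$). Eavesdroppers. Eavesdropper locations form a homogeneous PPP $\Phi_E$ on $\mathbb{R}^2$ of intensity $\lambda_E>0$, independent of $\Phi_B$. Fading. $h_{x^*o}$ (user) and $g_{x^*z}$ (eavesdropper at $z$) are small-scale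 power gains, mutually independent and independent of everything else given the link states, distributed as $\mathrm{gamma}(N_L,1)$ if the link is LOS and $\mathrm{gamma}(N_N,1)$ if it is NLOS, with $N_L,N_N$ positive integers. Antenna gain. The serving BS has gain $M_s$ towards its user. Towards an eavesdropper $z$ its gain is an independent random variable $G_b(\theta_z)$ equal to $M_s$ with probability $\mathrm{Pr}_{G_b}(M_s)=\theta_b/180$ and to $m_s$ with probability $\mathrm{Pr}_{G_b}(m_s)=(180-\theta_b)/180$, where $M_s>m_s>0$ and $0<\theta_b<180$ (degrees). *)

theory Defs
  imports "HOL-Probability.Probability"
begin

section \<open>Point processes and conditional laws\<close>

text \<open>
  A point process is represented by a random enumeration \<open>X \<omega> 0, X \<omega> 1, \<dots>\<close> of its points, which
  loses no generality for a homogeneous Poisson process of positive intensity, since it has infinitely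
  many points almost surely. The order of the enumeration is arbitrary, and points are
  counted with multiplicity. The bounded Borel sets of Lebesgue measure \<open>0\<close> are covered by the
  convention \<open>0 ^ 0 = 1\<close>.
\<close>

definition point_count :: "(nat \<Rightarrow> real^2) \<Rightarrow> (real^2) set \<Rightarrow> nat" where
  "point_count x B = card {i. x i \<in> B}"

abbreviation point_space :: "(nat \<Rightarrow> real^2) measure" where
  "point_space \<equiv> PiM UNIV (\<lambda>_. borel)"

definition homogeneous_ppp :: "'w measure \<Rightarrow> real \<Rightarrow> ('w \<Rightarrow> nat \<Rightarrow> real^2) \<Rightarrow> bool" where
  "homogeneous_ppp M l X \<longleftrightarrow>
     X \<in> M \<rightarrow>\<^sub>M point_space \<and>
     (\<forall>B\<in>sets borel. bounded B \<longrightarrow>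
        (AE \<omega> in M. finite {i. X \<omega> i \<in> B}) \<and>
        (\<forall>n. measure M {\<omega>\<in>space M. point_count (X \<omega>) B = n}
               = (l * measure lborel B) ^ n / fact n * exp (- (l * measure lborel B)))) \<and>
     (\<forall>(B :: nat \<Rightarrow> (real^2) set) n.
        (\<forall>k<n. B k \<in> sets borel \<and> bounded (B k)) \<and> disjoint_family_on B {..<n} \<longrightarrow>
        prob_space.indep_vars M (\<lambda>_. count_space UNIV) (\<lambda>k \<omega>. point_count (X \<omega>) (B k)) {..<n})"

text \<open>
  Given the random element \<open>W\<close>, the variables \<open>Y i\<close> are independent, and \<open>Y i\<close> has the conditional
  law \<open>\<kappa> i W\<close>.
\<close>

definition cond_indep_law ::
    "'w measure \<Rightarrow> 'c measure \<Rightarrow> ('w \<Rightarrow> 'c) \<Rightarrow> 'b measure \<Rightarrow> ('w \<Rightarrow> 'i \<Rightarrow> 'b) \<Rightarrow> ('i \<Rightarrow> 'c \<Rightarrow> 'b measure) \<Rightarrow> bool"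
  where
  "cond_indep_law M MW W N Y \<kappa> \<longleftrightarrow>
     W \<in> M \<rightarrow>\<^sub>M MW \<and> Y \<in> M \<rightarrow>\<^sub>M PiM UNIV (\<lambda>_. N) \<and>
     (\<forall>A\<in>sets MW. \<forall>J B. finite J \<longrightarrow> (\<forall>i\<in>J. B i \<in> sets N) \<longrightarrow>
        emeasure M {\<omega>\<in>space M. W \<omega> \<in> A \<and> (\<forall>i\<in>J. Y \<omega> i \<in> B i)}
          = (\<integral>\<^sup>+\<omega>. indicator A (W \<omega>) * (\<Prod>i\<in>J. emeasure (\<kappa> i (W \<omega>)) (B i)) \<partial>M))"

section \<open>Special functions and distributions\<close>

definition lower_inc_Gamma :: "real \<Rightarrow> real \<Rightarrow> real" where
  "lower_inc_Gamma a x = (LINT t:{0<..x}|lborel. t powr (a - 1) * exp (- t))"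

definition upper_inc_Gamma :: "real \<Rightarrow> real \<Rightarrow> real" where
  "upper_inc_Gamma a x = (LINT t:{x<..}|lborel. t powr (a - 1) * exp (- t))"

definition gamma_law :: "real \<Rightarrow> real measure" where
  "gamma_law k = density lborel (\<lambda>x. ennreal (if 0 < x then x powr (k - 1) * exp (- x) / Gamma k else 0))"

section \<open>The network\<close>

datatype link_state = LOS | NLOS

text \<open>Receivers are the typical user and the eavesdroppers, the latter referred to by their index.\<close>

datatype receiver = User | Eve nat

fun receiver_pos :: "(nat \<Rightarrow> real^2) \<Rightarrow> receiver \<Rightarrow> real^2" where
  "receiver_pos z User = 0"
| "receiver_pos z (Eve k) = z k"

text \<open>A link is a pair of the index of a base station and a receiver.\<close>

abbreviation link_state_space :: "(nat \<times> receiver \<Rightarrow> link_state) measure" where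
  "link_state_space \<equiv> PiM UNIV (\<lambda>_. count_space UNIV)"

definition link_law :: "real \<Rightarrow> real \<Rightarrow> real \<Rightarrow> link_state pmf" where
  "link_law C D r = map_pmf (\<lambda>b. if b then LOS else NLOS) (bernoulli_pmf (if r \<le> D then C else 0))"

definition gain_law :: "real \<Rightarrow> real \<Rightarrow> real \<Rightarrow> real pmf" where
  "gain_law Ms ms \<theta>b = map_pmf (\<lambda>b. if b then Ms else ms) (bernoulli_pmf (\<theta>b / 180))"

definition path_loss :: "(link_state \<Rightarrow> real) \<Rightarrow> (link_state \<Rightarrow> real) \<Rightarrow> link_state \<Rightarrow> real^2 \<Rightarrow> real^2 \<Rightarrow> real" where
  "path_loss K \<alpha> j x y = K j * dist x y powr (- \<alpha> j)"

text \<open>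
  The index of the base station of largest path gain \<open>L\<close> towards the user. The maximiser exists and
  is unique almost surely; the least index is taken only to have a measurable choice.
\<close>

definition serving :: "(link_state \<Rightarrow> real) \<Rightarrow> (link_state \<Rightarrow> real) \<Rightarrow>
    (nat \<Rightarrow> real^2) \<Rightarrow> (nat \<times> receiver \<Rightarrow> link_state) \<Rightarrow> nat" where
  "serving K \<alpha> x s = (LEAST i. is_arg_max (\<lambda>i. path_loss K \<alpha> (s (i, User)) (x i) 0) (\<lambda>_. True) i)"

text \<open>
  Path gain from the serving base station to a receiver, for given locations \<open>x\<close> and \<open>z\<close> of base
  stations and eavesdroppers and link states \<open>s\<close>.
\<close>

definition serving_path_loss :: "(link_state \<Rightarrow> real) \<Rightarrow> (link_state \<Rightarrow> real) \<Rightarrow>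
    (nat \<Rightarrow> real^2) \<Rightarrow> (nat \<Rightarrow> real^2) \<Rightarrow> (nat \<times> receiver \<Rightarrow> link_state) \<Rightarrow> receiver \<Rightarrow> real" where
  "serving_path_loss K \<alpha> x z s v =
     (let i = serving K \<alpha> x s in path_loss K \<alpha> (s (i, v)) (x i) (receiver_pos z v))"

definition assoc_event :: "'w measure \<Rightarrow> (link_state \<Rightarrow> real) \<Rightarrow> (link_state \<Rightarrow> real) \<Rightarrow>
    ('w \<Rightarrow> nat \<Rightarrow> real^2) \<Rightarrow> ('w \<Rightarrow> nat \<times> receiver \<Rightarrow> link_state) \<Rightarrow> link_state \<Rightarrow> 'w set" where
  "assoc_event M K \<alpha> X S j = {\<omega>\<in>space M. S \<omega> (serving K \<alpha> (X \<omega>) (S \<omega>), User) = j}"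

text \<open>
  \<open>f j\<close> is a density of the distance to the serving base station, conditioned on association with
  a base station of state \<open>j\<close>; nothing is required of \<open>f j\<close> if this has probability \<open>0\<close>.
\<close>

definition serving_dist_densities :: "'w measure \<Rightarrow> (link_state \<Rightarrow> real) \<Rightarrow> (link_state \<Rightarrow> real) \<Rightarrow>
    ('w \<Rightarrow> nat \<Rightarrow> real^2) \<Rightarrow> ('w \<Rightarrow> nat \<times> receiver \<Rightarrow> link_state) \<Rightarrow> (link_state \<Rightarrow> real \<Rightarrow> real) \<Rightarrow> bool" where
  "serving_dist_densities M K \<alpha> X S f \<longleftrightarrow>
     (\<forall>j. measure M (assoc_event M K \<alpha> X S j) > 0 \<longrightarrow>
        (\<forall>r. 0 \<le> f j r) \<and>
        distributed (uniform_measure M (assoc_event M K \<alpha> X S j)) lborel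
          (\<lambda>\<omega>. norm (X \<omega> (serving K \<alpha> (X \<omega>) (S \<omega>)))) (\<lambda>r. ennreal (f j r)))"

text \<open>
  The ratio and the supremum over the eavesdroppers are taken in \<^typ>\<open>ennreal\<close>, so that
  the event is meaningful also on the null set where the supremum is infinite.
\<close>

definition secure_connectivity :: "'w measure \<Rightarrow> (link_state \<Rightarrow> real) \<Rightarrow> (link_state \<Rightarrow> real) \<Rightarrow> real \<Rightarrow>
    ('w \<Rightarrow> nat \<Rightarrow> real^2) \<Rightarrow> ('w \<Rightarrow> nat \<Rightarrow> real^2) \<Rightarrow> ('w \<Rightarrow> nat \<times> receiver \<Rightarrow> link_state) \<Rightarrow>
    ('w \<Rightarrow> receiver \<Rightarrow> real) \<Rightarrow> ('w \<Rightarrow> nat \<Rightarrow> real) \<Rightarrow> real" where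
  "secure_connectivity M K \<alpha> Ms X Z S H G =
     measure M {\<omega>\<in>space M.
       ennreal (Ms * serving_path_loss K \<alpha> (X \<omega>) (Z \<omega>) (S \<omega>) User * H \<omega> User)
         / (SUP k. ennreal (G \<omega> k * serving_path_loss K \<alpha> (X \<omega>) (Z \<omega>) (S \<omega>) (Eve k) * H \<omega> (Eve k)))
       \<ge> 1}"

section \<open>The closed form\<close>

definition Omega_in :: "real \<Rightarrow> (link_state \<Rightarrow> real) \<Rightarrow> (link_state \<Rightarrow> real) \<Rightarrow> (link_state \<Rightarrow> nat) \<Rightarrow>
    real pmf \<Rightarrow> link_state \<Rightarrow> real \<Rightarrow> real \<Rightarrow> real" where
  "Omega_in D K \<alpha> N p j V t =
     pmf p V * ((V * K j * t) powr (2 / \<alpha> j) / \<alpha> j) *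
     (\<Sum>m<N j. lower_inc_Gamma (real m + 2 / \<alpha> j) (D powr \<alpha> j / (V * K j * t)) / fact m)"

definition Omega_out :: "real \<Rightarrow> (link_state \<Rightarrow> real) \<Rightarrow> (link_state \<Rightarrow> real) \<Rightarrow> (link_state \<Rightarrow> nat) \<Rightarrow>
    real pmf \<Rightarrow> link_state \<Rightarrow> real \<Rightarrow> real \<Rightarrow> real" where
  "Omega_out D K \<alpha> N p j V t =
     pmf p V * ((V * K j * t) powr (2 / \<alpha> j) / \<alpha> j) *
     (\<Sum>m<N j. upper_inc_Gamma (real m + 2 / \<alpha> j) (D powr \<alpha> j / (V * K j * t)) / fact m)"

definition Lambda_E :: "real \<Rightarrow> real \<Rightarrow> real \<Rightarrow> (link_state \<Rightarrow> real) \<Rightarrow> (link_state \<Rightarrow> real) \<Rightarrow>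
    (link_state \<Rightarrow> nat) \<Rightarrow> real \<Rightarrow> real \<Rightarrow> real \<Rightarrow> real \<Rightarrow> real" where
  "Lambda_E lam_E C D K \<alpha> N Ms ms \<theta>b t =
     (let p = gain_law Ms ms \<theta>b; q = (\<lambda>j. case j of LOS \<Rightarrow> C | NLOS \<Rightarrow> 1 - C) in
      2 * pi * lam_E *
        ((\<Sum>j\<in>{LOS, NLOS}. q j * (Omega_in D K \<alpha> N p j Ms t + Omega_in D K \<alpha> N p j ms t))
         + Omega_out D K \<alpha> N p NLOS Ms t + Omega_out D K \<alpha> N p NLOS ms t))"

end

theory Submission
  imports Defs
begin

text \<open>
  Only the measurability of the serving index in the base stations and the link states to the user
  matters, not its maximality. Conditioning successively on everything but the antenna gains, the
  eavesdroppers' fading, the user's fading and the eavesdroppers' link states, the probability that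
  none of the first \<open>n\<close> eavesdroppers beats the user becomes the mean of a product
  \<open>\<Prod>k<n. p (Z k)\<close>, where \<open>p\<close> depends only on the serving distance, the state of the serving link
  and the fading of the user. As \<open>n\<close> tends to infinity, the probability generating functional of
  the Poisson process gives \<open>exp (- lam_E * \<integral>(1 - p))\<close>. The integrand is radial around the serving
  station, and the tail of a gamma law of integer shape is a Poisson sum, which turns the
  integral into incomplete gamma functions. The serving distance has a density because a Poisson
  process avoids null sets.
\<close>

section \<open>Conditionally independent families\<close>

text \<open>The model prescribes conditional laws only through finitely many coordinates and
  measurable rectangles, while the index of the serving station is random. Three tools bridge the
  gap: rectangles are upgraded to functions of the conditioning element and a coordinate
  (\<open>nn_integral_law\<close>), part of a family is moved into the conditioning
  (\<open>split\<close>), and an index that is a function of the conditioning element is substituted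
  (\<open>cond_indep_family_select\<close>). The order of conditioning is forced: gains are given
  relative to the fading, fading relative to the link states. The fading of the user is shared by
  all eavesdroppers and its law depends on the user's link state, so it survives as an inner
  integration variable \<open>y\<close>. A second obstacle is that the link states are given
  relative to \<open>X\<close> and \<open>Z\<close> jointly, whereas the generating functional needs
  \<open>Z\<close> independent of the serving link; \<open>distr_user_Z\<close> recovers this
  because the law of a link to the user does not involve \<open>Z\<close>. The argument
  \<open>t\<close> of \<open>Lambda_E\<close> is the reciprocal of the power received by the
  user.\<close>

lemma nn_integral_comp_eqI:
  assumes [measurable]: "W \<in> M \<rightarrow>\<^sub>M MW" "r \<in> borel_measurable M" "r' \<in> borel_measurable M"
    "g \<in> borel_measurable MW"
    and eq: "\<And>A. A \<in> sets MW \<Longrightarrow>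
      (\<integral>\<^sup>+\<omega>. indicator A (W \<omega>) * r \<omega> \<partial>M) = (\<integral>\<^sup>+\<omega>. indicator A (W \<omega>) * r' \<omega> \<partial>M)"
  shows "(\<integral>\<^sup>+\<omega>. g (W \<omega>) * r \<omega> \<partial>M) = (\<integral>\<^sup>+\<omega>. g (W \<omega>) * r' \<omega> \<partial>M)"
proof -
  have *: "(\<integral>\<^sup>+w. g w \<partial>distr (density M r) MW W) = (\<integral>\<^sup>+\<omega>. g (W \<omega>) * r \<omega> \<partial>M)"
    if [measurable]: "r \<in> borel_measurable M" "g \<in> borel_measurable MW" for r g
    by (simp add: nn_integral_distr nn_integral_density mult.commute)
  \<comment> \<open>Each side of the goal integrates \<open>g\<close> against the image under
    \<open>W\<close> of a weighted copy of \<open>M\<close>. The hypothesis \<open>eq\<close> says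
    that these two images agree on every measurable set, so \<open>g\<close> may be unbounded and no
    finiteness is required.\<close>
  have "distr (density M r) MW W = distr (density M r') MW W"
  proof (rule measure_eqI)
    fix A assume "A \<in> sets (distr (density M r) MW W)"
    then have [measurable]: "A \<in> sets MW" by simp
    show "emeasure (distr (density M r) MW W) A = emeasure (distr (density M r') MW W) A"
      using eq[of A] by (simp add: *[symmetric])
  qed simp
  then show ?thesis by (simp flip: *)
qed

text \<open>Rectangles form an intersection-stable generator that contains the whole space, so
  finiteness of one measure replaces an exhausting sequence.\<close>

lemma measure_eqI_pair_measure:
  assumes sets: "sets \<mu> = sets (P \<Otimes>\<^sub>M N)" "sets \<nu> = sets (P \<Otimes>\<^sub>M N)"
    and fin: "emeasure \<mu> (space \<mu>) \<noteq> \<infinity>"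
    and eq: "\<And>A B. A \<in> sets P \<Longrightarrow> B \<in> sets N \<Longrightarrow> emeasure \<mu> (A \<times> B) = emeasure \<nu> (A \<times> B)"
  shows "\<mu> = \<nu>"
proof (rule measure_eqI_generator_eq[where \<Omega>="space P \<times> space N"
      and E="{a \<times> b | a b. a \<in> sets P \<and> b \<in> sets N}" and A="\<lambda>_. space P \<times> space N"])
  show "Int_stable {a \<times> b |a b. a \<in> sets P \<and> b \<in> sets N}"
    by (rule Int_stable_pair_measure_generator)
  show "{a \<times> b |a b. a \<in> sets P \<and> b \<in> sets N} \<subseteq> Pow (space P \<times> space N)"
    by (auto dest: sets.sets_into_space)
  show "emeasure \<mu> (space P \<times> space N) \<noteq> \<infinity>"
    using fin sets_eq_imp_space_eq[OF sets(1)] by (simp add: space_pair_measure)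
qed (use eq sets in \<open>auto simp: sets_pair_measure\<close>)

text \<open>The variant for an infinite product in the second factor: finite-dimensional cylinders
  generate it and are stable under intersection. This is the form in which
  \<open>cond_indep_law\<close> can be tested.\<close>

lemma measure_eqI_pair_PiM:
  fixes \<mu> :: "('a \<times> ('i \<Rightarrow> 'b)) measure"
  assumes sets: "sets \<mu> = sets (P \<Otimes>\<^sub>M PiM UNIV (\<lambda>_. N))" "sets \<nu> = sets (P \<Otimes>\<^sub>M PiM UNIV (\<lambda>_. N))"
    and fin: "emeasure \<mu> (space \<mu>) \<noteq> \<infinity>"
    and eq: "\<And>A J B. A \<in> sets P \<Longrightarrow> finite J \<Longrightarrow> (\<And>i. i \<in> J \<Longrightarrow> B i \<in> sets N) \<Longrightarrow>
      emeasure \<mu> (A \<times> {y\<in>space (PiM UNIV (\<lambda>_. N)). \<forall>i\<in>J. y i \<in> B i}) =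
      emeasure \<nu> (A \<times> {y\<in>space (PiM UNIV (\<lambda>_. N)). \<forall>i\<in>J. y i \<in> B i})"
  shows "\<mu> = \<nu>"
proof -
  let ?Q = "PiM UNIV (\<lambda>_::'i. N)"
  let ?G = "prod_algebra UNIV (\<lambda>_::'i. N)"
  let ?E = "{a \<times> b | a b. a \<in> sets P \<and> b \<in> ?G}"
  have G: "?G \<subseteq> Pow (space ?Q)" "space ?Q \<in> ?G"
    using prod_algebra_sets_into_space[of UNIV "\<lambda>_::'i. N"] space_in_prod_algebra[of UNIV "\<lambda>_::'i. N"]
    by (simp_all add: space_PiM)
  have E: "?E \<subseteq> Pow (space P \<times> space ?Q)"
    using G by (auto dest: sets.sets_into_space)
  have "sets (P \<Otimes>\<^sub>M ?Q) = sets (sigma (space P \<times> space ?Q) ?E)"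
    using G by (intro sets_pair_eq[where Ca="{space P}" and Cb="{space ?Q}"])
       (auto simp: sets.sigma_sets_eq sets_PiM space_PiM dest: sets.sets_into_space)
  then have sig: "sets (P \<Otimes>\<^sub>M ?Q) = sigma_sets (space P \<times> space ?Q) ?E"
    using E by simp
  show ?thesis
  proof (rule measure_eqI_generator_eq[OF _ E, where A="\<lambda>_. space P \<times> space ?Q"])
    show "Int_stable ?E"
      unfolding Int_stable_def
    proof safe
      fix a b c d assume "a \<in> sets P" "c \<in> sets P" "b \<in> ?G" "d \<in> ?G"
      then show "\<exists>aa ba. a \<times> b \<inter> c \<times> d = aa \<times> ba \<and> aa \<in> sets P \<and> ba \<in> ?G"
        using Int_stable_prod_algebra[of UNIV "\<lambda>_::'i. N"]
        by (intro exI[of _ "a \<inter> c"] exI[of _ "b \<inter> d"]) (auto simp: Int_stable_def)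
    qed
    show "emeasure \<mu> X = emeasure \<nu> X" if X_E: "X \<in> ?E" for X
    proof -
      obtain A b where X: "X = A \<times> b" "A \<in> sets P" "b \<in> ?G" using X_E by auto
      obtain J B where J: "b = prod_emb UNIV (\<lambda>_. N) J (PiE J B)" "finite J" "\<And>i. i \<in> J \<Longrightarrow> B i \<in> sets N"
        using prod_algebraE[OF X(3)] by metis
      have "b = {y\<in>space ?Q. \<forall>i\<in>J. y i \<in> B i}"
        unfolding J(1) by (auto simp: prod_emb_def space_PiM PiE_iff)
      then show ?thesis using eq[OF X(2) J(2,3)] X(1) by simp
    qed
    show "emeasure \<mu> (space P \<times> space ?Q) \<noteq> \<infinity>"
      using fin sets_eq_imp_space_eq[OF sets(1)] by (simp add: space_pair_measure)
  qed (use sig sets G in auto)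
qed

lemma sets_Collect_finite_Ball:
  assumes "finite J" "\<And>i. i \<in> J \<Longrightarrow> f i \<in> M \<rightarrow>\<^sub>M N" "\<And>i. i \<in> J \<Longrightarrow> B i \<in> sets N"
  shows "{\<omega>\<in>space M. \<forall>i\<in>J. f i \<omega> \<in> B i} \<in> sets M"
proof -
  have "{\<omega>\<in>space M. f i \<omega> \<in> B i} \<in> sets M" if "i \<in> J" for i
    using measurable_sets[OF assms(2)[OF that] assms(3)[OF that]] by (simp add: vimage_def Int_def conj_commute)
  then show ?thesis using assms(1) by (intro sets.sets_Collect_finite_All) auto
qed

lemma prod_indicator_Ball:
  "finite J \<Longrightarrow> (\<Prod>i\<in>J. indicator (B i) (y i) :: ennreal) = (if \<forall>i\<in>J. y i \<in> B i then 1 else 0)"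
  by (induction J rule: finite_induct) (auto simp: indicator_def)

lemma cond_indep_law_cong:
  assumes "cond_indep_law M MW W N Y \<kappa>"
    and "\<And>i w B. w \<in> space MW \<Longrightarrow> B \<in> sets N \<Longrightarrow> emeasure (\<kappa> i w) B = emeasure (\<kappa>' i w) B"
  shows "cond_indep_law M MW W N Y \<kappa>'"
proof -
  have W: "W \<omega> \<in> space MW" if "\<omega> \<in> space M" for \<omega>
    using assms(1) that by (auto simp: cond_indep_law_def dest: measurable_space)
  have "(\<integral>\<^sup>+\<omega>. indicator A (W \<omega>) * (\<Prod>i\<in>J. emeasure (\<kappa> i (W \<omega>)) (B i)) \<partial>M)
      = (\<integral>\<^sup>+\<omega>. indicator A (W \<omega>) * (\<Prod>i\<in>J. emeasure (\<kappa>' i (W \<omega>)) (B i)) \<partial>M)"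
    if "\<forall>i\<in>J. B i \<in> sets N" for A J B
    using that assms(2) W by (intro nn_integral_cong arg_cong2[where f="(*)"] prod.cong) auto
  then show ?thesis
    using assms(1) unfolding cond_indep_law_def by auto
qed

text \<open>Adds measurability of the kernels, which \<open>cond_indep_law\<close> does not contain
  and without which the integrals over \<open>\<kappa> i (W \<omega>)\<close> could not be
  integrated again.\<close>

locale cond_indep_family = prob_space M
  for M :: "'w measure" and MW :: "'c measure" and W :: "'w \<Rightarrow> 'c"
    and N :: "'b measure" and Y :: "'w \<Rightarrow> 'i \<Rightarrow> 'b" and \<kappa> :: "'i \<Rightarrow> 'c \<Rightarrow> 'b measure" +
  assumes law: "cond_indep_law M MW W N Y \<kappa>"
    and kernel [measurable]: "\<And>i. \<kappa> i \<in> MW \<rightarrow>\<^sub>M subprob_algebra N"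
begin

lemma W_measurable [measurable]: "W \<in> M \<rightarrow>\<^sub>M MW"
  and Y_measurable: "Y \<in> M \<rightarrow>\<^sub>M PiM UNIV (\<lambda>_. N)"
  using law by (auto simp: cond_indep_law_def)

lemma Y_component [measurable]: "(\<lambda>\<omega>. Y \<omega> i) \<in> M \<rightarrow>\<^sub>M N"
  using measurable_compose[OF Y_measurable measurable_component_singleton[of i UNIV]] by simp

lemma law_indicator:
  assumes [measurable]: "A \<in> sets MW" and J: "finite J" and B: "\<And>i. i \<in> J \<Longrightarrow> B i \<in> sets N"
  shows "(\<integral>\<^sup>+\<omega>. indicator A (W \<omega>) * (\<Prod>i\<in>J. indicator (B i) (Y \<omega> i)) \<partial>M)
      = (\<integral>\<^sup>+\<omega>. indicator A (W \<omega>) * (\<Prod>i\<in>J. emeasure (\<kappa> i (W \<omega>)) (B i)) \<partial>M)"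
proof -
  have [measurable]: "{\<omega>\<in>space M. \<forall>i\<in>J. Y \<omega> i \<in> B i} \<in> sets M"
    using J Y_component B by (rule sets_Collect_finite_Ball)
  have "emeasure M {\<omega>\<in>space M. W \<omega> \<in> A \<and> (\<forall>i\<in>J. Y \<omega> i \<in> B i)} =
      (\<integral>\<^sup>+\<omega>. indicator {\<omega>\<in>space M. W \<omega> \<in> A \<and> (\<forall>i\<in>J. Y \<omega> i \<in> B i)} \<omega> \<partial>M)"
    using J B by (intro nn_integral_indicator[symmetric]) measurable
  also have "\<dots> = (\<integral>\<^sup>+\<omega>. indicator A (W \<omega>) * (\<Prod>i\<in>J. indicator (B i) (Y \<omega> i)) \<partial>M)"
    by (intro nn_integral_cong) (auto simp: prod_indicator_Ball J indicator_def)
  finally show ?thesis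
    using law[unfolded cond_indep_law_def, THEN conjunct2, THEN conjunct2, rule_format, OF assms(1) J, of B] B
    by simp
qed

lemma nn_integral_law_indicator:
  assumes [measurable]: "g \<in> borel_measurable MW" and J: "finite J" and B: "\<And>i. i \<in> J \<Longrightarrow> B i \<in> sets N"
  shows "(\<integral>\<^sup>+\<omega>. g (W \<omega>) * (\<Prod>i\<in>J. indicator (B i) (Y \<omega> i)) \<partial>M)
      = (\<integral>\<^sup>+\<omega>. g (W \<omega>) * (\<Prod>i\<in>J. emeasure (\<kappa> i (W \<omega>)) (B i)) \<partial>M)"
proof (rule nn_integral_comp_eqI[where MW=MW and W=W])
  show "(\<lambda>\<omega>. \<Prod>i\<in>J. indicator (B i) (Y \<omega> i) :: ennreal) \<in> borel_measurable M"
    using B by (intro borel_measurable_prod_ennreal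
        measurable_compose[OF Y_component borel_measurable_indicator])
  show "(\<lambda>\<omega>. \<Prod>i\<in>J. emeasure (\<kappa> i (W \<omega>)) (B i)) \<in> borel_measurable M"
    using B by (intro borel_measurable_prod_ennreal) measurable
qed (use law_indicator J B in auto)


lemma sets_kernel: "w \<in> space MW \<Longrightarrow> sets (\<kappa> i w) = sets N"
  using measurable_space[OF kernel, of w i] by (simp add: space_subprob_algebra)

lemma measurable_nn_integral_kernel [measurable]:
  assumes [measurable]: "f \<in> borel_measurable (MW \<Otimes>\<^sub>M N)"
  shows "(\<lambda>w. \<integral>\<^sup>+y. f (w, y) \<partial>\<kappa> i w) \<in> borel_measurable MW"
  by (rule nn_integral_measurable_subprob_algebra2[where N=N]) measurable

lemma emeasure_measurable_kernel:
  "B \<in> sets N \<Longrightarrow> (\<lambda>w. emeasure (\<kappa> i w) B) \<in> borel_measurable MW"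
  by measurable

text \<open>Induction on \<open>J\<close>, the coordinates seen through functions; \<open>K\<close>
  holds the coordinates still seen through sets. To treat a new coordinate \<open>i\<close>, it is
  first placed in \<open>K\<close> with an arbitrary set, where the induction hypothesis applies,
  and uniqueness of measures then passes from sets to \<open>f i\<close>. The bounds by 1 keep the
  measures involved finite.\<close>

lemma nn_integral_law_bounded:
  assumes "finite J" "finite K" "J \<inter> K = {}" "\<And>i. i \<in> K \<Longrightarrow> B i \<in> sets N"
    and "g \<in> borel_measurable MW" "\<And>w. g w \<le> 1"
    and "\<And>i. i \<in> J \<Longrightarrow> f i \<in> borel_measurable (MW \<Otimes>\<^sub>M N)" "\<And>i z. i \<in> J \<Longrightarrow> f i z \<le> 1"
  shows "(\<integral>\<^sup>+\<omega>. g (W \<omega>) * ((\<Prod>i\<in>K. indicator (B i) (Y \<omega> i)) * (\<Prod>i\<in>J. f i (W \<omega>, Y \<omega> i))) \<partial>M)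
    = (\<integral>\<^sup>+\<omega>. g (W \<omega>) * ((\<Prod>i\<in>K. emeasure (\<kappa> i (W \<omega>)) (B i)) *
          (\<Prod>i\<in>J. \<integral>\<^sup>+y. f i (W \<omega>, y) \<partial>\<kappa> i (W \<omega>))) \<partial>M)"
  using assms
proof (induction J arbitrary: K B g rule: finite_induct)
  case empty
  then show ?case by (simp add: nn_integral_law_indicator)
next
  case (insert i J)
  note [measurable] = insert.prems(4)
  have f [measurable]: "f i \<in> borel_measurable (MW \<Otimes>\<^sub>M N)"
    and fJ: "\<And>j. j \<in> J \<Longrightarrow> f j \<in> borel_measurable (MW \<Otimes>\<^sub>M N)" "\<And>j z. j \<in> J \<Longrightarrow> f j z \<le> 1"
    using insert.prems by auto
  have i: "i \<notin> J" "i \<notin> K" using insert by auto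
  define R where "R \<omega> = g (W \<omega>) * ((\<Prod>i\<in>K. indicator (B i) (Y \<omega> i)) * (\<Prod>i\<in>J. f i (W \<omega>, Y \<omega> i)))" for \<omega>
  define r' where "r' w = g w * ((\<Prod>i\<in>K. emeasure (\<kappa> i w) (B i)) *
          (\<Prod>i\<in>J. \<integral>\<^sup>+y. f i (w, y) \<partial>\<kappa> i w))" for w
  have "(\<lambda>\<omega>. \<Prod>i\<in>K. indicator (B i) (Y \<omega> i) :: ennreal) \<in> borel_measurable M"
    using insert.prems(3) by (intro borel_measurable_prod_ennreal
        measurable_compose[OF Y_component borel_measurable_indicator])
  moreover have "(\<lambda>\<omega>. \<Prod>i\<in>J. f i (W \<omega>, Y \<omega> i)) \<in> borel_measurable M"
    by (intro borel_measurable_prod_ennreal measurable_compose[OF _ fJ(1)]) measurable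
  ultimately have R [measurable]: "R \<in> borel_measurable M"
    unfolding R_def by measurable
  have "(\<lambda>w. \<Prod>i\<in>K. emeasure (\<kappa> i w) (B i)) \<in> borel_measurable MW"
    using insert.prems(3) by (intro borel_measurable_prod_ennreal) measurable
  moreover have "(\<lambda>w. \<Prod>i\<in>J. \<integral>\<^sup>+y. f i (w, y) \<partial>\<kappa> i w) \<in> borel_measurable MW"
    by (intro borel_measurable_prod_ennreal measurable_nn_integral_kernel fJ(1))
  ultimately have r' [measurable]: "r' \<in> borel_measurable MW"
    unfolding r'_def by measurable
  have R1: "R \<omega> \<le> 1" for \<omega>
    unfolding R_def using insert.prems(5) fJ(2)
    by (intro mult_le_one prod_le_1 conjI) (auto simp: indicator_def)
  \<comment> \<open>\<open>\<mu>\<close> is the law of \<open>(W, Y i)\<close> weighted by all other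
    factors; in \<open>\<nu>\<close> the coordinate is a fresh draw from \<open>\<kappa> i W\<close>
    and the other factors are already integrated out. The claim is the equality of their integrals
    of \<open>f i\<close>.\<close>
  define \<mu> where "\<mu> = distr (density M R) (MW \<Otimes>\<^sub>M N) (\<lambda>\<omega>. (W \<omega>, Y \<omega> i))"
  define k where "k w = distr (\<kappa> i w) (MW \<Otimes>\<^sub>M N) (\<lambda>y. (w, y))" for w
  define \<nu> where "\<nu> = distr (density M (\<lambda>\<omega>. r' (W \<omega>))) MW W \<bind> k"
  have k [measurable]: "k \<in> MW \<rightarrow>\<^sub>M subprob_algebra (MW \<Otimes>\<^sub>M N)"
    unfolding k_def by (rule measurable_distr2[where M=N]) measurable
  have MW_ne: "space MW \<noteq> {}"
    using measurable_space[OF W_measurable] not_empty by auto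
  have pair: "(\<lambda>y. (w, y)) \<in> \<kappa> i w \<rightarrow>\<^sub>M MW \<Otimes>\<^sub>M N" if "w \<in> space MW" for w
    using measurable_Pair1'[OF that] by (simp add: measurable_cong_sets[OF sets_kernel[OF that] refl])
  have \<mu>: "(\<integral>\<^sup>+z. h z \<partial>\<mu>) = (\<integral>\<^sup>+\<omega>. R \<omega> * h (W \<omega>, Y \<omega> i) \<partial>M)"
    if [measurable]: "h \<in> borel_measurable (MW \<Otimes>\<^sub>M N)" for h
    unfolding \<mu>_def by (simp add: nn_integral_distr nn_integral_density)
  have \<nu>: "(\<integral>\<^sup>+z. h z \<partial>\<nu>) = (\<integral>\<^sup>+\<omega>. r' (W \<omega>) * (\<integral>\<^sup>+y. h (W \<omega>, y) \<partial>\<kappa> i (W \<omega>)) \<partial>M)"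
    if h [measurable]: "h \<in> borel_measurable (MW \<Otimes>\<^sub>M N)" for h
  proof -
    have "(\<integral>\<^sup>+z. h z \<partial>\<nu>) = (\<integral>\<^sup>+w. \<integral>\<^sup>+z. h z \<partial>k w \<partial>distr (density M (\<lambda>\<omega>. r' (W \<omega>))) MW W)"
      unfolding \<nu>_def by (rule nn_integral_bind[OF h]) measurable
    also have "\<dots> = (\<integral>\<^sup>+w. (\<integral>\<^sup>+y. h (w, y) \<partial>\<kappa> i w) \<partial>distr (density M (\<lambda>\<omega>. r' (W \<omega>))) MW W)"
      by (intro nn_integral_cong) (simp add: k_def nn_integral_distr pair)
    finally show ?thesis by (simp add: nn_integral_distr nn_integral_density)
  qed
  have "\<mu> = \<nu>"
  proof (rule measure_eqI_pair_measure)
    show sets_\<mu>: "sets \<mu> = sets (MW \<Otimes>\<^sub>M N)" by (simp add: \<mu>_def)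
    show sets_\<nu>: "sets \<nu> = sets (MW \<Otimes>\<^sub>M N)"
      unfolding \<nu>_def using MW_ne measurable_space[OF k]
      by (intro sets_bind) (auto simp: space_subprob_algebra)
    have "emeasure \<mu> (space \<mu>) = (\<integral>\<^sup>+z. 1 \<partial>\<mu>)" by simp
    also have "\<dots> \<le> (\<integral>\<^sup>+\<omega>. 1 \<partial>M)" unfolding \<mu>[OF borel_measurable_const] by (intro nn_integral_mono) (simp add: R1)
    also have "\<dots> < \<infinity>" by (simp add: emeasure_space_1)
    finally show "emeasure \<mu> (space \<mu>) \<noteq> \<infinity>" by simp
    fix A C assume AC [measurable]: "A \<in> sets MW" "C \<in> sets N"
    have ind: "indicator (A \<times> C) (w, y) = (indicator A w * indicator C y :: ennreal)" for w y
      by (simp add: indicator_times)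
    \<comment> \<open>A rectangle \<open>A \<times> C\<close> is encoded by absorbing the indicator
      of \<open>A\<close> into the weight \<open>g\<close> and attaching the set \<open>C\<close> to
      the index \<open>i\<close>.\<close>
    have IH: "(\<integral>\<^sup>+\<omega>. (g (W \<omega>) * indicator A (W \<omega>)) * ((\<Prod>j\<in>insert i K. indicator ((B(i := C)) j) (Y \<omega> j)) * (\<Prod>i\<in>J. f i (W \<omega>, Y \<omega> i))) \<partial>M)
      = (\<integral>\<^sup>+\<omega>. (g (W \<omega>) * indicator A (W \<omega>)) * ((\<Prod>j\<in>insert i K. emeasure (\<kappa> j (W \<omega>)) ((B(i := C)) j)) *
          (\<Prod>i\<in>J. \<integral>\<^sup>+y. f i (W \<omega>, y) \<partial>\<kappa> i (W \<omega>))) \<partial>M)"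
      by (rule insert.IH) (use insert.prems insert.hyps fJ AC in \<open>auto simp: indicator_def\<close>)
    have "emeasure \<mu> (A \<times> C) = (\<integral>\<^sup>+z. indicator (A \<times> C) z \<partial>\<mu>)" using AC by (simp add: sets_\<mu>)
    also have "\<dots> = (\<integral>\<^sup>+\<omega>. (g (W \<omega>) * indicator A (W \<omega>)) * ((\<Prod>j\<in>insert i K. indicator ((B(i := C)) j) (Y \<omega> j)) * (\<Prod>i\<in>J. f i (W \<omega>, Y \<omega> i))) \<partial>M)"
    proof -
      have K: "(\<Prod>j\<in>insert i K. indicator ((B(i := C)) j) (Y \<omega> j)) =
          (indicator C (Y \<omega> i) * (\<Prod>j\<in>K. indicator (B j) (Y \<omega> j)) :: ennreal)" for \<omega>
        unfolding prod.insert[OF insert.prems(1) i(2)]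
        using i by (intro arg_cong2[where f="(*)"] prod.cong) auto
      show ?thesis
        unfolding K by (subst \<mu>) (simp_all add: ind R_def mult_ac)
    qed
    also note IH
    also have "(\<integral>\<^sup>+\<omega>. (g (W \<omega>) * indicator A (W \<omega>)) * ((\<Prod>j\<in>insert i K. emeasure (\<kappa> j (W \<omega>)) ((B(i := C)) j)) *
          (\<Prod>i\<in>J. \<integral>\<^sup>+y. f i (W \<omega>, y) \<partial>\<kappa> i (W \<omega>))) \<partial>M) =
        (\<integral>\<^sup>+\<omega>. r' (W \<omega>) * (indicator A (W \<omega>) * emeasure (\<kappa> i (W \<omega>)) C) \<partial>M)"
    proof -
      have K: "(\<Prod>j\<in>insert i K. emeasure (\<kappa> j w) ((B(i := C)) j)) =
          emeasure (\<kappa> i w) C * (\<Prod>j\<in>K. emeasure (\<kappa> j w) (B j))" for w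
        unfolding prod.insert[OF insert.prems(1) i(2)]
        using i by (intro arg_cong2[where f="(*)"] prod.cong) auto
      show ?thesis
        unfolding K r'_def by (simp add: mult_ac)
    qed
    also have "\<dots> = (\<integral>\<^sup>+z. indicator (A \<times> C) z \<partial>\<nu>)"
      by (subst \<nu>, measurable, intro nn_integral_cong)
         (simp add: ind nn_integral_cmult sets_kernel measurable_space[OF W_measurable] measurable_cong_sets[OF sets_kernel refl])
    also have "\<dots> = emeasure \<nu> (A \<times> C)" using AC by (simp add: sets_\<nu>)
    finally show "emeasure \<mu> (A \<times> C) = emeasure \<nu> (A \<times> C)" .
  qed
  then have "(\<integral>\<^sup>+z. f i z \<partial>\<mu>) = (\<integral>\<^sup>+z. f i z \<partial>\<nu>)" by simp
  then show ?case
    using i insert.hyps unfolding \<mu>[OF f] \<nu>[OF f] by (simp add: R_def r'_def mult_ac)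
qed

text \<open>Only the factors \<open>f i\<close> need a bound: for indicator weights the bounded
  version applies, and \<open>nn_integral_comp_eqI\<close> extends the identity to every measurable
  weight \<open>g\<close>.\<close>

lemma nn_integral_law:
  assumes J: "finite J" and [measurable]: "g \<in> borel_measurable MW"
    and f: "\<And>i. i \<in> J \<Longrightarrow> f i \<in> borel_measurable (MW \<Otimes>\<^sub>M N)" "\<And>i z. i \<in> J \<Longrightarrow> f i z \<le> 1"
  shows "(\<integral>\<^sup>+\<omega>. g (W \<omega>) * (\<Prod>i\<in>J. f i (W \<omega>, Y \<omega> i)) \<partial>M)
    = (\<integral>\<^sup>+\<omega>. g (W \<omega>) * (\<Prod>i\<in>J. \<integral>\<^sup>+y. f i (W \<omega>, y) \<partial>\<kappa> i (W \<omega>)) \<partial>M)"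
proof (rule nn_integral_comp_eqI[where MW=MW and W=W])
  show "(\<lambda>\<omega>. \<Prod>i\<in>J. f i (W \<omega>, Y \<omega> i)) \<in> borel_measurable M"
    by (intro borel_measurable_prod_ennreal measurable_compose[OF _ f(1)]) measurable
  show "(\<lambda>\<omega>. \<Prod>i\<in>J. \<integral>\<^sup>+y. f i (W \<omega>, y) \<partial>\<kappa> i (W \<omega>)) \<in> borel_measurable M"
    by (intro borel_measurable_prod_ennreal measurable_compose[OF W_measurable measurable_nn_integral_kernel] f(1))
  fix A assume "A \<in> sets MW"
  then show "(\<integral>\<^sup>+\<omega>. indicator A (W \<omega>) * (\<Prod>i\<in>J. f i (W \<omega>, Y \<omega> i)) \<partial>M) =
    (\<integral>\<^sup>+\<omega>. indicator A (W \<omega>) * (\<Prod>i\<in>J. \<integral>\<^sup>+y. f i (W \<omega>, y) \<partial>\<kappa> i (W \<omega>)) \<partial>M)"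
    using nn_integral_law_bounded[OF J finite.emptyI, of undefined "indicator A" f] f
    by (simp add: indicator_def)
qed simp_all

text \<open>Given \<open>W\<close> the coordinates are independent, so learning those along
  \<open>u\<close> does not alter the law of those along \<open>e\<close>. The kernels are therefore
  unchanged and read only the first component of the enlarged conditioning element.\<close>

lemma split:
  fixes u :: "'j \<Rightarrow> 'i" and e :: "'k \<Rightarrow> 'i"
  assumes inj: "inj u" "inj e" "range u \<inter> range e = {}"
  shows "cond_indep_family M (MW \<Otimes>\<^sub>M PiM UNIV (\<lambda>_. N)) (\<lambda>\<omega>. (W \<omega>, \<lambda>j. Y \<omega> (u j))) N
    (\<lambda>\<omega> k. Y \<omega> (e k)) (\<lambda>k z. \<kappa> (e k) (fst z))"
proof
  let ?U = "\<lambda>\<omega> j. Y \<omega> (u j)" and ?P = "MW \<Otimes>\<^sub>M PiM UNIV (\<lambda>_. N)"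
  have U [measurable]: "?U \<in> M \<rightarrow>\<^sub>M PiM UNIV (\<lambda>_. N)"
    by (rule measurable_PiM_single') (auto dest: measurable_space[OF Y_component])
  show "(\<lambda>z. \<kappa> (e i) (fst z)) \<in> ?P \<rightarrow>\<^sub>M subprob_algebra N" for i :: 'k
    by measurable
  show "cond_indep_law M ?P (\<lambda>\<omega>. (W \<omega>, ?U \<omega>)) N (\<lambda>\<omega> k. Y \<omega> (e k)) (\<lambda>k z. \<kappa> (e k) (fst z))"
    unfolding cond_indep_law_def
  proof (intro conjI ballI allI impI)
    show "(\<lambda>\<omega>. (W \<omega>, ?U \<omega>)) \<in> M \<rightarrow>\<^sub>M ?P" by measurable
    show "(\<lambda>\<omega> k. Y \<omega> (e k)) \<in> M \<rightarrow>\<^sub>M PiM UNIV (\<lambda>_. N)"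
      by (rule measurable_PiM_single') (auto dest: measurable_space[OF Y_component])
    fix A :: "('c \<times> ('j \<Rightarrow> 'b)) set" and J :: "'k set" and B assume A [measurable]: "A \<in> sets ?P" and J: "finite J" and "\<forall>i\<in>J. B i \<in> sets N"
    then have B: "\<And>i. i \<in> J \<Longrightarrow> B i \<in> sets N" by auto
    define r where "r \<omega> = (\<Prod>i\<in>J. indicator (B i) (Y \<omega> (e i)) :: ennreal)" for \<omega>
    define r' where "r' w = (\<Prod>i\<in>J. emeasure (\<kappa> (e i) w) (B i))" for w
    have r [measurable]: "r \<in> borel_measurable M"
      unfolding r_def using B by (intro borel_measurable_prod_ennreal
          measurable_compose[OF Y_component borel_measurable_indicator])
    have r' [measurable]: "r' \<in> borel_measurable MW"
      unfolding r'_def using B by (intro borel_measurable_prod_ennreal) measurable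
    \<comment> \<open>Both are weighted laws of the new conditioning element: \<open>\<mu>\<close>
      carries the indicators of the coordinates along \<open>e\<close>, \<open>\<nu>\<close> their
      kernel probabilities. On a cylinder, the law is applied to both families at once and then
      undone for the coordinates along \<open>u\<close>.\<close>
    define \<mu> where "\<mu> = distr (density M r) ?P (\<lambda>\<omega>. (W \<omega>, ?U \<omega>))"
    define \<nu> where "\<nu> = distr (density M (\<lambda>\<omega>. r' (W \<omega>))) ?P (\<lambda>\<omega>. (W \<omega>, ?U \<omega>))"
    have \<mu>: "emeasure \<mu> X = (\<integral>\<^sup>+\<omega>. indicator X (W \<omega>, ?U \<omega>) * r \<omega> \<partial>M)"
      and \<nu>: "emeasure \<nu> X = (\<integral>\<^sup>+\<omega>. indicator X (W \<omega>, ?U \<omega>) * r' (W \<omega>) \<partial>M)"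
      if [measurable]: "X \<in> sets ?P" for X
    proof -
      have "emeasure \<mu> X = (\<integral>\<^sup>+z. indicator X z \<partial>\<mu>)" using that by (simp add: \<mu>_def)
      then show "emeasure \<mu> X = (\<integral>\<^sup>+\<omega>. indicator X (W \<omega>, ?U \<omega>) * r \<omega> \<partial>M)"
        by (simp add: \<mu>_def nn_integral_distr nn_integral_density mult.commute del: nn_integral_indicator)
      have "emeasure \<nu> X = (\<integral>\<^sup>+z. indicator X z \<partial>\<nu>)" using that by (simp add: \<nu>_def)
      then show "emeasure \<nu> X = (\<integral>\<^sup>+\<omega>. indicator X (W \<omega>, ?U \<omega>) * r' (W \<omega>) \<partial>M)"
        by (simp add: \<nu>_def nn_integral_distr nn_integral_density mult.commute del: nn_integral_indicator)
    qed
    have "\<mu> = \<nu>"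
    proof (rule measure_eqI_pair_PiM)
      show "sets \<mu> = sets ?P" "sets \<nu> = sets ?P" by (simp_all add: \<mu>_def \<nu>_def)
      have "emeasure \<mu> (space \<mu>) = (\<integral>\<^sup>+\<omega>. indicator (space ?P) (W \<omega>, ?U \<omega>) * r \<omega> \<partial>M)"
        using \<mu>[OF sets.top] by (simp add: \<mu>_def)
      also have "\<dots> \<le> (\<integral>\<^sup>+\<omega>. 1 \<partial>M)"
        unfolding r_def by (intro nn_integral_mono mult_le_one prod_le_1 conjI) (auto simp: indicator_def)
      also have "\<dots> < \<infinity>" by (simp add: emeasure_space_1)
      finally show "emeasure \<mu> (space \<mu>) \<noteq> \<infinity>" by simp
      fix A0 and J' :: "'j set" and B' assume A0 [measurable]: "A0 \<in> sets MW" and J': "finite J'" and B': "\<And>i. i \<in> J' \<Longrightarrow> B' i \<in> sets N"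
      let ?Cyl = "{y\<in>space (PiM UNIV (\<lambda>_. N)). \<forall>i\<in>J'. y i \<in> B' i}"
      have [measurable]: "?Cyl \<in> sets (PiM UNIV (\<lambda>_. N))"
        using J' measurable_component_singleton B' by (rule sets_Collect_finite_Ball) simp_all
      \<comment> \<open>Merges the two families of test sets into one family on the original index
        set; injectivity and disjoint ranges make this consistent.\<close>
      define B2 where "B2 i = (if i \<in> range u then B' (inv u i) else B (inv e i))" for i
      have B2: "B2 (u j) = B' j" "B2 (e k) = B k" for j k
        using inj by (auto simp: B2_def)
      have disj: "u ` J' \<inter> e ` J = {}" using inj(3) by auto
      have inj_on: "inj_on u J'" "inj_on e J" using inj by (auto intro: inj_on_subset)
      have cyl: "indicator (A0 \<times> ?Cyl) (W \<omega>, ?U \<omega>) = (indicator A0 (W \<omega>) * (\<Prod>i\<in>u ` J'. indicator (B2 i) (Y \<omega> i)) :: ennreal)"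
        if "\<omega> \<in> space M" for \<omega>
        using measurable_space[OF U that]
        by (auto simp: prod.reindex inj_on B2 prod_indicator_Ball J' indicator_def)
      have "emeasure \<mu> (A0 \<times> ?Cyl) = (\<integral>\<^sup>+\<omega>. indicator A0 (W \<omega>) * (\<Prod>i\<in>u ` J' \<union> e ` J. indicator (B2 i) (Y \<omega> i)) \<partial>M)"
        using J J' disj by (subst \<mu>)
          (auto intro!: nn_integral_cong simp: cyl prod.union_disjoint r_def prod.reindex inj_on B2 mult_ac)
      also have "\<dots> = (\<integral>\<^sup>+\<omega>. indicator A0 (W \<omega>) * (\<Prod>i\<in>u ` J' \<union> e ` J. emeasure (\<kappa> i (W \<omega>)) (B2 i)) \<partial>M)"
        using J J' B B' by (intro law_indicator) (auto simp: B2)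
      also have "\<dots> = (\<integral>\<^sup>+\<omega>. (indicator A0 (W \<omega>) * r' (W \<omega>)) * (\<Prod>i\<in>u ` J'. emeasure (\<kappa> i (W \<omega>)) (B2 i)) \<partial>M)"
        using J J' disj by (auto intro!: nn_integral_cong simp: prod.union_disjoint r'_def prod.reindex inj_on B2 mult_ac)
      also have "\<dots> = (\<integral>\<^sup>+\<omega>. (indicator A0 (W \<omega>) * r' (W \<omega>)) * (\<Prod>i\<in>u ` J'. indicator (B2 i) (Y \<omega> i)) \<partial>M)"
        using J' B' by (intro nn_integral_law_indicator[symmetric]) (auto simp: B2)
      also have "\<dots> = emeasure \<nu> (A0 \<times> ?Cyl)"
        by (subst \<nu>) (auto intro!: nn_integral_cong simp: cyl mult_ac)
      finally show "emeasure \<mu> (A0 \<times> ?Cyl) = emeasure \<nu> (A0 \<times> ?Cyl)" .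
    qed
    then have eq: "emeasure \<mu> A = emeasure \<nu> A" by simp
    have [measurable]: "{\<omega>\<in>space M. \<forall>i\<in>J. Y \<omega> (e i) \<in> B i} \<in> sets M"
      using J Y_component B by (rule sets_Collect_finite_Ball)
    have "emeasure M {\<omega>\<in>space M. (W \<omega>, ?U \<omega>) \<in> A \<and> (\<forall>i\<in>J. Y \<omega> (e i) \<in> B i)} =
        (\<integral>\<^sup>+\<omega>. indicator {\<omega>\<in>space M. (W \<omega>, ?U \<omega>) \<in> A \<and> (\<forall>i\<in>J. Y \<omega> (e i) \<in> B i)} \<omega> \<partial>M)"
      using J B by (intro nn_integral_indicator[symmetric]) measurable
    also have "\<dots> = emeasure \<mu> A"
      unfolding \<mu>[OF A] r_def
      by (intro nn_integral_cong) (auto simp: prod_indicator_Ball J indicator_def)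
    finally show "emeasure M {\<omega>\<in>space M. (W \<omega>, ?U \<omega>) \<in> A \<and> (\<forall>i\<in>J. Y \<omega> (e i) \<in> B i)} =
      (\<integral>\<^sup>+\<omega>. indicator A (W \<omega>, ?U \<omega>) * (\<Prod>i\<in>J. emeasure (\<kappa> (e i) (fst (W \<omega>, ?U \<omega>))) (B i)) \<partial>M)"
      unfolding eq \<nu>[OF A] r'_def by simp
  qed
qed

end

text \<open>On the event \<open>I W = i\<close> the random index is a constant and the law of the
  coordinates \<open>(i, k)\<close> applies; the countably many values of \<open>I\<close> are
  summed. It is essential that \<open>I\<close> depends on the conditioning element alone.\<close>

lemma cond_indep_family_select:
  fixes Y :: "'w \<Rightarrow> nat \<times> 'k \<Rightarrow> 'b"
  assumes "cond_indep_family M MW W N Y \<kappa>" and I [measurable]: "I \<in> MW \<rightarrow>\<^sub>M count_space UNIV"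
  shows "cond_indep_family M MW W N (\<lambda>\<omega> k. Y \<omega> (I (W \<omega>), k)) (\<lambda>k w. \<kappa> (I w, k) w)"
proof -
  interpret cond_indep_family M MW W N Y \<kappa> by fact
  show ?thesis
  proof
    show "(\<lambda>w. \<kappa> (I w, k) w) \<in> MW \<rightarrow>\<^sub>M subprob_algebra N" for k
      by (rule measurable_compose_countable[OF _ I]) (rule kernel)
    have Yk: "(\<lambda>\<omega>. Y \<omega> (I (W \<omega>), k)) \<in> M \<rightarrow>\<^sub>M N" for k
      by (rule measurable_compose_countable[OF _ measurable_compose[OF W_measurable I]]) (rule Y_component)
    show "cond_indep_law M MW W N (\<lambda>\<omega> k. Y \<omega> (I (W \<omega>), k)) (\<lambda>k w. \<kappa> (I w, k) w)"
      unfolding cond_indep_law_def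
    proof (intro conjI ballI allI impI)
      show "W \<in> M \<rightarrow>\<^sub>M MW" by measurable
      show "(\<lambda>\<omega> k. Y \<omega> (I (W \<omega>), k)) \<in> M \<rightarrow>\<^sub>M PiM UNIV (\<lambda>_. N)"
        by (rule measurable_PiM_single') (auto dest: measurable_space[OF Yk] simp: Yk)
      fix A and J :: "'k set" and B assume A [measurable]: "A \<in> sets MW" and J: "finite J" and "\<forall>i\<in>J. B i \<in> sets N"
      then have B: "\<And>i. i \<in> J \<Longrightarrow> B i \<in> sets N" by auto
      let ?E = "\<lambda>\<omega>. \<forall>k\<in>J. Y \<omega> (I (W \<omega>), k) \<in> B k"
      have ind: "(\<Prod>k\<in>J. indicator (B k) (Y \<omega> (i, k)) :: ennreal) = (\<Prod>p\<in>Pair i ` J. indicator (B (snd p)) (Y \<omega> p))" for i \<omega>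
        by (subst prod.reindex) (auto simp: inj_on_def)
      have em: "(\<Prod>k\<in>J. emeasure (\<kappa> (i, k) w) (B k)) = (\<Prod>p\<in>Pair i ` J. emeasure (\<kappa> p w) (B (snd p)))" for i w
        by (subst prod.reindex) (auto simp: inj_on_def)
      have m1: "(\<lambda>\<omega>. indicator (A \<inter> {w\<in>space MW. I w = i}) (W \<omega>) * (\<Prod>k\<in>J. indicator (B k) (Y \<omega> (i, k))) :: ennreal) \<in> borel_measurable M" for i
        using B by (intro borel_measurable_times_ennreal borel_measurable_prod_ennreal
          measurable_compose[OF Y_component borel_measurable_indicator]
          measurable_compose[OF W_measurable borel_measurable_indicator]) auto
      have m2: "(\<lambda>\<omega>. indicator (A \<inter> {w\<in>space MW. I w = i}) (W \<omega>) * (\<Prod>k\<in>J. emeasure (\<kappa> (i, k) (W \<omega>)) (B k))) \<in> borel_measurable M" for i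
        using B by (intro borel_measurable_times_ennreal borel_measurable_prod_ennreal
          measurable_compose[OF W_measurable borel_measurable_indicator]
          measurable_compose[OF W_measurable emeasure_measurable_kernel]) auto
      have single: "(\<Sum>i. indicator (A \<inter> {w\<in>space MW. I w = i}) (W \<omega>) * h i) = indicator A (W \<omega>) * h (I (W \<omega>))"
        if "\<omega> \<in> space M" for \<omega> and h :: "nat \<Rightarrow> ennreal"
        using measurable_space[OF W_measurable that]
        by (subst suminf_finite[where N="{I (W \<omega>)}"]) (auto simp: indicator_def)
      have ev [measurable]: "{\<omega>\<in>space M. W \<omega> \<in> A \<and> ?E \<omega>} \<in> sets M"
      proof -
        have "{\<omega>\<in>space M. ?E \<omega>} \<in> sets M"
          using J Yk B by (rule sets_Collect_finite_Ball)
        then have "{\<omega>\<in>space M. ?E \<omega>} \<inter> (W -` A \<inter> space M) \<in> sets M" by measurable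
        also have "{\<omega>\<in>space M. ?E \<omega>} \<inter> (W -` A \<inter> space M) = {\<omega>\<in>space M. W \<omega> \<in> A \<and> ?E \<omega>}" by auto
        finally show ?thesis .
      qed
      have "emeasure M {\<omega>\<in>space M. W \<omega> \<in> A \<and> ?E \<omega>} = (\<integral>\<^sup>+\<omega>. indicator {\<omega>\<in>space M. W \<omega> \<in> A \<and> ?E \<omega>} \<omega> \<partial>M)"
        by (intro nn_integral_indicator[symmetric]) measurable
      also have "\<dots> = (\<integral>\<^sup>+\<omega>. (\<Sum>i. indicator (A \<inter> {w\<in>space MW. I w = i}) (W \<omega>) * (\<Prod>k\<in>J. indicator (B k) (Y \<omega> (i, k)))) \<partial>M)"
        by (intro nn_integral_cong, subst single) (auto simp: prod_indicator_Ball J indicator_def)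
      also have "\<dots> = (\<Sum>i. \<integral>\<^sup>+\<omega>. indicator (A \<inter> {w\<in>space MW. I w = i}) (W \<omega>) * (\<Prod>k\<in>J. indicator (B k) (Y \<omega> (i, k))) \<partial>M)"
        by (intro nn_integral_suminf m1)
      also have "\<dots> = (\<Sum>i. \<integral>\<^sup>+\<omega>. indicator (A \<inter> {w\<in>space MW. I w = i}) (W \<omega>) * (\<Prod>k\<in>J. emeasure (\<kappa> (i, k) (W \<omega>)) (B k)) \<partial>M)"
        unfolding ind em using J B by (intro suminf_cong law_indicator) auto
      also have "\<dots> = (\<integral>\<^sup>+\<omega>. (\<Sum>i. indicator (A \<inter> {w\<in>space MW. I w = i}) (W \<omega>) * (\<Prod>k\<in>J. emeasure (\<kappa> (i, k) (W \<omega>)) (B k))) \<partial>M)"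
        by (intro nn_integral_suminf[symmetric] m2)
      also have "\<dots> = (\<integral>\<^sup>+\<omega>. indicator A (W \<omega>) * (\<Prod>k\<in>J. emeasure (\<kappa> (I (W \<omega>), k) (W \<omega>)) (B k)) \<partial>M)"
        by (intro nn_integral_cong) (simp add: single)
      finally show "emeasure M {\<omega>\<in>space M. W \<omega> \<in> A \<and> ?E \<omega>} =
        (\<integral>\<^sup>+\<omega>. indicator A (W \<omega>) * (\<Prod>k\<in>J. emeasure (\<kappa> (I (W \<omega>), k) (W \<omega>)) (B k)) \<partial>M)" .
    qed
  qed
qed

section \<open>Poisson point processes\<close>

lemma nn_integral_nat_valued:
  assumes [measurable]: "n \<in> M \<rightarrow>\<^sub>M count_space (UNIV :: nat set)"
  shows "(\<integral>\<^sup>+\<omega>. f (n \<omega>) \<partial>M) = (\<Sum>k. f k * emeasure M {\<omega>\<in>space M. n \<omega> = k})"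
proof -
  have "(\<integral>\<^sup>+\<omega>. f (n \<omega>) \<partial>M) = (\<integral>\<^sup>+\<omega>. (\<Sum>k. f k * indicator {\<omega>\<in>space M. n \<omega> = k} \<omega>) \<partial>M)"
  proof (intro nn_integral_cong)
    fix \<omega> assume "\<omega> \<in> space M"
    then show "f (n \<omega>) = (\<Sum>k. f k * indicator {\<omega>\<in>space M. n \<omega> = k} \<omega>)"
      by (subst suminf_finite[where N="{n \<omega>}"]) (auto simp: indicator_def)
  qed
  also have "\<dots> = (\<Sum>k. f k * emeasure M {\<omega>\<in>space M. n \<omega> = k})"
    by (subst nn_integral_suminf) (auto intro!: suminf_cong nn_integral_cmult_indicator)
  finally show ?thesis .
qed

lemma point_count_power:
  assumes "finite {i. x i \<in> B}"
  shows "\<exists>K0. \<forall>K\<ge>K0. (\<Prod>k<K. if x k \<in> B then c else 1 :: real) = c ^ point_count x B"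
proof -
  obtain K0 where K0: "{i. x i \<in> B} \<subseteq> {..<K0}"
    using finite_nat_bounded[OF assms] by auto
  have "(\<Prod>k<K. if x k \<in> B then c else 1) = c ^ point_count x B" if "K \<ge> K0" for K
  proof -
    have "(\<Prod>k<K. if x k \<in> B then c else 1) = (\<Prod>k\<in>{i. x i \<in> B}. c)"
      using K0 that by (intro prod.mono_neutral_cong_right) auto
    then show ?thesis by (simp add: point_count_def)
  qed
  then show ?thesis by blast
qed

lemma INF_eventually_const:
  fixes f :: "nat \<Rightarrow> ennreal"
  assumes "decseq f" "\<And>K. K \<ge> K0 \<Longrightarrow> f K = c"
  shows "(INF K. f K) = c"
proof -
  have "f \<longlonglongrightarrow> (INF K. f K)" by (rule LIMSEQ_INF[OF assms(1)])
  moreover have "f \<longlonglongrightarrow> c"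
    by (rule tendsto_eventually) (auto simp: eventually_sequentially intro: assms(2))
  ultimately show ?thesis by (rule LIMSEQ_unique)
qed

lemma decseq_prod_le_1:
  fixes g :: "nat \<Rightarrow> real"
  assumes "\<And>k. 0 \<le> g k" "\<And>k. g k \<le> 1"
  shows "decseq (\<lambda>K. ennreal (\<Prod>k<K. g k))"
proof (rule decseq_SucI)
  fix K
  have "(\<Prod>k<K. g k) * g K \<le> (\<Prod>k<K. g k) * 1"
    using assms by (intro mult_left_mono prod_nonneg) auto
  then show "ennreal (\<Prod>k<Suc K. g k) \<le> ennreal (\<Prod>k<K. g k)"
    by (intro ennreal_leI) simp
qed

locale ppp = prob_space M for M :: "'w measure" and l :: real and Z :: "'w \<Rightarrow> nat \<Rightarrow> real^2" +
  assumes ppp: "homogeneous_ppp M l Z" and l_pos: "0 < l"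
begin

lemma Z_measurable [measurable]: "Z \<in> M \<rightarrow>\<^sub>M point_space"
  using ppp by (simp add: homogeneous_ppp_def)

lemma Z_component [measurable]: "(\<lambda>\<omega>. Z \<omega> i) \<in> borel_measurable M"
  using measurable_compose[OF Z_measurable measurable_component_singleton[of i UNIV]] by simp

lemma
  assumes "B \<in> sets borel" "bounded B"
  shows finite_points: "AE \<omega> in M. finite {i. Z \<omega> i \<in> B}"
    and prob_count: "prob {\<omega>\<in>space M. point_count (Z \<omega>) B = n} =
      (l * measure lborel B) ^ n / fact n * exp (- (l * measure lborel B))"
proof -
  note * = ppp[unfolded homogeneous_ppp_def, THEN conjunct2, THEN conjunct1, rule_format, OF assms]
  show "AE \<omega> in M. finite {i. Z \<omega> i \<in> B}" by (rule *[THEN conjunct1])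
  show "prob {\<omega>\<in>space M. point_count (Z \<omega>) B = n} =
      (l * measure lborel B) ^ n / fact n * exp (- (l * measure lborel B))"
    by (rule *[THEN conjunct2, rule_format])
qed

lemma indep_counts:
  fixes B :: "nat \<Rightarrow> (real^2) set"
  assumes "\<And>k. k < n \<Longrightarrow> B k \<in> sets borel \<and> bounded (B k)" "disjoint_family_on B {..<n}"
  shows "indep_vars (\<lambda>_. count_space UNIV) (\<lambda>k \<omega>. point_count (Z \<omega>) (B k)) {..<n}"
  using ppp[unfolded homogeneous_ppp_def, THEN conjunct2, THEN conjunct2, THEN spec[of _ B],
      THEN spec[of _ n], THEN mp] assms by simp

text \<open>Measurability of a single count is extracted from independence of a one-element
  family.\<close>

lemma count_measurable:
  assumes "B \<in> sets borel" "bounded B"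
  shows "(\<lambda>\<omega>. point_count (Z \<omega>) B) \<in> M \<rightarrow>\<^sub>M count_space UNIV"
proof -
  have "indep_vars (\<lambda>_. count_space UNIV) (\<lambda>k \<omega>. point_count (Z \<omega>) B) {..<1::nat}"
    using assms by (intro indep_counts[where B="\<lambda>_. B"]) (auto simp: disjoint_family_on_def)
  then show ?thesis by (auto simp: indep_vars_def2)
qed

text \<open>With mean 0 the Poisson weight at 0 is 1 by \<open>0 ^ 0 = 1\<close>. Since
  \<open>card\<close> of an infinite set is 0, a zero count means absence of points only together
  with the almost sure finiteness.\<close>

lemma no_points_bounded_null:
  assumes "B \<in> sets borel" "bounded B" "emeasure lborel B = 0"
  shows "AE \<omega> in M. \<forall>i. Z \<omega> i \<notin> B"
proof -
  have "measure lborel B = 0" using assms by (simp add: measure_def)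
  then have "prob {\<omega>\<in>space M. point_count (Z \<omega>) B = 0} = 1"
    using prob_count[OF assms(1,2), of 0] by simp
  then have "AE \<omega> in M. point_count (Z \<omega>) B = 0"
    using AE_prob_1[of "{\<omega>\<in>space M. point_count (Z \<omega>) B = 0}"] by auto
  with finite_points[OF assms(1,2)] show ?thesis
    by eventually_elim (auto simp: point_count_def)
qed

text \<open>Balls exhaust the plane, which reduces the claim to the bounded sets that the definition
  of the process speaks about.\<close>

lemma no_points_null:
  assumes [measurable]: "B \<in> sets borel" and "emeasure lborel B = 0"
  shows "AE \<omega> in M. \<forall>i. Z \<omega> i \<notin> B"
proof -
  have "AE \<omega> in M. \<forall>i. Z \<omega> i \<notin> B \<inter> cball 0 (real n)" for n
  proof (rule no_points_bounded_null)
    show "bounded (B \<inter> cball 0 (real n))" by (auto intro: bounded_subset[OF bounded_cball])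
    have "emeasure lborel (B \<inter> cball 0 (real n)) \<le> emeasure lborel B" by (rule emeasure_mono) auto
    then show "emeasure lborel (B \<inter> cball 0 (real n)) = 0" using assms by simp
  qed measurable
  then have "AE \<omega> in M. \<forall>n i. Z \<omega> i \<notin> B \<inter> cball 0 (real n)"
    by (rule AE_all_countable[THEN iffD2, OF allI])
  then show ?thesis
  proof eventually_elim
    case (elim \<omega>)
    have "z \<in> cball 0 (real (nat \<lceil>norm z\<rceil>))" for z :: "real^2" by (simp add: real_nat_ceiling_ge)
    then show ?case using elim by blast
  qed
qed

text \<open>The generating function of a Poisson variable, summed with the exponential
  series.\<close>

lemma nn_integral_power_count:
  assumes B: "B \<in> sets borel" "bounded B" and c: "0 \<le> c"
  shows "(\<integral>\<^sup>+\<omega>. ennreal (c ^ point_count (Z \<omega>) B) \<partial>M) = ennreal (exp (- l * ((1 - c) * measure lborel B)))"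
proof -
  let ?m = "l * measure lborel B"
  have m: "0 \<le> ?m" using l_pos by simp
  have "(\<integral>\<^sup>+\<omega>. ennreal (c ^ point_count (Z \<omega>) B) \<partial>M) =
      (\<Sum>k. ennreal (c ^ k) * emeasure M {\<omega>\<in>space M. point_count (Z \<omega>) B = k})"
    by (rule nn_integral_nat_valued[OF count_measurable[OF B]])
  also have "\<dots> = (\<Sum>k. ennreal ((c * ?m) ^ k / fact k * exp (- ?m)))"
    using c m by (intro suminf_cong) (simp add: emeasure_eq_measure prob_count[OF B] ennreal_mult'[symmetric] power_mult_distrib mult_ac)
  also have "\<dots> = ennreal (exp (c * ?m) * exp (- ?m))"
  proof (rule suminf_ennreal_eq)
    have "(\<lambda>k. (c * ?m) ^ k / fact k) sums exp (c * ?m)"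
      using exp_converges[of "c * ?m"] by (simp add: divide_inverse mult.commute scaleR_conv_of_real)
    then show "(\<lambda>k. (c * ?m) ^ k / fact k * exp (- ?m)) sums (exp (c * ?m) * exp (- ?m))"
      by (rule sums_mult2)
  qed (use c m in auto)
  also have "exp (c * ?m) * exp (- ?m) = exp (- l * ((1 - c) * measure lborel B))"
    by (simp add: exp_add[symmetric] algebra_simps)
  finally show ?thesis .
qed

text \<open>For a step function the product over the points regroups into one power
  \<open>c i ^ point_count\<close> per set, and counts in disjoint sets are independent. Finitely
  many points lie in the sets, so the infimum over \<open>K\<close> is an eventually constant
  value.\<close>

lemma pgfl_simple:
  fixes c :: "nat \<Rightarrow> real"
  assumes B: "\<And>i. i < n \<Longrightarrow> B i \<in> sets borel" "\<And>i. i < n \<Longrightarrow> bounded (B i)" and disj: "disjoint_family_on B {..<n}"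
    and c: "\<And>i. 0 \<le> c i" "\<And>i. c i \<le> 1"
  shows "(\<integral>\<^sup>+\<omega>. (INF K. ennreal (\<Prod>k<K. \<Prod>i<n. if Z \<omega> k \<in> B i then c i else 1)) \<partial>M)
    = ennreal (exp (- l * (\<Sum>i<n. (1 - c i) * measure lborel (B i))))"
proof -
  have fin: "AE \<omega> in M. \<forall>i\<in>{..<n}. finite {k. Z \<omega> k \<in> B i}"
    by (rule AE_finite_allI) (use B finite_points in auto)
  have "(\<integral>\<^sup>+\<omega>. (INF K. ennreal (\<Prod>k<K. \<Prod>i<n. if Z \<omega> k \<in> B i then c i else 1)) \<partial>M) =
      (\<integral>\<^sup>+\<omega>. (\<Prod>i<n. ennreal (c i ^ point_count (Z \<omega>) (B i))) \<partial>M)"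
  proof (rule nn_integral_cong_AE, use fin in eventually_elim)
    fix \<omega> assume fin: "\<forall>i\<in>{..<n}. finite {k. Z \<omega> k \<in> B i}"
    have "\<exists>K0. \<forall>K\<ge>K0. (\<Prod>k<K. if Z \<omega> k \<in> B i then c i else 1) = c i ^ point_count (Z \<omega>) (B i)" if "i < n" for i
      using that fin by (intro point_count_power) auto
    then obtain K0 where K0: "\<And>i K. i < n \<Longrightarrow> K \<ge> K0 i \<Longrightarrow> (\<Prod>k<K. if Z \<omega> k \<in> B i then c i else 1) = c i ^ point_count (Z \<omega>) (B i)"
      by metis
    show "(INF K. ennreal (\<Prod>k<K. \<Prod>i<n. if Z \<omega> k \<in> B i then c i else 1)) = (\<Prod>i<n. ennreal (c i ^ point_count (Z \<omega>) (B i)))"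
    proof (rule INF_eventually_const)
      show "decseq (\<lambda>K. ennreal (\<Prod>k<K. \<Prod>i<n. if Z \<omega> k \<in> B i then c i else 1))"
        using c by (intro decseq_prod_le_1 prod_nonneg prod_le_1) auto
      \<comment> \<open>From this index on every set has exhausted its points; inserting 0 keeps
        \<open>Max\<close> meaningful when there are no sets.\<close>
      fix K assume K: "K \<ge> Max (insert 0 (K0 ` {..<n}))"
      then have "K \<ge> K0 i" if "i < n" for i
        using that by (auto intro: order_trans[rotated])
      then have "(\<Prod>k<K. \<Prod>i<n. if Z \<omega> k \<in> B i then c i else 1) = (\<Prod>i<n. c i ^ point_count (Z \<omega>) (B i))"
        by (subst prod.swap) (auto intro!: prod.cong K0)
      then show "ennreal (\<Prod>k<K. \<Prod>i<n. if Z \<omega> k \<in> B i then c i else 1) = (\<Prod>i<n. ennreal (c i ^ point_count (Z \<omega>) (B i)))"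
        using c by (simp add: prod_ennreal)
    qed
  qed
  also have "\<dots> = (\<Prod>i<n. \<integral>\<^sup>+\<omega>. ennreal (c i ^ point_count (Z \<omega>) (B i)) \<partial>M)"
    using B disj by (intro indep_vars_nn_integral indep_vars_compose2[OF indep_counts]) auto
  also have "\<dots> = (\<Prod>i<n. ennreal (exp (- l * ((1 - c i) * measure lborel (B i)))))"
    using B c by (intro prod.cong nn_integral_power_count) auto
  also have "\<dots> = ennreal (exp (- l * (\<Sum>i<n. (1 - c i) * measure lborel (B i))))"
    by (simp add: prod_ennreal exp_sum sum_distrib_left flip: sum_negf)
  finally show ?thesis .
qed

text \<open>The probability generating functional, obtained from step functions. The approximants
  \<open>u n\<close> of \<open>1 - p\<close> round down to multiples of \<open>1 / 2 ^ n\<close> and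
  vanish outside a ball of radius \<open>n\<close>, because counts are controlled on bounded sets
  only; \<open>1 - p\<close> itself is the dominating function for their integrals.\<close>

lemma pgfl:
  fixes p :: "real^2 \<Rightarrow> real"
  assumes p [measurable]: "p \<in> borel_measurable borel" and p01: "\<And>z. 0 \<le> p z" "\<And>z. p z \<le> 1"
    and int: "integrable lborel (\<lambda>z. 1 - p z)"
  shows "(\<integral>\<^sup>+\<omega>. (INF K. ennreal (\<Prod>k<K. p (Z \<omega> k))) \<partial>M)
    = ennreal (exp (- l * (\<integral>z. 1 - p z \<partial>lborel)))"
proof -
  define fl where "fl n z = \<lfloor>2 ^ n * (1 - p z)\<rfloor>" for n :: nat and z
  define u where "u n z = indicator (cball 0 (real n)) z * (of_int (fl n z) / 2 ^ n :: real)" for n z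
  define B where "B n i = {z\<in>cball 0 (real n). fl n z = int i}" for n i
  \<comment> \<open>The truncation at 0 matters only for \<open>i > 2 ^ n\<close>, where it keeps
    \<open>c n i\<close> nonnegative for all indices, as \<open>pgfl_simple\<close>
    requires.\<close>
  define c where "c n i = max 0 (1 - real i / 2 ^ n)" for n i :: nat
  have fl_meas [measurable]: "fl n \<in> borel \<rightarrow>\<^sub>M count_space UNIV" for n
    unfolding fl_def by measurable
  have [measurable]: "(\<lambda>z. of_int (fl n z) :: real) \<in> borel_measurable borel" for n
    by (rule measurable_compose[OF fl_meas]) simp
  have [measurable]: "cball 0 r \<in> sets (borel :: (real^2) measure)" for r
    by simp
  have u_meas [measurable]: "u n \<in> borel_measurable borel" for n
    unfolding u_def by measurable
  have fl0: "0 \<le> fl n z" for n z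
    using p01[of z] by (simp add: fl_def)
  have fl1: "fl n z \<le> 2 ^ n" for n z
  proof -
    have "2 ^ n * (1 - p z) \<le> 2 ^ n * 1" using p01[of z] by (intro mult_left_mono) auto
    then have "\<lfloor>2 ^ n * (1 - p z)\<rfloor> \<le> \<lfloor>2 ^ n :: real\<rfloor>" by (intro floor_mono) simp
    also have "\<lfloor>2 ^ n :: real\<rfloor> = 2 ^ n" using floor_of_int[of "2 ^ n", where 'a=real] by simp
    finally show ?thesis by (simp add: fl_def)
  qed
  have fl_u: "of_int (fl n z) / 2 ^ n \<le> 1 - p z" "1 - p z - (1 / 2) ^ n \<le> of_int (fl n z) / 2 ^ n" for n z
  proof -
    have "of_int (fl n z) / 2 ^ n \<le> 2 ^ n * (1 - p z) / 2 ^ n"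
      unfolding fl_def by (intro divide_right_mono) auto
    then show "of_int (fl n z) / 2 ^ n \<le> 1 - p z" by simp
    have "1 - p z - (1 / 2) ^ n = (2 ^ n * (1 - p z) - 1) / 2 ^ n"
      by (simp add: power_one_over diff_divide_distrib)
    also have "\<dots> \<le> of_int (fl n z) / 2 ^ n"
      unfolding fl_def by (intro divide_right_mono) (use real_of_int_floor_gt_diff_one[of "2 ^ n * (1 - p z)"] in auto)
    finally show "1 - p z - (1 / 2) ^ n \<le> of_int (fl n z) / 2 ^ n" .
  qed
  \<comment> \<open>\<open>u n\<close> increases to \<open>1 - p\<close>; infinite products are infima of finite ones, so that this limit
    and the limit over the number of factors can be interchanged.\<close>
  have u0: "0 \<le> u n z" and u_le: "u n z \<le> 1 - p z" for n z
    using fl0[of n z] fl_u(1)[of n z] p01[of z] by (auto simp: u_def indicator_def)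
  have u_le1: "u n z \<le> 1" for n z
    using u_le[of n z] p01(1)[of z] by linarith
  have u_mono: "u n z \<le> u (Suc n) z" for n z
  proof -
    \<comment> \<open>Dyadic refinement: twice the floor of a number is at most the floor of its
      double.\<close>
    have "2 * fl n z \<le> fl (Suc n) z"
      using of_int_floor_le[of "2 ^ n * (1 - p z)"] by (simp add: fl_def le_floor_iff algebra_simps)
    then have "2 * real_of_int (fl n z) \<le> of_int (fl (Suc n) z)" by linarith
    then have "of_int (fl n z) / 2 ^ n \<le> (of_int (fl (Suc n) z) / 2 ^ Suc n :: real)"
      by (simp add: field_simps)
    then show ?thesis using fl0[of "Suc n" z] by (auto simp: u_def indicator_def)
  qed
  have u_lim: "(\<lambda>n. u n z) \<longlonglongrightarrow> 1 - p z" for z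
  proof (rule tendsto_sandwich[where f="\<lambda>n. 1 - p z - (1/2) ^ n" and h="\<lambda>_. 1 - p z"])
    have "(\<lambda>n. 1 - p z - (1/2) ^ n) \<longlonglongrightarrow> 1 - p z - 0"
      by (intro tendsto_intros LIMSEQ_realpow_zero) auto
    then show "(\<lambda>n. 1 - p z - (1/2) ^ n) \<longlonglongrightarrow> 1 - p z" by simp
    show "\<forall>\<^sub>F n in sequentially. 1 - p z - (1/2) ^ n \<le> u n z"
      using eventually_ge_at_top[of "nat \<lceil>norm z\<rceil>"]
    proof eventually_elim
      case (elim n)
      then have "z \<in> cball 0 (real n)" using real_nat_ceiling_ge[of "norm z"] by auto
      then show ?case using fl_u(2)[of z n] by (simp add: u_def)
    qed
  qed (auto simp: u_le)
  have B_meas: "B n i \<in> sets borel" for n i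
    unfolding B_def by measurable
  have B_bdd: "bounded (B n i)" for n i
    unfolding B_def by (rule bounded_subset[OF bounded_cball[of 0 "real n"]]) auto
  have B_disj: "disjoint_family_on (B n) A" for n A
    by (auto simp: disjoint_family_on_def B_def)
  have c1: "1 - c n i = real i / 2 ^ n" if "i < 2 ^ n + 1" for n i
  proof -
    have "real i \<le> real (2 ^ n)" using that by (simp only: of_nat_le_iff)
    then have "real i / 2 ^ n \<le> 1" by (simp add: field_simps)
    then show ?thesis by (simp add: c_def)
  qed
  \<comment> \<open>The level sets for different \<open>i\<close> are disjoint, so at most the level
    of \<open>z\<close> contributes. The range has \<open>2 ^ n + 1\<close> members because the top
    level \<open>2 ^ n\<close> is reached where \<open>p z = 0\<close>.\<close>
  have q: "(\<Prod>i<2 ^ n + 1. if z \<in> B n i then c n i else 1) = 1 - u n z"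
    and u_sum: "u n z = (\<Sum>i<2 ^ n + 1. (1 - c n i) * indicator (B n i) z)" for n z
  proof -
    let ?j = "nat (fl n z)"
    have j: "?j < 2 ^ n + 1" using fl1[of n z] by (simp add: nat_less_iff fl0)
    have BB: "z \<in> B n i \<longleftrightarrow> z \<in> cball 0 (real n) \<and> i = ?j" for i
      using fl0[of n z] by (auto simp: B_def)
    have cj: "1 - c n ?j = of_int (fl n z) / 2 ^ n" using c1[OF j] fl0[of n z] by simp
    have "(\<Prod>i<2 ^ n + 1. if z \<in> B n i then c n i else 1) = (\<Prod>i<2 ^ n + 1. if i = ?j then (if z \<in> cball 0 (real n) then c n i else 1) else 1)"
      by (intro prod.cong) (auto simp: BB)
    also have "\<dots> = (if z \<in> cball 0 (real n) then c n ?j else 1)"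
      using j by (subst prod.delta) auto
    also have "\<dots> = 1 - u n z" using cj by (auto simp: u_def)
    finally show "(\<Prod>i<2 ^ n + 1. if z \<in> B n i then c n i else 1) = 1 - u n z" .
    have "(\<Sum>i<2 ^ n + 1. (1 - c n i) * indicator (B n i) z) = (\<Sum>i<2 ^ n + 1. if i = ?j then (if z \<in> cball 0 (real n) then 1 - c n i else 0) else 0)"
      by (intro sum.cong) (auto simp: BB indicator_def)
    also have "\<dots> = (if z \<in> cball 0 (real n) then 1 - c n ?j else 0)"
      using j by (subst sum.delta) auto
    also have "\<dots> = u n z" unfolding cj by (auto simp: u_def)
    finally show "u n z = (\<Sum>i<2 ^ n + 1. (1 - c n i) * indicator (B n i) z)" by simp
  qed
  have int_u: "(\<Sum>i<2 ^ n + 1. (1 - c n i) * measure lborel (B n i)) = (\<integral>z. u n z \<partial>lborel)" for n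
  proof -
    have "emeasure lborel (B n i) < \<infinity>" for i
      using emeasure_bounded_finite[OF B_bdd] by simp
    then have "integrable lborel (\<lambda>z. (1 - c n i) * indicator (B n i) z)" for i
      using B_meas by (intro integrable_mult_right integrable_real_indicator) auto
    then show ?thesis unfolding u_sum by (subst Bochner_Integration.integral_sum) (auto intro!: sum.cong simp: B_meas)
  qed
  define G where "G n \<omega> = (INF K. ennreal (\<Prod>k<K. 1 - u n (Z \<omega> k)))" for n \<omega>
  have [measurable]: "G n \<in> borel_measurable M" for n
    unfolding G_def by measurable
  have G: "(\<integral>\<^sup>+\<omega>. G n \<omega> \<partial>M) = ennreal (exp (- l * (\<integral>z. u n z \<partial>lborel)))" for n
  proof -
    have "(\<integral>\<^sup>+\<omega>. (INF K. ennreal (\<Prod>k<K. \<Prod>i<2 ^ n + 1. if Z \<omega> k \<in> B n i then c n i else 1)) \<partial>M)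
      = ennreal (exp (- l * (\<Sum>i<2 ^ n + 1. (1 - c n i) * measure lborel (B n i))))"
      by (rule pgfl_simple) (auto simp: B_meas B_bdd B_disj c_def)
    then show ?thesis unfolding q int_u G_def .
  qed
  have prod_mono_u: "(\<Prod>k<K. 1 - u (Suc n) (Z \<omega> k)) \<le> (\<Prod>k<K. 1 - u n (Z \<omega> k))" for K n \<omega>
    using u_mono u_le1 by (intro prod_mono) auto
  have G_dec: "decseq G"
    unfolding G_def by (intro decseq_SucI le_funI INF_mono) (auto intro!: ennreal_leI prod_mono_u)
  have INF_G: "(INF n. G n \<omega>) = (INF K. ennreal (\<Prod>k<K. p (Z \<omega> k)))" for \<omega>
  proof -
    have "(INF n. ennreal (\<Prod>k<K. 1 - u n (Z \<omega> k))) = ennreal (\<Prod>k<K. p (Z \<omega> k))" for K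
    proof (rule LIMSEQ_unique[OF LIMSEQ_INF])
      show "decseq (\<lambda>n. ennreal (\<Prod>k<K. 1 - u n (Z \<omega> k)))"
        by (intro decseq_SucI ennreal_leI prod_mono_u)
      have "(\<lambda>n. \<Prod>k<K. 1 - u n (Z \<omega> k)) \<longlonglongrightarrow> (\<Prod>k<K. 1 - (1 - p (Z \<omega> k)))"
        by (intro tendsto_intros u_lim)
      then show "(\<lambda>n. ennreal (\<Prod>k<K. 1 - u n (Z \<omega> k))) \<longlonglongrightarrow> ennreal (\<Prod>k<K. p (Z \<omega> k))"
        by (intro tendsto_ennrealI) simp
    qed
    then show ?thesis unfolding G_def by (subst INF_commute) simp
  qed
  have "(\<integral>\<^sup>+\<omega>. (INF K. ennreal (\<Prod>k<K. p (Z \<omega> k))) \<partial>M) = (\<integral>\<^sup>+\<omega>. (INF n. G n \<omega>) \<partial>M)"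
    by (simp add: INF_G)
  also have "\<dots> = (INF n. \<integral>\<^sup>+\<omega>. G n \<omega> \<partial>M)"
    by (rule nn_integral_monotone_convergence_INF_decseq[OF G_dec, where i=0]) (auto simp: G)
  also have "\<dots> = ennreal (exp (- l * (\<integral>z. 1 - p z \<partial>lborel)))"
  proof (rule LIMSEQ_unique[OF LIMSEQ_INF])
    show "decseq (\<lambda>n. \<integral>\<^sup>+\<omega>. G n \<omega> \<partial>M)"
      by (intro decseq_SucI nn_integral_mono le_funD[OF decseq_SucD[OF G_dec]])
    have "(\<lambda>n. \<integral>z. u n z \<partial>lborel) \<longlonglongrightarrow> (\<integral>z. 1 - p z \<partial>lborel)"
      by (rule integral_dominated_convergence[where w="\<lambda>z. 1 - p z"]) (auto simp: u_lim u0 u_le int)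
    then show "(\<lambda>n. \<integral>\<^sup>+\<omega>. G n \<omega> \<partial>M) \<longlonglongrightarrow> ennreal (exp (- l * (\<integral>z. 1 - p z \<partial>lborel)))"
      unfolding G by (intro tendsto_intros tendsto_ennrealI)
  qed
  finally show ?thesis .
qed

end

section \<open>Radial integrals and the gamma distribution\<close>

text \<open>The set is the disc around \<open>x\<close> of radius
  \<open>(b * c) powr (1 / a)\<close>.\<close>

lemma emeasure_dist_powr_atMost:
  fixes x :: "real^2"
  assumes a: "0 < a" and b: "0 < b" and c: "0 \<le> c"
  shows "emeasure lborel {z. dist x z powr a / b \<le> c} = ennreal (pi * (b * c) powr (2 / a))"
proof -
  have *: "dist x z powr a / b \<le> c \<longleftrightarrow> dist x z \<le> (b * c) powr (1 / a)" for z
  proof -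
    have "dist x z powr a / b \<le> c \<longleftrightarrow> dist x z powr a \<le> b * c" using b by (simp add: field_simps)
    also have "\<dots> \<longleftrightarrow> dist x z powr a \<le> ((b * c) powr (1 / a)) powr a" using a b c by (simp add: powr_powr)
    also have "\<dots> \<longleftrightarrow> dist x z \<le> (b * c) powr (1 / a)"
    proof
      assume *: "dist x z powr a \<le> ((b * c) powr (1 / a)) powr a"
      show "dist x z \<le> (b * c) powr (1 / a)"
      proof (rule ccontr)
        assume "\<not> dist x z \<le> (b * c) powr (1 / a)"
        then have "((b * c) powr (1 / a)) powr a < dist x z powr a"
          using a by (intro powr_less_mono2) auto
        then show False using * by simp
      qed
    qed (use a in \<open>intro powr_mono2, auto\<close>)
    finally show ?thesis .
  qed
  have "{z. dist x z powr a / b \<le> c} = cball x ((b * c) powr (1 / a))"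
    unfolding * cball_def ..
  moreover have "((b * c) powr (1 / a))^2 = (b * c) powr (2 / a)"
    using a b c by (cases "c = 0") (simp_all add: powr_power)
  ultimately show ?thesis by (simp add: emeasure_cball unit_ball_vol_2)
qed

text \<open>Integration in polar coordinates, phrased as an image measure. It is enough to compare
  half-lines: the left side gives the area of a disc, and the density on the right is the derivative
  of that area in \<open>c\<close>.\<close>

lemma distr_dist_powr:
  fixes x :: "real^2"
  assumes a: "0 < a" and b: "0 < b"
  shows "distr lborel borel (\<lambda>z. dist x z powr a / b) =
    density lborel (\<lambda>u. ennreal (if 0 < u then 2 * pi * (b powr (2 / a) / a) * u powr (2 / a - 1) else 0))"
    (is "?L = ?R")
proof (rule measure_eqI_generator_eq[where E="range atMost" and \<Omega>=UNIV and A="\<lambda>n. {..real n}"])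
  have meas [measurable]: "(\<lambda>z. dist x z powr a / b) \<in> borel_measurable borel" by measurable
  have L: "emeasure ?L {..c} = (if 0 \<le> c then ennreal (pi * (b * c) powr (2 / a)) else 0)" for c
  proof -
    have "emeasure ?L {..c} = emeasure lborel {z. dist x z powr a / b \<le> c}"
      by (subst emeasure_distr) (auto simp: vimage_def)
    also have "\<dots> = (if 0 \<le> c then ennreal (pi * (b * c) powr (2 / a)) else 0)"
    proof (cases "0 \<le> c")
      case False
      have "\<not> dist x z powr a / b \<le> c" for z
        using False b by (metis divide_nonneg_pos order_trans powr_ge_zero)
      then show ?thesis using False by simp
    qed (simp add: emeasure_dist_powr_atMost[OF a b])
    finally show ?thesis .
  qed
  have R: "emeasure ?R {..c} = (if 0 \<le> c then ennreal (pi * (b * c) powr (2 / a)) else 0)" for c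
  proof (cases "0 \<le> c")
    case True
    let ?f = "\<lambda>u. 2 * pi * (b powr (2 / a) / a) * u powr (2 / a - 1)"
    have "(?f has_integral 2 * pi * (b powr (2 / a) / a) * (c powr (2 / a - 1 + 1) / (2 / a - 1 + 1))) {0..c}"
      using a True by (intro has_integral_mult_right has_integral_powr_from_0) auto
    also have "2 * pi * (b powr (2 / a) / a) * (c powr (2 / a - 1 + 1) / (2 / a - 1 + 1)) = pi * (b * c) powr (2 / a)"
      using a b True by (simp add: powr_mult)
    finally have "((\<lambda>u. if u \<in> {0..c} then ?f u else 0) has_integral pi * (b * c) powr (2 / a)) UNIV"
      by (simp only: has_integral_restrict_UNIV)
    then have "(\<integral>\<^sup>+u. ennreal (if u \<in> {0..c} then ?f u else 0) \<partial>lborel) = ennreal (pi * (b * c) powr (2 / a))"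
      using a by (intro nn_integral_has_integral_lborel) auto
    also have "(\<integral>\<^sup>+u. ennreal (if u \<in> {0..c} then ?f u else 0) \<partial>lborel) = emeasure ?R {..c}"
      by (subst emeasure_density) (auto intro!: nn_integral_cong simp: indicator_def order_less_le)
    finally show ?thesis using True by simp
  next
    case False
    then show ?thesis
      by (subst emeasure_density) (auto intro!: nn_integral_zero' AE_I2 simp: indicator_def)
  qed
  show "Int_stable (range atMost :: real set set)"
    by (auto simp: Int_stable_def)
  show "sets ?L = sigma_sets UNIV (range atMost)" "sets ?R = sigma_sets UNIV (range atMost)"
    by (simp_all add: borel_eq_atMost)
  show "(\<Union>n. {..real n}) = UNIV" by (auto simp: real_arch_simple)
  show "emeasure ?L X = emeasure ?R X" if "X \<in> range atMost" for X
    using that L R by auto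
  show "emeasure ?L {..real n} \<noteq> \<infinity>" for n by (simp add: L)
qed auto

lemma has_bochner_integral_dist_powr:
  fixes x :: "real^2" and f :: "real \<Rightarrow> real"
  assumes a: "0 < a" and b: "0 < b" and f [measurable]: "f \<in> borel_measurable borel"
    and int: "has_bochner_integral lborel
      (\<lambda>u. (if 0 < u then 2 * pi * (b powr (2 / a) / a) * u powr (2 / a - 1) else 0) * f u) I"
  shows "has_bochner_integral lborel (\<lambda>z. f (dist x z powr a / b)) I"
proof -
  have "has_bochner_integral (distr lborel borel (\<lambda>z. dist x z powr a / b)) f I"
    unfolding distr_dist_powr[OF a b] using a int
    by (intro has_bochner_integral_density) auto
  then show ?thesis
    by (simp add: has_bochner_integral_iff integrable_distr_eq integral_distr)
qed

text \<open>Integrability is inherited from the complete Gamma integral. The general set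
  \<open>A\<close> covers the lower and the upper incomplete function at once.\<close>

lemma has_bochner_integral_inc_Gamma:
  assumes s: "0 < s" and A [measurable]: "A \<in> sets borel" "A \<subseteq> {0 :: real<..}"
  shows "has_bochner_integral lborel (\<lambda>t. indicator A t * (t powr (s - 1) * exp (- t)))
    (LINT t:A|lborel. t powr (s - 1) * exp (- t))"
proof -
  let ?g = "\<lambda>t. if t \<in> {0..} then t powr (s - 1) / exp t else 0 :: real"
  have "(?g has_integral Gamma s) UNIV"
    using Gamma_integral_real[OF s] by (simp only: has_integral_restrict_UNIV)
  then have "(\<integral>\<^sup>+t. ennreal (?g t) \<partial>lborel) = ennreal (Gamma s)"
    by (intro nn_integral_has_integral_lborel) auto
  then have "integrable lborel ?g"
    by (intro integrableI_nonneg) auto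
  then have "integrable lborel (\<lambda>t. ?g t * indicator A t)"
    using A by (intro integrable_real_mult_indicator) auto
  also have "(\<lambda>t. ?g t * indicator A t) = (\<lambda>t. indicator A t * (t powr (s - 1) * exp (- t)))"
    using A(2) by (auto simp: fun_eq_iff indicator_def exp_minus divide_inverse)
  finally show ?thesis
    by (simp add: has_bochner_integral_iff set_lebesgue_integral_def)
qed

text \<open>For \<open>n > 0\<close> this is the probability that a gamma variable of shape
  \<open>n\<close> and scale 1 exceeds \<open>x\<close>; equivalently, that a Poisson variable of
  mean \<open>x\<close> is smaller than \<open>n\<close>.\<close>

definition gamma_tail :: "nat \<Rightarrow> real \<Rightarrow> real" where
  "gamma_tail n x = (\<Sum>m<n. x ^ m * exp (- x) / fact m)"

lemma gamma_tail_measurable [measurable]: "gamma_tail n \<in> borel_measurable borel"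
  unfolding gamma_tail_def by measurable

text \<open>In the variable \<open>u = dist x z powr a / b\<close> the plane has density
  proportional to \<open>u powr (2 / a - 1)\<close>. The \<open>m\<close>-th Poisson term multiplies
  this by \<open>u ^ m * exp (- u) / fact m\<close>, an incomplete Gamma integrand of order
  \<open>m + 2 / a\<close>. The value does not depend on the centre \<open>x\<close>.\<close>

lemma has_bochner_integral_gamma_tail:
  fixes x :: "real^2"
  assumes a: "0 < a" and b: "0 < b" and A [measurable]: "A \<in> sets borel" and A_pos: "A \<subseteq> {0<..}"
  shows "has_bochner_integral lborel (\<lambda>z. indicator A (dist x z powr a / b) * gamma_tail n (dist x z powr a / b))
    (2 * pi * (b powr (2 / a) / a) * (\<Sum>m<n. (LINT t:A|lborel. t powr (real m + 2 / a - 1) * exp (- t)) / fact m))"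
proof (rule has_bochner_integral_dist_powr[OF a b])
  let ?c = "2 * pi * (b powr (2 / a) / a)"
  have "has_bochner_integral lborel
      (\<lambda>u. ?c * (\<Sum>m<n. indicator A u * (u powr (real m + 2 / a - 1) * exp (- u)) / fact m))
      (?c * (\<Sum>m<n. (LINT t:A|lborel. t powr (real m + 2 / a - 1) * exp (- t)) / fact m))"
    using a by (intro has_bochner_integral_mult_right has_bochner_integral_sum
        has_bochner_integral_divide_zero has_bochner_integral_inc_Gamma A A_pos) (auto intro: add_nonneg_pos)
  also have "(\<lambda>u. ?c * (\<Sum>m<n. indicator A u * (u powr (real m + 2 / a - 1) * exp (- u)) / fact m)) =
      (\<lambda>u. (if 0 < u then ?c * u powr (2 / a - 1) else 0) * (indicator A u * gamma_tail n u))"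
  proof
    fix u :: real
    show "?c * (\<Sum>m<n. indicator A u * (u powr (real m + 2 / a - 1) * exp (- u)) / fact m) =
      (if 0 < u then ?c * u powr (2 / a - 1) else 0) * (indicator A u * gamma_tail n u)"
    proof (cases "u \<in> A")
      case True
      then have u: "0 < u" using A_pos by auto
      have "u powr (real m + 2 / a - 1) = u ^ m * u powr (2 / a - 1)" for m
        using u by (simp add: powr_realpow[symmetric] powr_add[symmetric] add_diff_eq)
      then show ?thesis using True u
        by (simp add: gamma_tail_def sum_distrib_left sum_divide_distrib mult_ac)
    qed simp
  qed
  finally show "has_bochner_integral lborel
      (\<lambda>u. (if 0 < u then ?c * u powr (2 / a - 1) else 0) * (indicator A u * gamma_tail n u))
      (?c * (\<Sum>m<n. (LINT t:A|lborel. t powr (real m + 2 / a - 1) * exp (- t)) / fact m))" .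
qed measurable

text \<open>The two densities can differ at 0, where for \<open>k = 0\<close> the Erlang density is
  1; hence the comparison almost everywhere.\<close>

lemma gamma_law_Suc: "gamma_law (real (Suc k)) = density lborel (erlang_density k 1)"
  unfolding gamma_law_def
proof (rule density_cong)
  have "AE x in lborel. x \<noteq> (0::real)" by (rule AE_lborel_singleton)
  then show "AE x in lborel. ennreal (if 0 < x then x powr (real (Suc k) - 1) * exp (- x) / Gamma (real (Suc k)) else 0) =
      ennreal (erlang_density k 1 x)"
  proof eventually_elim
    case (elim x)
    have "Gamma (real (Suc k)) = fact k" using Gamma_fact[of k, where 'a=real] by (simp add: add.commute)
    then show ?case using elim by (auto simp: erlang_density_def powr_realpow)
  qed
qed measurable

lemma emeasure_gamma_law_atMost:
  assumes "0 < n" "0 \<le> x"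
  shows "emeasure (gamma_law (real n)) {..x} = ennreal (1 - gamma_tail n x)"
proof -
  obtain k where n: "n = Suc k" using assms(1) gr0_implies_Suc by blast
  show ?thesis
    unfolding n gamma_law_Suc using assms(2)
    by (simp add: emeasure_erlang_density erlang_CDF_def gamma_tail_def lessThan_Suc_atMost)
qed

lemma prob_space_gamma_law: "0 < n \<Longrightarrow> prob_space (gamma_law (real n))"
proof -
  assume "0 < n"
  then obtain k where "n = Suc k" using gr0_implies_Suc by blast
  then show ?thesis using prob_space_erlang_density[of 1 k] by (simp only: gamma_law_Suc)
qed

lemma sets_gamma_law [simp, measurable_cong]: "sets (gamma_law k) = sets borel"
  by (simp add: gamma_law_def)

lemma gamma_tail_bounds: "0 \<le> x \<Longrightarrow> 0 \<le> gamma_tail n x" "0 \<le> x \<Longrightarrow> gamma_tail n x \<le> 1"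
proof -
  assume x: "0 \<le> x"
  then show "0 \<le> gamma_tail n x" by (auto simp: gamma_tail_def intro!: sum_nonneg)
  show "gamma_tail n x \<le> 1"
  proof (cases n)
    case (Suc k)
    have "0 \<le> erlang_CDF k 1 x" by simp
    then show ?thesis using x by (simp add: erlang_CDF_def gamma_tail_def Suc lessThan_Suc_atMost)
  qed (simp add: gamma_tail_def)
qed

lemma inc_Gamma_measurable [measurable]:
  "lower_inc_Gamma s \<in> borel_measurable borel" "upper_inc_Gamma s \<in> borel_measurable borel"
proof -
  have "lower_inc_Gamma s = (\<lambda>x. \<integral>t. (if 0 < t \<and> t \<le> x then t powr (s - 1) * exp (- t) else 0) \<partial>lborel)"
    unfolding lower_inc_Gamma_def set_lebesgue_integral_def
    by (intro ext Bochner_Integration.integral_cong) (auto simp: indicator_def)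
  then show "lower_inc_Gamma s \<in> borel_measurable borel" by simp
  have "upper_inc_Gamma s = (\<lambda>x. \<integral>t. (if x < t then t powr (s - 1) * exp (- t) else 0) \<partial>lborel)"
    unfolding upper_inc_Gamma_def set_lebesgue_integral_def
    by (intro ext Bochner_Integration.integral_cong) (auto simp: indicator_def)
  then show "upper_inc_Gamma s \<in> borel_measurable borel" by simp
qed

text \<open>The density with a natural power in place of \<open>powr\<close>, as it appears in the
  closed form.\<close>

definition gamma_density :: "nat \<Rightarrow> real \<Rightarrow> real" where
  "gamma_density n y = (if 0 < y then y ^ (n - 1) * exp (- y) / Gamma (real n) else 0)"

lemma gamma_density_measurable [measurable]: "gamma_density n \<in> borel_measurable borel"
  unfolding gamma_density_def by measurable

lemma gamma_density_nonneg: "0 \<le> gamma_density n y"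
proof (cases "n = 0")
  case False
  then show ?thesis by (simp add: gamma_density_def)
qed (simp add: gamma_density_def)

lemma nn_integral_gamma_law:
  assumes n: "0 < n" and [measurable]: "f \<in> borel_measurable borel"
  shows "(\<integral>\<^sup>+y. f y \<partial>gamma_law (real n)) = (\<integral>\<^sup>+y. ennreal (gamma_density n y) * f y \<partial>lborel)"
proof -
  have "(if 0 < y then y powr (real n - 1) * exp (- y) / Gamma (real n) else 0) = gamma_density n y" for y
    using n by (auto simp: gamma_density_def powr_realpow[symmetric] of_nat_diff)
  then show ?thesis
    by (simp add: gamma_law_def nn_integral_density)
qed

lemma Lambda_E_measurable [measurable]:
  "Lambda_E lam_E C D K \<alpha> N Ms ms \<theta>b \<in> borel_measurable borel"
  unfolding Lambda_E_def[abs_def] Omega_in_def Omega_out_def Let_def by measurable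

text \<open>Positivity of \<open>c\<close> settles the case \<open>s = 0\<close>, where the quotient
  is infinite; with \<open>c = 0\<close> it would be \<open>0 / 0 = 0\<close> and the equivalence
  would fail. This is why the user's received power must be shown to be almost surely
  positive.\<close>

lemma ennreal_one_le_divide_iff:
  assumes "0 < c"
  shows "1 \<le> ennreal c / s \<longleftrightarrow> s \<le> ennreal c"
proof (cases s)
  case (real x)
  show ?thesis
  proof (cases "x = 0")
    case False
    then have x: "0 < x" using real by simp
    then have "ennreal c / s = ennreal (c / x)" using assms real by (simp add: divide_ennreal)
    then have "1 \<le> ennreal c / s \<longleftrightarrow> 1 \<le> c / x" using assms x by simp
    then show ?thesis using x real assms by (simp add: le_divide_eq)
  qed (use real assms in simp)
qed (simp add: top_unique)

text \<open>The case \<open>a = b = 1\<close> of \<open>distr_dist_powr\<close>: the radial image of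
  planar Lebesgue measure has a density.\<close>

lemma emeasure_norm_null:
  fixes B :: "real set"
  assumes B [measurable]: "B \<in> sets borel" and null: "emeasure lborel B = 0"
  shows "emeasure lborel {z :: real^2. norm z \<in> B} = 0"
proof -
  have "AE u in lborel. u \<notin> B"
    using null by (intro AE_not_in) (auto simp: null_sets_def)
  then have "emeasure (density lborel (\<lambda>u. ennreal (if 0 < u then 2 * pi * (1 powr (2 / 1) / 1) * u powr (2 / 1 - 1) else 0))) B = 0"
    by (subst emeasure_density) (auto simp: nn_integral_0_iff_AE indicator_def elim: eventually_mono)
  then have "emeasure (distr lborel borel (\<lambda>z. dist (0 :: real^2) z powr 1 / 1)) B = 0"
    by (subst distr_dist_powr) simp_all
  then show ?thesis
    by (simp add: emeasure_distr vimage_def)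
qed

section \<open>The serving link\<close>

lemma path_loss_measurable [measurable (raw)]:
  assumes j: "j \<in> M \<rightarrow>\<^sub>M count_space UNIV"
    and [measurable]: "f \<in> borel_measurable M" "g \<in> borel_measurable M"
  shows "(\<lambda>w. path_loss K \<alpha> (j w) (f w) (g w)) \<in> borel_measurable M"
proof -
  have [measurable]: "(\<lambda>w. K (j w)) \<in> borel_measurable M" "(\<lambda>w. - \<alpha> (j w)) \<in> borel_measurable M"
    by (rule measurable_compose[OF j], simp)+
  show ?thesis unfolding path_loss_def by measurable
qed

text \<open>The serving index with its true arguments: only the links to the user enter, so it is
  measurable with respect to them and can be used in
  \<open>cond_indep_family_select\<close>.\<close>

definition serving_by_user where
  "serving_by_user K \<alpha> x u =
    (LEAST i :: nat. \<forall>k. \<not> path_loss K \<alpha> (u i) (x i) 0 < path_loss K \<alpha> (u k) (x k) 0)"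

lemma serving_eq: "serving K \<alpha> x s = serving_by_user K \<alpha> x (\<lambda>i. s (i, User))"
  by (simp add: serving_def serving_by_user_def is_arg_max_def)

abbreviation user_link_space :: "(nat \<Rightarrow> link_state) measure" where
  "user_link_space \<equiv> PiM UNIV (\<lambda>_. count_space UNIV)"

lemma PiM_component:
  "x \<in> M \<rightarrow>\<^sub>M PiM UNIV (\<lambda>_. N) \<Longrightarrow> (\<lambda>w. x w i) \<in> M \<rightarrow>\<^sub>M N"
  using measurable_compose[OF _ measurable_component_singleton[of i UNIV "\<lambda>_. N"]] by simp

lemma PiM_component_countable:
  fixes I :: "'a \<Rightarrow> 'i::countable"
  shows "x \<in> M \<rightarrow>\<^sub>M PiM UNIV (\<lambda>_. N) \<Longrightarrow> I \<in> M \<rightarrow>\<^sub>M count_space UNIV \<Longrightarrow> (\<lambda>w. x w (I w)) \<in> M \<rightarrow>\<^sub>M N"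
  by (rule measurable_compose_countable[OF PiM_component])

lemma serving_by_user_measurable [measurable (raw)]:
  assumes [measurable]: "x \<in> M \<rightarrow>\<^sub>M point_space" "u \<in> M \<rightarrow>\<^sub>M user_link_space"
  shows "(\<lambda>w. serving_by_user K \<alpha> (x w) (u w)) \<in> M \<rightarrow>\<^sub>M count_space UNIV"
proof -
  have [measurable]: "(\<lambda>w. x w i) \<in> borel_measurable M" "(\<lambda>w. u w i) \<in> M \<rightarrow>\<^sub>M count_space UNIV" for i
    by (rule PiM_component; measurable)+
  show ?thesis unfolding serving_by_user_def by measurable
qed

lemma user_states_measurable:
  assumes s: "s \<in> M \<rightarrow>\<^sub>M link_state_space"
  shows "(\<lambda>w i. s w (i, User)) \<in> M \<rightarrow>\<^sub>M user_link_space"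
  by (rule measurable_PiM_single') (use PiM_component[OF s] in \<open>auto simp: space_PiM\<close>)

lemma serving_measurable [measurable (raw)]:
  assumes [measurable]: "x \<in> M \<rightarrow>\<^sub>M point_space" "s \<in> M \<rightarrow>\<^sub>M link_state_space"
  shows "(\<lambda>w. serving K \<alpha> (x w) (s w)) \<in> M \<rightarrow>\<^sub>M count_space UNIV"
  unfolding serving_eq by (intro serving_by_user_measurable user_states_measurable assms)

lemma serving_state_measurable:
  assumes [measurable]: "x \<in> M \<rightarrow>\<^sub>M point_space" "s \<in> M \<rightarrow>\<^sub>M link_state_space"
  shows "(\<lambda>w. s w (serving K \<alpha> (x w) (s w), v)) \<in> M \<rightarrow>\<^sub>M count_space UNIV"
  by (rule measurable_compose_countable[where g="\<lambda>w. serving K \<alpha> (x w) (s w)" and f="\<lambda>i w. s w (i, v)"])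
     (rule PiM_component[OF assms(2)] serving_measurable[OF assms])+

lemma serving_pos_measurable:
  assumes [measurable]: "x \<in> M \<rightarrow>\<^sub>M point_space" "s \<in> M \<rightarrow>\<^sub>M link_state_space"
  shows "(\<lambda>w. x w (serving K \<alpha> (x w) (s w))) \<in> borel_measurable M"
  by (rule PiM_component_countable[OF assms(1) serving_measurable[OF assms]])

lemma receiver_pos_measurable [measurable (raw)]:
  assumes [measurable]: "z \<in> M \<rightarrow>\<^sub>M point_space"
  shows "(\<lambda>w. receiver_pos (z w) v) \<in> borel_measurable M"
  using PiM_component[OF assms] by (cases v) simp_all

lemma serving_path_loss_measurable [measurable (raw)]:
  assumes [measurable]: "x \<in> M \<rightarrow>\<^sub>M point_space" "z \<in> M \<rightarrow>\<^sub>M point_space" "s \<in> M \<rightarrow>\<^sub>M link_state_space"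
  shows "(\<lambda>w. serving_path_loss K \<alpha> (x w) (z w) (s w) v) \<in> borel_measurable M"
  unfolding serving_path_loss_def Let_def
  by (intro path_loss_measurable serving_state_measurable serving_pos_measurable receiver_pos_measurable assms)

lemma link_law_kernel [measurable]:
  "(\<lambda>d. measure_pmf (link_law C D d)) \<in> borel \<rightarrow>\<^sub>M subprob_algebra (count_space UNIV)"
proof -
  have "(\<lambda>d. measure_pmf (link_law C D d)) = (\<lambda>d. if d \<le> D
      then measure_pmf (map_pmf (\<lambda>b. if b then LOS else NLOS) (bernoulli_pmf C))
      else measure_pmf (map_pmf (\<lambda>b. if b then LOS else NLOS) (bernoulli_pmf 0)))"
    by (auto simp: link_law_def)
  then show ?thesis by (simp add: measure_pmf_in_subprob_algebra)
qed

lemma pmf_link_law: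
  assumes "0 \<le> C" "C \<le> 1"
  shows "pmf (link_law C D d) LOS = (if d \<le> D then C else 0)"
    and "pmf (link_law C D d) NLOS = (if d \<le> D then 1 - C else 1)"
proof -
  have inj: "inj (\<lambda>b. if b then LOS else NLOS)" by (auto simp: inj_def split: if_splits)
  show "pmf (link_law C D d) LOS = (if d \<le> D then C else 0)"
    using pmf_map_inj'[OF inj, of "bernoulli_pmf (if d \<le> D then C else 0)" True] assms
    by (simp add: link_law_def)
  show "pmf (link_law C D d) NLOS = (if d \<le> D then 1 - C else 1)"
    using pmf_map_inj'[OF inj, of "bernoulli_pmf (if d \<le> D then C else 0)" False] assms
    by (simp add: link_law_def)
qed

lemma nn_integral_link_law:
  "(\<integral>\<^sup>+j. f j \<partial>measure_pmf (link_law C D d)) =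
    f LOS * ennreal (pmf (link_law C D d) LOS) + f NLOS * ennreal (pmf (link_law C D d) NLOS)"
proof -
  have "x \<in> {LOS, NLOS}" for x by (cases x) auto
  then show ?thesis by (subst nn_integral_measure_pmf_support[where A="{LOS, NLOS}"]) auto
qed

lemma gamma_law_kernel [measurable (raw)]:
  assumes n: "n \<in> M \<rightarrow>\<^sub>M count_space UNIV" "\<And>w. 0 < n w"
  shows "(\<lambda>w. gamma_law (real (n w))) \<in> M \<rightarrow>\<^sub>M subprob_algebra borel"
proof -
  \<comment> \<open>The maximum with 1 yields a probability measure for every \<open>k\<close>, so
    that the kernel is a function on all of \<open>nat\<close>; it changes nothing at the positive
    values \<open>n w\<close>.\<close>
  have "gamma_law (real (max 1 k)) \<in> space (subprob_algebra borel)" for k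
    using prob_space_gamma_law[of "max 1 k"] by (simp add: space_subprob_algebra prob_space_imp_subprob_space)
  then have "(\<lambda>k. gamma_law (real (max 1 k))) \<in> count_space UNIV \<rightarrow>\<^sub>M subprob_algebra borel"
    by (simp only: measurable_count_space_eq1) auto
  from measurable_compose[OF n(1) this]
  have "(\<lambda>w. gamma_law (real (max 1 (n w)))) \<in> M \<rightarrow>\<^sub>M subprob_algebra borel" .
  moreover have "max 1 (n w) = n w" for w using n(2)[of w] by simp
  ultimately show ?thesis by simp
qed

text \<open>Here \<open>c\<close> is path loss times fading of an eavesdropper and \<open>a\<close>
  the power to stay below; only the antenna gain is averaged. \<open>power_cdf\<close> averages over
  the fading as well, \<open>link_cdf\<close> also over the link state.\<close>

definition gain_cdf :: "real pmf \<Rightarrow> real \<Rightarrow> real \<Rightarrow> ennreal" where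
  "gain_cdf p c a = (\<integral>\<^sup>+y. (if y * c \<le> a then 1 else 0) \<partial>measure_pmf p)"

lemma gain_cdf_le_1: "gain_cdf p c a \<le> 1"
proof -
  have "gain_cdf p c a \<le> (\<integral>\<^sup>+y. 1 \<partial>measure_pmf p)"
    unfolding gain_cdf_def by (intro nn_integral_mono) auto
  then show ?thesis by (simp add: measure_pmf.emeasure_space_1)
qed

lemma pmf_gain_law:
  assumes "0 < \<theta>b" "\<theta>b < 180" "ms \<noteq> Ms"
  shows "pmf (gain_law Ms ms \<theta>b) Ms = \<theta>b / 180" "pmf (gain_law Ms ms \<theta>b) ms = 1 - \<theta>b / 180"
proof -
  have inj: "inj (\<lambda>b. if b then Ms else ms)" using assms by (auto simp: inj_def split: if_splits)
  show "pmf (gain_law Ms ms \<theta>b) Ms = \<theta>b / 180" "pmf (gain_law Ms ms \<theta>b) ms = 1 - \<theta>b / 180"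
    using pmf_map_inj'[OF inj, of "bernoulli_pmf (\<theta>b / 180)" True]
      pmf_map_inj'[OF inj, of "bernoulli_pmf (\<theta>b / 180)" False] assms
    by (simp_all add: gain_law_def)
qed

lemma gain_cdf_gain_law:
  assumes "0 < \<theta>b" "\<theta>b < 180" "ms \<noteq> Ms"
  shows "gain_cdf (gain_law Ms ms \<theta>b) c a =
    ennreal (pmf (gain_law Ms ms \<theta>b) Ms) * (if Ms * c \<le> a then 1 else 0) +
    ennreal (pmf (gain_law Ms ms \<theta>b) ms) * (if ms * c \<le> a then 1 else 0)"
  using assms(1,2) unfolding pmf_gain_law[OF assms]
  by (simp add: gain_cdf_def gain_law_def mult.commute)

lemma gain_cdf_measurable [measurable (raw)]:
  assumes "0 < \<theta>b" "\<theta>b < 180" "ms \<noteq> Ms" and [measurable]: "c \<in> borel_measurable M" "a \<in> borel_measurable M"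
  shows "(\<lambda>w. gain_cdf (gain_law Ms ms \<theta>b) (c w) (a w)) \<in> borel_measurable M"
  unfolding gain_cdf_gain_law[OF assms(1-3)] by measurable

definition power_cdf :: "real pmf \<Rightarrow> nat \<Rightarrow> real \<Rightarrow> real \<Rightarrow> ennreal" where
  "power_cdf p n c a = (\<integral>\<^sup>+y. gain_cdf p (c * y) a \<partial>gamma_law (real n))"

lemma power_cdf_le_1: "0 < n \<Longrightarrow> power_cdf p n c a \<le> 1"
proof -
  assume "0 < n"
  then interpret prob_space "gamma_law (real n)" by (rule prob_space_gamma_law)
  have "power_cdf p n c a \<le> (\<integral>\<^sup>+y. 1 \<partial>gamma_law (real n))"
    unfolding power_cdf_def by (intro nn_integral_mono gain_cdf_le_1)
  then show ?thesis by (simp add: emeasure_space_1)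
qed

lemma power_cdf_measurable [measurable (raw)]:
  assumes par: "0 < \<theta>b" "\<theta>b < 180" "ms \<noteq> Ms" and n: "n \<in> M \<rightarrow>\<^sub>M count_space UNIV" "\<And>w. 0 < n w"
    and [measurable]: "c \<in> borel_measurable M" "a \<in> borel_measurable M"
  shows "(\<lambda>w. power_cdf (gain_law Ms ms \<theta>b) (n w) (c w) (a w)) \<in> borel_measurable M"
  unfolding power_cdf_def
  by (rule nn_integral_measurable_subprob_algebra2[where N=borel])
     (use par in \<open>measurable, auto intro: gamma_law_kernel n\<close>)

text \<open>For each gain \<open>V\<close> the event is that the fading is at most
  \<open>a / (V * c)\<close>, a gamma distribution function; the weights of the two gains add up to
  1.\<close>

lemma power_cdf_gain_law:
  assumes par: "0 < \<theta>b" "\<theta>b < 180" "0 < ms" "ms < Ms" and n: "0 < n" and c: "0 < c" and a: "0 < a"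
  shows "power_cdf (gain_law Ms ms \<theta>b) n c a =
    ennreal (1 - (pmf (gain_law Ms ms \<theta>b) Ms * gamma_tail n (a / (Ms * c)) +
      pmf (gain_law Ms ms \<theta>b) ms * gamma_tail n (a / (ms * c))))"
proof -
  let ?p = "gain_law Ms ms \<theta>b"
  have ne: "ms \<noteq> Ms" using par by simp
  have ev: "V * (c * y) \<le> a \<longleftrightarrow> y \<in> {..a / (V * c)}" if "0 < V" for V y
    using that c by (simp add: field_simps)
  have cdf: "(\<integral>\<^sup>+y. (if V * (c * y) \<le> a then 1 else 0) \<partial>gamma_law (real n)) = ennreal (1 - gamma_tail n (a / (V * c)))"
    if V: "0 < V" for V
  proof -
    have "(\<integral>\<^sup>+y. (if V * (c * y) \<le> a then 1 else 0) \<partial>gamma_law (real n)) =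
        (\<integral>\<^sup>+y. indicator {..a / (V * c)} y \<partial>gamma_law (real n))"
      by (intro nn_integral_cong) (simp add: ev[OF V] indicator_def)
    also have "\<dots> = ennreal (1 - gamma_tail n (a / (V * c)))"
      using V c a by (simp add: emeasure_gamma_law_atMost[OF n])
    finally show ?thesis .
  qed
  have p: "0 \<le> pmf ?p Ms" "0 \<le> pmf ?p ms" "pmf ?p Ms + pmf ?p ms = 1"
    by (rule pmf_nonneg, rule pmf_nonneg, simp add: pmf_gain_law[OF par(1,2) ne])
  have g: "0 \<le> 1 - gamma_tail n (a / (V * c))" if "0 < V" for V
    using gamma_tail_bounds(2)[of "a / (V * c)" n] that c a by simp
  have "power_cdf ?p n c a = ennreal (pmf ?p Ms) * ennreal (1 - gamma_tail n (a / (Ms * c))) +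
      ennreal (pmf ?p ms) * ennreal (1 - gamma_tail n (a / (ms * c)))"
    using par unfolding power_cdf_def gain_cdf_gain_law[OF par(1,2) ne]
    by (subst nn_integral_add) (simp_all add: nn_integral_cmult cdf)
  also have "\<dots> = ennreal (pmf ?p Ms * (1 - gamma_tail n (a / (Ms * c))) +
      pmf ?p ms * (1 - gamma_tail n (a / (ms * c))))"
    using p g par by (simp add: ennreal_mult[symmetric] ennreal_plus[symmetric] del: ennreal_plus)
  also have "pmf ?p Ms * (1 - gamma_tail n (a / (Ms * c))) + pmf ?p ms * (1 - gamma_tail n (a / (ms * c))) =
     1 - (pmf ?p Ms * gamma_tail n (a / (Ms * c)) + pmf ?p ms * gamma_tail n (a / (ms * c)))"
    using p(3) by (simp add: algebra_simps)
  finally show ?thesis .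
qed

section \<open>The network\<close>

locale network = prob_space M + BS: ppp M lam_B X + EV: ppp M lam_E Z
  for M :: "'w measure" and lam_B lam_E :: real and X Z :: "'w \<Rightarrow> nat \<Rightarrow> real^2" +
  fixes C D Ms ms \<theta>b :: real and K \<alpha> :: "link_state \<Rightarrow> real" and N :: "link_state \<Rightarrow> nat"
    and S :: "'w \<Rightarrow> nat \<times> receiver \<Rightarrow> link_state" and H :: "'w \<Rightarrow> receiver \<Rightarrow> real" and G :: "'w \<Rightarrow> nat \<Rightarrow> real"
  assumes D: "0 < D" and C: "0 \<le> C" "C \<le> 1"
    and K: "\<And>j. 0 < K j" and \<alpha>: "\<And>j. 0 < \<alpha> j" and N: "\<And>j. 0 < N j"
    and gains: "0 < ms" "ms < Ms" and \<theta>b: "0 < \<theta>b" "\<theta>b < 180"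
    and XZ: "indep_var point_space X point_space Z"
    and blockage: "cond_indep_law M (point_space \<Otimes>\<^sub>M point_space) (\<lambda>\<omega>. (X \<omega>, Z \<omega>)) (count_space UNIV) S
           (\<lambda>(i, v) (x, z). measure_pmf (link_law C D (dist (x i) (receiver_pos z v))))"
    and fading: "cond_indep_law M (point_space \<Otimes>\<^sub>M point_space \<Otimes>\<^sub>M link_state_space)
           (\<lambda>\<omega>. (X \<omega>, Z \<omega>, S \<omega>)) borel H
           (\<lambda>v (x, z, s). gamma_law (real (N (s (serving K \<alpha> x s, v)))))"
    and antenna_gain: "cond_indep_law M
           (point_space \<Otimes>\<^sub>M point_space \<Otimes>\<^sub>M link_state_space \<Otimes>\<^sub>M PiM UNIV (\<lambda>_. borel))
           (\<lambda>\<omega>. (X \<omega>, Z \<omega>, S \<omega>, H \<omega>)) borel G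
           (\<lambda>k _. measure_pmf (gain_law Ms ms \<theta>b))"
begin

sublocale S: cond_indep_family M "point_space \<Otimes>\<^sub>M point_space" "\<lambda>\<omega>. (X \<omega>, Z \<omega>)" "count_space UNIV" S
  "\<lambda>p w. measure_pmf (link_law C D (dist (fst w (fst p)) (receiver_pos (snd w) (snd p))))"
proof
  show "cond_indep_law M (point_space \<Otimes>\<^sub>M point_space) (\<lambda>\<omega>. (X \<omega>, Z \<omega>)) (count_space UNIV) S
    (\<lambda>p w. measure_pmf (link_law C D (dist (fst w (fst p)) (receiver_pos (snd w) (snd p)))))"
    using blockage by (simp add: case_prod_beta')
  fix p :: "nat \<times> receiver"
  have "(\<lambda>w. dist (fst w (fst p)) (receiver_pos (snd w) (snd p))) \<in> borel_measurable (point_space \<Otimes>\<^sub>M point_space)"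
    by (intro borel_measurable_dist PiM_component[where N=borel] receiver_pos_measurable) measurable
  from measurable_compose[OF this link_law_kernel]
  show "(\<lambda>w. measure_pmf (link_law C D (dist (fst w (fst p)) (receiver_pos (snd w) (snd p)))))
    \<in> point_space \<Otimes>\<^sub>M point_space \<rightarrow>\<^sub>M subprob_algebra (count_space UNIV)" .
qed

lemma N_measurable [measurable (raw)]:
  "j \<in> L \<rightarrow>\<^sub>M count_space UNIV \<Longrightarrow> (\<lambda>w. N (j w)) \<in> L \<rightarrow>\<^sub>M count_space UNIV"
  by (erule measurable_compose) simp

sublocale H: cond_indep_family M "point_space \<Otimes>\<^sub>M point_space \<Otimes>\<^sub>M link_state_space" "\<lambda>\<omega>. (X \<omega>, Z \<omega>, S \<omega>)" borel H
  "\<lambda>v w. gamma_law (real (N (snd (snd w) (serving K \<alpha> (fst w) (snd (snd w)), v))))"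
proof
  show "cond_indep_law M (point_space \<Otimes>\<^sub>M point_space \<Otimes>\<^sub>M link_state_space) (\<lambda>\<omega>. (X \<omega>, Z \<omega>, S \<omega>)) borel H
    (\<lambda>v w. gamma_law (real (N (snd (snd w) (serving K \<alpha> (fst w) (snd (snd w)), v)))))"
    using fading by (simp add: case_prod_beta')
  show "(\<lambda>w. gamma_law (real (N (snd (snd w) (serving K \<alpha> (fst w) (snd (snd w)), v)))))
    \<in> point_space \<Otimes>\<^sub>M point_space \<Otimes>\<^sub>M link_state_space \<rightarrow>\<^sub>M subprob_algebra borel" for v
    by (intro gamma_law_kernel N N_measurable serving_state_measurable) measurable
qed

text \<open>The gain law as a measure on the Borel sets: all sets are measurable for \<^const>\<open>measure_pmf\<close>.\<close>

definition gain_measure :: "real measure" where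
  "gain_measure = distr (measure_pmf (gain_law Ms ms \<theta>b)) borel id"

lemma gain_measure_kernel [measurable]: "gain_measure \<in> space (subprob_algebra borel)"
  unfolding gain_measure_def space_subprob_algebra
  by (auto intro!: prob_space_imp_subprob_space measure_pmf.prob_space_distr)

sublocale G: cond_indep_family M "point_space \<Otimes>\<^sub>M point_space \<Otimes>\<^sub>M link_state_space \<Otimes>\<^sub>M PiM UNIV (\<lambda>_. borel)"
  "\<lambda>\<omega>. (X \<omega>, Z \<omega>, S \<omega>, H \<omega>)" borel G "\<lambda>k _. gain_measure"
proof
  show "cond_indep_law M (point_space \<Otimes>\<^sub>M point_space \<Otimes>\<^sub>M link_state_space \<Otimes>\<^sub>M PiM UNIV (\<lambda>_. borel))
     (\<lambda>\<omega>. (X \<omega>, Z \<omega>, S \<omega>, H \<omega>)) borel G (\<lambda>k _. gain_measure)"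
    by (rule cond_indep_law_cong[OF antenna_gain]) (simp add: gain_measure_def emeasure_distr)
qed (simp add: gain_measure_kernel)

text \<open>Moves the user's fading into the conditioning. \<open>split\<close> conditions on a
  family of coordinates, so the single variable is a family indexed by \<open>unit\<close>.\<close>

sublocale H_Eve: cond_indep_family M "(point_space \<Otimes>\<^sub>M point_space \<Otimes>\<^sub>M link_state_space) \<Otimes>\<^sub>M PiM UNIV (\<lambda>_::unit. borel)"
  "\<lambda>\<omega>. ((X \<omega>, Z \<omega>, S \<omega>), \<lambda>_. H \<omega> User)" borel "\<lambda>\<omega> k. H \<omega> (Eve k)"
  "\<lambda>k w. gamma_law (real (N (snd (snd (fst w)) (serving K \<alpha> (fst (fst w)) (snd (snd (fst w))), Eve k))))"
  using H.split[of "\<lambda>_::unit. User" Eve] by (auto simp: inj_def)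

abbreviation serving_w :: "((nat \<Rightarrow> real^2) \<times> (nat \<Rightarrow> real^2)) \<times> (nat \<Rightarrow> link_state) \<Rightarrow> nat" where
  "serving_w w \<equiv> serving_by_user K \<alpha> (fst (fst w)) (snd w)"

text \<open>
  The serving index is a function of the locations and of the links to the user, so conditioning on
  these leaves the links of the serving station to the eavesdroppers fresh.
\<close>

sublocale S_Eve: cond_indep_family M "(point_space \<Otimes>\<^sub>M point_space) \<Otimes>\<^sub>M user_link_space"
  "\<lambda>\<omega>. ((X \<omega>, Z \<omega>), \<lambda>i. S \<omega> (i, User))" "count_space UNIV" "\<lambda>\<omega> k. S \<omega> (serving K \<alpha> (X \<omega>) (S \<omega>), Eve k)"
  "\<lambda>k w. measure_pmf (link_law C D (dist (fst (fst w) (serving_w w)) (snd (fst w) k)))"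
proof -
  have split: "cond_indep_family M ((point_space \<Otimes>\<^sub>M point_space) \<Otimes>\<^sub>M user_link_space)
    (\<lambda>\<omega>. ((X \<omega>, Z \<omega>), \<lambda>i. S \<omega> (i, User))) (count_space UNIV) (\<lambda>\<omega> p. S \<omega> (fst p, Eve (snd p)))
    (\<lambda>p w. measure_pmf (link_law C D (dist (fst (fst w) (fst p)) (snd (fst w) (snd p)))))"
    using S.split[of "\<lambda>i. (i, User)" "\<lambda>p. (fst p, Eve (snd p))"] by (auto simp: inj_def)
  show "cond_indep_family M ((point_space \<Otimes>\<^sub>M point_space) \<Otimes>\<^sub>M user_link_space)
    (\<lambda>\<omega>. ((X \<omega>, Z \<omega>), \<lambda>i. S \<omega> (i, User))) (count_space UNIV) (\<lambda>\<omega> k. S \<omega> (serving K \<alpha> (X \<omega>) (S \<omega>), Eve k))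
    (\<lambda>k w. measure_pmf (link_law C D (dist (fst (fst w) (serving_w w)) (snd (fst w) k))))"
    using cond_indep_family_select[OF split, of serving_w] by (simp add: serving_eq)
qed

section \<open>Averaging over gains, fading and link states of the eavesdroppers\<close>

abbreviation "gain \<equiv> gain_law Ms ms \<theta>b"
abbreviation "sv \<omega> \<equiv> serving K \<alpha> (X \<omega>) (S \<omega>)"
abbreviation "user_state \<omega> \<equiv> S \<omega> (sv \<omega>, User)"
abbreviation "pl \<omega> v \<equiv> serving_path_loss K \<alpha> (X \<omega>) (Z \<omega>) (S \<omega>) v"

lemma ms_ne_Ms: "ms \<noteq> Ms" using gains by simp

lemmas cdf_measurable [measurable (raw)] =
  gain_cdf_measurable[OF \<theta>b ms_ne_Ms] power_cdf_measurable[OF \<theta>b ms_ne_Ms]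

lemma sv_measurable [measurable]: "(\<lambda>\<omega>. sv \<omega>) \<in> M \<rightarrow>\<^sub>M count_space UNIV"
  by (intro serving_measurable BS.Z_measurable S.Y_measurable)

lemma state_measurable [measurable]: "(\<lambda>\<omega>. S \<omega> (sv \<omega>, v)) \<in> M \<rightarrow>\<^sub>M count_space UNIV"
  by (intro serving_state_measurable BS.Z_measurable S.Y_measurable)

lemma pl_measurable [measurable]: "(\<lambda>\<omega>. pl \<omega> v) \<in> borel_measurable M"
  by (intro serving_path_loss_measurable BS.Z_measurable EV.Z_measurable S.Y_measurable)

lemma sv_pos_measurable [measurable]: "(\<lambda>\<omega>. X \<omega> (sv \<omega>)) \<in> borel_measurable M"
  by (intro serving_pos_measurable BS.Z_measurable S.Y_measurable)

lemma prob_secure_finite_gain: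
  "emeasure M {\<omega>\<in>space M. \<forall>k<n. G \<omega> k * pl \<omega> (Eve k) * H \<omega> (Eve k) \<le> Ms * pl \<omega> User * H \<omega> User}
    = (\<integral>\<^sup>+\<omega>. (\<Prod>k<n. gain_cdf gain (pl \<omega> (Eve k) * H \<omega> (Eve k)) (Ms * pl \<omega> User * H \<omega> User)) \<partial>M)"
    (is "emeasure M ?E = _")
proof -
  let ?MW = "point_space \<Otimes>\<^sub>M point_space \<Otimes>\<^sub>M link_state_space \<Otimes>\<^sub>M PiM UNIV (\<lambda>_::receiver. borel :: real measure)"
  let ?pl = "\<lambda>w v. serving_path_loss K \<alpha> (fst w) (fst (snd w)) (fst (snd (snd w))) v"
  let ?h = "\<lambda>w. snd (snd (snd w)) :: receiver \<Rightarrow> real"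
  let ?f = "\<lambda>k wy. (if snd wy * (?pl (fst wy) (Eve k) * ?h (fst wy) (Eve k)) \<le> Ms * ?pl (fst wy) User * ?h (fst wy) User
      then 1 else 0 :: ennreal)"
  have h: "(\<lambda>w. ?h w v) \<in> borel_measurable ?MW" for v
    by (rule PiM_component) measurable
  have pl: "(\<lambda>w. ?pl w v) \<in> borel_measurable ?MW" for v
    by (intro serving_path_loss_measurable) measurable
  note [measurable] = measurable_compose[OF measurable_fst h] measurable_compose[OF measurable_fst pl]
  have f: "?f k \<in> borel_measurable (?MW \<Otimes>\<^sub>M borel)" for k by measurable
  have E: "?E \<in> sets M"
    by measurable
  have "emeasure M ?E = (\<integral>\<^sup>+\<omega>. indicator ?E \<omega> \<partial>M)"
    using E by (rule nn_integral_indicator[symmetric])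
  also have "\<dots> = (\<integral>\<^sup>+\<omega>. 1 * (\<Prod>k<n. ?f k ((X \<omega>, Z \<omega>, S \<omega>, H \<omega>), G \<omega> k)) \<partial>M)"
  proof (intro nn_integral_cong)
    fix \<omega> assume \<omega>: "\<omega> \<in> space M"
    have "(\<Prod>k<n. ?f k ((X \<omega>, Z \<omega>, S \<omega>, H \<omega>), G \<omega> k)) =
      (\<Prod>k<n. indicator {k. G \<omega> k * pl \<omega> (Eve k) * H \<omega> (Eve k) \<le> Ms * pl \<omega> User * H \<omega> User} k)"
      by (intro prod.cong) (auto simp: mult.assoc)
    also have "\<dots> = indicator ?E \<omega>"
      using prod_indicator_Ball[of "{..<n}" "\<lambda>_. {k. G \<omega> k * pl \<omega> (Eve k) * H \<omega> (Eve k) \<le> Ms * pl \<omega> User * H \<omega> User}" "\<lambda>k. k"] \<omega>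
      by (auto simp: indicator_def)
    finally show "indicator ?E \<omega> = 1 * (\<Prod>k<n. ?f k ((X \<omega>, Z \<omega>, S \<omega>, H \<omega>), G \<omega> k))" by simp
  qed
  also have "\<dots> = (\<integral>\<^sup>+\<omega>. 1 * (\<Prod>k<n. \<integral>\<^sup>+y. ?f k ((X \<omega>, Z \<omega>, S \<omega>, H \<omega>), y) \<partial>gain_measure) \<partial>M)"
    by (rule G.nn_integral_law[where f="?f" and g="\<lambda>_. 1"]) (use f in auto)
  also have "\<dots> = (\<integral>\<^sup>+\<omega>. (\<Prod>k<n. gain_cdf gain (pl \<omega> (Eve k) * H \<omega> (Eve k)) (Ms * pl \<omega> User * H \<omega> User)) \<partial>M)"
    unfolding gain_measure_def gain_cdf_def by (simp add: nn_integral_distr)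
  finally show ?thesis .
qed

text \<open>All factors contain the user's fading, so it is held fixed while those of the
  eavesdroppers are integrated out independently; it is then integrated itself, relative to
  locations and link states.\<close>

lemma prob_secure_finite_fading:
  "(\<integral>\<^sup>+\<omega>. (\<Prod>k<n. gain_cdf gain (pl \<omega> (Eve k) * H \<omega> (Eve k)) (Ms * pl \<omega> User * H \<omega> User)) \<partial>M) =
   (\<integral>\<^sup>+\<omega>. (\<integral>\<^sup>+y. (\<Prod>k<n. power_cdf gain (N (S \<omega> (sv \<omega>, Eve k))) (pl \<omega> (Eve k)) (Ms * pl \<omega> User * y))
      \<partial>gamma_law (real (N (user_state \<omega>)))) \<partial>M)"
proof -
  let ?MW = "point_space \<Otimes>\<^sub>M point_space \<Otimes>\<^sub>M link_state_space"
  let ?pl = "\<lambda>w v. serving_path_loss K \<alpha> (fst w) (fst (snd w)) (snd (snd w)) v"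
  let ?st = "\<lambda>w v. snd (snd w) (serving K \<alpha> (fst w) (snd (snd w)), v)"
  have pl: "(\<lambda>w. ?pl w v) \<in> borel_measurable ?MW" for v
    by (intro serving_path_loss_measurable) measurable
  have st: "(\<lambda>w. ?st w v) \<in> ?MW \<rightarrow>\<^sub>M count_space UNIV" for v
    by (intro serving_state_measurable) measurable
  let ?f = "\<lambda>k wy. gain_cdf gain (?pl (fst (fst wy)) (Eve k) * snd wy) (Ms * ?pl (fst (fst wy)) User * snd (fst wy) ())"
  let ?g = "\<lambda>wy. \<Prod>k<n. power_cdf gain (N (?st (fst wy) (Eve k))) (?pl (fst wy) (Eve k)) (Ms * ?pl (fst wy) User * snd wy)"
  have "(\<lambda>w. snd w () :: real) \<in> borel_measurable (?MW \<Otimes>\<^sub>M PiM UNIV (\<lambda>_::unit. borel))"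
    by (rule PiM_component) measurable
  note [measurable] = pl st measurable_compose[OF measurable_fst this] measurable_compose[OF measurable_fst pl]
    measurable_compose[OF measurable_fst st] measurable_compose[OF measurable_compose[OF measurable_fst measurable_fst] pl]
  have f: "?f k \<in> borel_measurable ((?MW \<Otimes>\<^sub>M PiM UNIV (\<lambda>_::unit. borel)) \<Otimes>\<^sub>M borel)" for k
    by (intro cdf_measurable) measurable
  have g: "?g \<in> borel_measurable (?MW \<Otimes>\<^sub>M borel)"
    by (intro borel_measurable_prod_ennreal cdf_measurable N_measurable N) measurable
  have "(\<integral>\<^sup>+\<omega>. (\<Prod>k<n. gain_cdf gain (pl \<omega> (Eve k) * H \<omega> (Eve k)) (Ms * pl \<omega> User * H \<omega> User)) \<partial>M) =
      (\<integral>\<^sup>+\<omega>. 1 * (\<Prod>k<n. ?f k (((X \<omega>, Z \<omega>, S \<omega>), \<lambda>_. H \<omega> User), H \<omega> (Eve k))) \<partial>M)"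
    by simp
  also have "\<dots> = (\<integral>\<^sup>+\<omega>. 1 * (\<Prod>k<n. \<integral>\<^sup>+y. ?f k (((X \<omega>, Z \<omega>, S \<omega>), \<lambda>_. H \<omega> User), y)
      \<partial>gamma_law (real (N (S \<omega> (sv \<omega>, Eve k))))) \<partial>M)"
    using H_Eve.nn_integral_law[of "{..<n}" "\<lambda>_. 1" ?f] f by (simp add: gain_cdf_le_1)
  also have "\<dots> = (\<integral>\<^sup>+\<omega>. 1 * (\<Prod>v\<in>{User}. ?g ((X \<omega>, Z \<omega>, S \<omega>), H \<omega> v)) \<partial>M)"
    by (simp add: power_cdf_def)
  also have "\<dots> = (\<integral>\<^sup>+\<omega>. 1 * (\<Prod>v\<in>{User}. \<integral>\<^sup>+y. ?g ((X \<omega>, Z \<omega>, S \<omega>), y) \<partial>gamma_law (real (N (S \<omega> (sv \<omega>, v))))) \<partial>M)"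
    using H.nn_integral_law[of "{User}" "\<lambda>_. 1" "\<lambda>_. ?g"] g by (simp add: prod_le_1 power_cdf_le_1 N)
  finally show ?thesis by simp
qed

definition link_cdf :: "real \<Rightarrow> real \<Rightarrow> ennreal" where
  "link_cdf d a = (\<integral>\<^sup>+j. power_cdf gain (N j) (K j * d powr (- \<alpha> j)) a \<partial>measure_pmf (link_law C D d))"

lemma link_cdf_le_1: "link_cdf d a \<le> 1"
proof -
  have "link_cdf d a \<le> (\<integral>\<^sup>+j. 1 \<partial>measure_pmf (link_law C D d))"
    unfolding link_cdf_def by (intro nn_integral_mono power_cdf_le_1 N)
  then show ?thesis by (simp add: measure_pmf.emeasure_space_1)
qed

lemma link_cdf_measurable [measurable (raw)]:
  assumes [measurable]: "d \<in> borel_measurable L" "a \<in> borel_measurable L"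
  shows "(\<lambda>w. link_cdf (d w) (a w)) \<in> borel_measurable L"
  unfolding link_cdf_def
proof (rule nn_integral_measurable_subprob_algebra2[where N="count_space UNIV"])
  show "(\<lambda>w. measure_pmf (link_law C D (d w))) \<in> L \<rightarrow>\<^sub>M subprob_algebra (count_space UNIV)"
    by (rule measurable_compose[OF assms(1) link_law_kernel])
  have [measurable]: "(\<lambda>wj. K (snd wj)) \<in> borel_measurable (L \<Otimes>\<^sub>M count_space UNIV)"
    "(\<lambda>wj. \<alpha> (snd wj)) \<in> borel_measurable (L \<Otimes>\<^sub>M count_space UNIV)"
    by (rule measurable_compose[OF measurable_snd], simp)+
  have "(\<lambda>wj. power_cdf gain (N (snd wj)) (K (snd wj) * d (fst wj) powr (- \<alpha> (snd wj))) (a (fst wj)))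
      \<in> borel_measurable (L \<Otimes>\<^sub>M count_space UNIV)"
    by (intro cdf_measurable N_measurable N) measurable
  then show "(\<lambda>(w, j). power_cdf gain (N j) (K j * d w powr (- \<alpha> j)) (a w))
      \<in> borel_measurable (L \<Otimes>\<^sub>M count_space UNIV)"
    by (simp add: case_prod_beta')
qed

lemma N_user_kernel: "(\<lambda>\<omega>. gamma_law (real (N (user_state \<omega>)))) \<in> M \<rightarrow>\<^sub>M subprob_algebra borel"
  by (intro gamma_law_kernel N_measurable N state_measurable)

text \<open>The inner law varies with \<open>\<omega>\<close>. Writing it by its Lebesgue density
  moves this dependence into a factor, so that the integrals can be exchanged and the link states
  averaged for each fixed \<open>y\<close>.\<close>

lemma prob_secure_finite_blockage:
  "(\<integral>\<^sup>+\<omega>. (\<integral>\<^sup>+y. (\<Prod>k<n. power_cdf gain (N (S \<omega> (sv \<omega>, Eve k))) (pl \<omega> (Eve k)) (Ms * pl \<omega> User * y))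
      \<partial>gamma_law (real (N (user_state \<omega>)))) \<partial>M) =
   (\<integral>\<^sup>+\<omega>. (\<integral>\<^sup>+y. (\<Prod>k<n. link_cdf (dist (X \<omega> (sv \<omega>)) (Z \<omega> k)) (Ms * pl \<omega> User * y))
      \<partial>gamma_law (real (N (user_state \<omega>)))) \<partial>M)"
proof -
  interpret MB: pair_sigma_finite M lborel ..
  let ?d = "\<lambda>\<omega> y. ennreal (gamma_density (N (user_state \<omega>)) y)"
  let ?p = "\<lambda>\<omega> y. \<Prod>k<n. power_cdf gain (N (S \<omega> (sv \<omega>, Eve k))) (pl \<omega> (Eve k)) (Ms * pl \<omega> User * y)"
  let ?q = "\<lambda>\<omega> y. \<Prod>k<n. link_cdf (dist (X \<omega> (sv \<omega>)) (Z \<omega> k)) (Ms * pl \<omega> User * y)"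
  have [measurable]: "(\<lambda>w. ?d (fst w) (snd w)) \<in> borel_measurable (M \<Otimes>\<^sub>M borel)"
  proof (rule measurable_compose_countable[where g="\<lambda>w. N (user_state (fst w))" and f="\<lambda>n w. ennreal (gamma_density n (snd w))"])
    show "(\<lambda>w. N (user_state (fst w))) \<in> M \<Otimes>\<^sub>M borel \<rightarrow>\<^sub>M count_space UNIV"
      by (rule measurable_compose[OF measurable_fst N_measurable[OF state_measurable]])
    show "(\<lambda>w. ennreal (gamma_density n (snd w))) \<in> borel_measurable (M \<Otimes>\<^sub>M borel)" for n
      by measurable
  qed
  have p [measurable]: "(\<lambda>w. ?p (fst w) (snd w)) \<in> borel_measurable (M \<Otimes>\<^sub>M borel)"
    by (intro borel_measurable_prod_ennreal cdf_measurable N_measurable N) measurable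
  have q [measurable]: "(\<lambda>w. ?q (fst w) (snd w)) \<in> borel_measurable (M \<Otimes>\<^sub>M borel)"
    by (intro borel_measurable_prod_ennreal link_cdf_measurable) measurable
  have p1: "?p \<omega> \<in> borel_measurable borel" and q1: "?q \<omega> \<in> borel_measurable borel" for \<omega>
    by (intro borel_measurable_prod_ennreal cdf_measurable link_cdf_measurable N; measurable)+
  let ?MW = "(point_space \<Otimes>\<^sub>M point_space) \<Otimes>\<^sub>M user_link_space"
  let ?x = "\<lambda>w. fst (fst w) (serving_w w)"
  let ?u = "\<lambda>w. snd w (serving_w w)"
  have sw: "serving_w \<in> ?MW \<rightarrow>\<^sub>M count_space UNIV"
    by (intro serving_by_user_measurable) measurable
  have x: "?x \<in> borel_measurable ?MW"
    by (rule PiM_component_countable[where x="\<lambda>w. fst (fst w)", OF _ sw])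
       (rule measurable_compose[OF measurable_fst measurable_fst])
  have u: "?u \<in> ?MW \<rightarrow>\<^sub>M count_space UNIV"
    by (rule PiM_component_countable[where x=snd, OF measurable_snd sw])
  have z: "(\<lambda>w. snd (fst w) k) \<in> borel_measurable ?MW" for k
    by (rule PiM_component[where x="\<lambda>w. snd (fst w)", OF measurable_compose[OF measurable_fst measurable_snd]])
  note [measurable] = x u z measurable_compose[OF measurable_fst x] measurable_compose[OF measurable_fst u]
    measurable_compose[OF measurable_fst z]
  have pl_User: "pl \<omega> User = path_loss K \<alpha> (user_state \<omega>) (X \<omega> (sv \<omega>)) 0" for \<omega>
    by (simp add: serving_path_loss_def Let_def)
  \<comment> \<open>The density factor depends on the user's link state alone, hence on the
    conditioning element of \<open>S_Eve\<close>, and serves as the weight in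
    \<open>nn_integral_law\<close>.\<close>
  have fixed: "(\<integral>\<^sup>+\<omega>. ?d \<omega> y * ?p \<omega> y \<partial>M) = (\<integral>\<^sup>+\<omega>. ?d \<omega> y * ?q \<omega> y \<partial>M)" for y
  proof -
    let ?g = "\<lambda>w. ennreal (gamma_density (N (?u w)) y)"
    let ?f = "\<lambda>k wj. power_cdf gain (N (snd wj)) (path_loss K \<alpha> (snd wj) (?x (fst wj)) (snd (fst (fst wj)) k))
        (Ms * path_loss K \<alpha> (?u (fst wj)) (?x (fst wj)) 0 * y)"
    have "?g \<in> borel_measurable ?MW"
      by (rule measurable_compose[OF u]) simp
    moreover have "?f k \<in> borel_measurable (?MW \<Otimes>\<^sub>M count_space UNIV)" for k
      by (intro cdf_measurable N_measurable N path_loss_measurable) measurable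
    ultimately have "(\<integral>\<^sup>+\<omega>. ?g ((X \<omega>, Z \<omega>), \<lambda>i. S \<omega> (i, User)) *
        (\<Prod>k<n. ?f k (((X \<omega>, Z \<omega>), \<lambda>i. S \<omega> (i, User)), S \<omega> (sv \<omega>, Eve k))) \<partial>M) =
      (\<integral>\<^sup>+\<omega>. ?g ((X \<omega>, Z \<omega>), \<lambda>i. S \<omega> (i, User)) *
        (\<Prod>k<n. \<integral>\<^sup>+j. ?f k (((X \<omega>, Z \<omega>), \<lambda>i. S \<omega> (i, User)), j)
            \<partial>measure_pmf (link_law C D (dist (X \<omega> (sv \<omega>)) (Z \<omega> k)))) \<partial>M)"
      using S_Eve.nn_integral_law[of "{..<n}" ?g ?f] by (simp add: power_cdf_le_1 N serving_eq[symmetric])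
    then show ?thesis
      unfolding pl_User by (simp add: serving_eq[symmetric] serving_path_loss_def Let_def link_cdf_def path_loss_def)
  qed
  have "(\<integral>\<^sup>+\<omega>. (\<integral>\<^sup>+y. ?p \<omega> y \<partial>gamma_law (real (N (user_state \<omega>)))) \<partial>M) = (\<integral>\<^sup>+\<omega>. (\<integral>\<^sup>+y. ?d \<omega> y * ?p \<omega> y \<partial>lborel) \<partial>M)"
    by (simp add: nn_integral_gamma_law N p1)
  also have "\<dots> = (\<integral>\<^sup>+y. (\<integral>\<^sup>+\<omega>. ?d \<omega> y * ?p \<omega> y \<partial>M) \<partial>lborel)"
    by (rule MB.Fubini'[symmetric]) (simp add: case_prod_beta')
  also have "\<dots> = (\<integral>\<^sup>+y. (\<integral>\<^sup>+\<omega>. ?d \<omega> y * ?q \<omega> y \<partial>M) \<partial>lborel)"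
    by (simp add: fixed)
  also have "\<dots> = (\<integral>\<^sup>+\<omega>. (\<integral>\<^sup>+y. ?d \<omega> y * ?q \<omega> y \<partial>lborel) \<partial>M)"
    by (rule MB.Fubini') (simp add: case_prod_beta')
  also have "\<dots> = (\<integral>\<^sup>+\<omega>. (\<integral>\<^sup>+y. ?q \<omega> y \<partial>gamma_law (real (N (user_state \<omega>)))) \<partial>M)"
    by (simp add: nn_integral_gamma_law N q1)
  finally show ?thesis .
qed

abbreviation "secure_event \<equiv>
  {\<omega>\<in>space M. \<forall>k. G \<omega> k * pl \<omega> (Eve k) * H \<omega> (Eve k) \<le> Ms * pl \<omega> User * H \<omega> User}"

text \<open>The secure event is the decreasing limit of the events for the first \<open>n\<close>
  eavesdroppers. The limit passes through both integrals by decreasing monotone convergence, which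
  is legitimate because the value at \<open>n = 0\<close> is 1.\<close>

lemma prob_secure_INF:
  "emeasure M secure_event =
   (\<integral>\<^sup>+\<omega>. (\<integral>\<^sup>+y. (INF n. \<Prod>k<n. link_cdf (dist (X \<omega> (sv \<omega>)) (Z \<omega> k)) (Ms * pl \<omega> User * y))
      \<partial>gamma_law (real (N (user_state \<omega>)))) \<partial>M)"
proof -
  let ?E = "\<lambda>n. {\<omega>\<in>space M. \<forall>k<n. G \<omega> k * pl \<omega> (Eve k) * H \<omega> (Eve k) \<le> Ms * pl \<omega> User * H \<omega> User}"
  let ?q = "\<lambda>n \<omega> y. \<Prod>k<n. link_cdf (dist (X \<omega> (sv \<omega>)) (Z \<omega> k)) (Ms * pl \<omega> User * y)"
  let ?I = "\<lambda>n \<omega>. \<integral>\<^sup>+y. ?q n \<omega> y \<partial>gamma_law (real (N (user_state \<omega>)))"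
  have E: "?E n \<in> sets M" for n by measurable
  have q1: "?q n \<omega> \<in> borel_measurable (gamma_law k)" for n \<omega> k
    by (intro borel_measurable_prod_ennreal link_cdf_measurable) measurable
  have I: "?I n \<in> borel_measurable M" for n
  proof (rule nn_integral_measurable_subprob_algebra2[OF _ N_user_kernel])
    have "(\<lambda>w. ?q n (fst w) (snd w)) \<in> borel_measurable (M \<Otimes>\<^sub>M borel)"
      by (intro borel_measurable_prod_ennreal link_cdf_measurable) measurable
    then show "(\<lambda>(\<omega>, y). ?q n \<omega> y) \<in> borel_measurable (M \<Otimes>\<^sub>M borel)" by (simp add: case_prod_beta')
  qed
  have q_dec: "decseq (\<lambda>n. ?q n \<omega>)" for \<omega>
  proof (intro decseq_SucI le_funI)
    fix n y
    have "?q n \<omega> y * link_cdf (dist (X \<omega> (sv \<omega>)) (Z \<omega> n)) (Ms * pl \<omega> User * y) \<le> ?q n \<omega> y * 1"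
      by (intro mult_left_mono link_cdf_le_1) simp
    then show "?q (Suc n) \<omega> y \<le> ?q n \<omega> y" by simp
  qed
  have I_dec: "decseq ?I"
    by (intro decseq_SucI le_funI nn_integral_mono le_funD[OF decseq_SucD[OF q_dec]])
  have I0: "?I 0 \<omega> = 1" for \<omega>
  proof -
    interpret g: prob_space "gamma_law (real (N (user_state \<omega>)))" by (rule prob_space_gamma_law[OF N])
    show ?thesis by (simp add: g.emeasure_space_1)
  qed
  have "secure_event = (\<Inter>n. ?E n)" by auto
  then have "emeasure M secure_event = (INF n. emeasure M (?E n))"
    using E by (subst INF_emeasure_decseq) (auto simp: decseq_def)
  also have "\<dots> = (INF n. \<integral>\<^sup>+\<omega>. ?I n \<omega> \<partial>M)"
    unfolding prob_secure_finite_gain prob_secure_finite_fading prob_secure_finite_blockage ..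
  also have "\<dots> = (\<integral>\<^sup>+\<omega>. (INF n. ?I n \<omega>) \<partial>M)"
    by (rule nn_integral_monotone_convergence_INF_decseq[OF I_dec I, where i=0, symmetric])
       (simp add: I0[simplified] emeasure_space_1)
  also have "\<dots> = (\<integral>\<^sup>+\<omega>. (\<integral>\<^sup>+y. (INF n. ?q n \<omega> y) \<partial>gamma_law (real (N (user_state \<omega>)))) \<partial>M)"
  proof (rule nn_integral_cong)
    fix \<omega>
    show "(INF n. ?I n \<omega>) = (\<integral>\<^sup>+y. (INF n. ?q n \<omega> y) \<partial>gamma_law (real (N (user_state \<omega>))))"
      by (rule nn_integral_monotone_convergence_INF_decseq[OF q_dec q1, where i=0, symmetric])
         (use I0[of \<omega>] in simp)
  qed
  finally show ?thesis .
qed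

section \<open>Independence of the eavesdroppers from the serving link\<close>

lemma indep_Z_comp:
  assumes B [measurable]: "B \<in> sets point_space" and [measurable]: "g \<in> borel_measurable point_space"
  shows "(\<integral>\<^sup>+\<omega>. g (X \<omega>) * indicator B (Z \<omega>) \<partial>M) = (\<integral>\<^sup>+\<omega>. g (X \<omega>) * emeasure M (Z -` B \<inter> space M) \<partial>M)"
proof (rule nn_integral_comp_eqI[where MW=point_space])
  fix A :: "(nat \<Rightarrow> real^2) set" assume A [measurable]: "A \<in> sets point_space"
  have "(\<integral>\<^sup>+\<omega>. indicator A (X \<omega>) * indicator B (Z \<omega>) \<partial>M) =
      (\<integral>\<^sup>+\<omega>. indicator ((X -` A \<inter> space M) \<inter> (Z -` B \<inter> space M)) \<omega> \<partial>M)"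
    by (intro nn_integral_cong) (auto simp: indicator_def)
  also have "\<dots> = emeasure M ((X -` A \<inter> space M) \<inter> (Z -` B \<inter> space M))"
    by (rule nn_integral_indicator) measurable
  also have "\<dots> = emeasure M (X -` A \<inter> space M) * emeasure M (Z -` B \<inter> space M)"
  proof -
    have "prob ((\<lambda>x. (X x, Z x)) -` (A \<times> B) \<inter> space M) = prob (X -` A \<inter> space M) * prob (Z -` B \<inter> space M)"
      using indep_varD[OF XZ A B] .
    moreover have "(\<lambda>x. (X x, Z x)) -` (A \<times> B) \<inter> space M = (X -` A \<inter> space M) \<inter> (Z -` B \<inter> space M)" by auto
    ultimately show ?thesis by (simp add: emeasure_eq_measure ennreal_mult)
  qed
  also have "emeasure M (X -` A \<inter> space M) = (\<integral>\<^sup>+\<omega>. indicator (X -` A \<inter> space M) \<omega> \<partial>M)"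
    by (rule nn_integral_indicator[symmetric]) measurable
  also have "\<dots> = (\<integral>\<^sup>+\<omega>. indicator A (X \<omega>) \<partial>M)"
    by (intro nn_integral_cong) (auto simp: indicator_def)
  also have "\<dots> * emeasure M (Z -` B \<inter> space M) = (\<integral>\<^sup>+\<omega>. indicator A (X \<omega>) * emeasure M (Z -` B \<inter> space M) \<partial>M)"
    by (rule nn_integral_multc[symmetric]) measurable
  finally show "(\<integral>\<^sup>+\<omega>. indicator A (X \<omega>) * indicator B (Z \<omega>) \<partial>M) =
    (\<integral>\<^sup>+\<omega>. indicator A (X \<omega>) * emeasure M (Z -` B \<inter> space M) \<partial>M)" .
qed measurable

abbreviation "SU \<omega> \<equiv> (\<lambda>i. S \<omega> (i, User))"

lemma SU_measurable [measurable]: "SU \<in> M \<rightarrow>\<^sub>M user_link_space"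
  by (intro user_states_measurable S.Y_measurable)

text \<open>Independence of \<open>Z\<close> from the base stations together with the states of the
  links to the user. The model gives only independence of \<open>X\<close> and \<open>Z\<close>; the
  link states join in because their kernels do not involve \<open>Z\<close>.\<close>

lemma distr_user_Z:
  "distr M (point_space \<Otimes>\<^sub>M user_link_space) (\<lambda>\<omega>. (X \<omega>, SU \<omega>)) \<Otimes>\<^sub>M distr M point_space Z =
    distr M ((point_space \<Otimes>\<^sub>M user_link_space) \<Otimes>\<^sub>M point_space) (\<lambda>\<omega>. ((X \<omega>, SU \<omega>), Z \<omega>))"
proof (rule pair_measure_eqI)
  let ?U = "point_space \<Otimes>\<^sub>M user_link_space"
  show "sigma_finite_measure (distr M ?U (\<lambda>\<omega>. (X \<omega>, SU \<omega>)))" "sigma_finite_measure (distr M point_space Z)"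
    by (intro prob_space_imp_sigma_finite prob_space_distr; measurable)+
  fix A B assume "A \<in> sets (distr M ?U (\<lambda>\<omega>. (X \<omega>, SU \<omega>)))" "B \<in> sets (distr M point_space Z)"
  then have A [measurable]: "A \<in> sets ?U" and B [measurable]: "B \<in> sets point_space" by simp_all
  let ?b = "emeasure M (Z -` B \<inter> space M)"
  define \<mu> where "\<mu> = distr (density M (\<lambda>\<omega>. indicator B (Z \<omega>))) ?U (\<lambda>\<omega>. (X \<omega>, SU \<omega>))"
  define \<nu> where "\<nu> = distr (density M (\<lambda>\<omega>. ?b)) ?U (\<lambda>\<omega>. (X \<omega>, SU \<omega>))"
  have \<mu>: "emeasure \<mu> Q = (\<integral>\<^sup>+\<omega>. indicator Q (X \<omega>, SU \<omega>) * indicator B (Z \<omega>) \<partial>M)"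
    and \<nu>: "emeasure \<nu> Q = (\<integral>\<^sup>+\<omega>. indicator Q (X \<omega>, SU \<omega>) * ?b \<partial>M)"
    if [measurable]: "Q \<in> sets ?U" for Q
  proof -
    have "emeasure \<mu> Q = (\<integral>\<^sup>+z. indicator Q z \<partial>\<mu>)" using that by (simp add: \<mu>_def)
    then show "emeasure \<mu> Q = (\<integral>\<^sup>+\<omega>. indicator Q (X \<omega>, SU \<omega>) * indicator B (Z \<omega>) \<partial>M)"
      by (simp add: \<mu>_def nn_integral_distr nn_integral_density mult.commute del: nn_integral_indicator)
    have "emeasure \<nu> Q = (\<integral>\<^sup>+z. indicator Q z \<partial>\<nu>)" using that by (simp add: \<nu>_def)
    then show "emeasure \<nu> Q = (\<integral>\<^sup>+\<omega>. indicator Q (X \<omega>, SU \<omega>) * ?b \<partial>M)"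
      by (simp add: \<nu>_def nn_integral_distr nn_integral_density mult.commute del: nn_integral_indicator)
  qed
  have "\<mu> = \<nu>"
  proof (rule measure_eqI_pair_PiM)
    show "sets \<mu> = sets ?U" "sets \<nu> = sets ?U" by (simp_all add: \<mu>_def \<nu>_def)
    have "emeasure \<mu> (space \<mu>) = (\<integral>\<^sup>+\<omega>. indicator (space ?U) (X \<omega>, SU \<omega>) * indicator B (Z \<omega>) \<partial>M)"
      using \<mu>[OF sets.top] by (simp add: \<mu>_def)
    also have "\<dots> \<le> (\<integral>\<^sup>+\<omega>. 1 \<partial>M)"
      by (intro nn_integral_mono) (auto simp: indicator_def)
    also have "\<dots> < \<infinity>" by (simp add: emeasure_space_1)
    finally show "emeasure \<mu> (space \<mu>) \<noteq> \<infinity>" by simp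
    fix A0 and J :: "nat set" and B' :: "nat \<Rightarrow> link_state set" assume A0 [measurable]: "A0 \<in> sets point_space" and J: "finite J"
    let ?Cyl = "{y\<in>space user_link_space. \<forall>i\<in>J. y i \<in> B' i}"
    have [measurable]: "?Cyl \<in> sets user_link_space"
      by (rule sets_Collect_finite_Ball[where f="\<lambda>i y. y i" and N="count_space UNIV", OF J])
         (auto intro: measurable_component_singleton)
    \<comment> \<open>The conditional probability of the cylinder of user links. The user sits at
      the origin, so it is a function of \<open>x\<close> alone, and independence of
      \<open>X\<close> and \<open>Z\<close> applies to it.\<close>
    define g where "g x = indicator A0 x * (\<Prod>i\<in>J. emeasure (measure_pmf (link_law C D (dist (x i) 0))) (B' i))" for x
    have [measurable]: "(\<lambda>x. emeasure (measure_pmf (link_law C D (dist (x i) 0))) (B' i)) \<in> borel_measurable point_space" for i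
    proof -
      have "(\<lambda>x. dist (x i) 0) \<in> borel_measurable point_space"
        using measurable_component_singleton[of i UNIV "\<lambda>_. borel :: (real^2) measure"]
        by (intro borel_measurable_dist) auto
      from measurable_compose[OF this measurable_compose[OF link_law_kernel measurable_emeasure_subprob_algebra]]
      show ?thesis by simp
    qed
    have g [measurable]: "g \<in> borel_measurable point_space"
      unfolding g_def by measurable
    have inj: "inj_on (\<lambda>i. (i, User)) J" by (auto simp: inj_on_def)
    have law: "(\<integral>\<^sup>+\<omega>. (indicator A0 (X \<omega>) * indicator B2 (Z \<omega>)) * (\<Prod>i\<in>J. indicator (B' i) (S \<omega> (i, User))) \<partial>M) =
        (\<integral>\<^sup>+\<omega>. g (X \<omega>) * indicator B2 (Z \<omega>) \<partial>M)" if B2 [measurable]: "B2 \<in> sets point_space" for B2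
    proof -
      have "(\<integral>\<^sup>+\<omega>. indicator (A0 \<times> B2) (X \<omega>, Z \<omega>) * (\<Prod>p\<in>(\<lambda>i. (i, User)) ` J. indicator (B' (fst p)) (S \<omega> p)) \<partial>M) =
        (\<integral>\<^sup>+\<omega>. indicator (A0 \<times> B2) (X \<omega>, Z \<omega>) * (\<Prod>p\<in>(\<lambda>i. (i, User)) ` J.
            emeasure (measure_pmf (link_law C D (dist (fst (X \<omega>, Z \<omega>) (fst p)) (receiver_pos (snd (X \<omega>, Z \<omega>)) (snd p))))) (B' (fst p))) \<partial>M)"
        using J by (intro S.law_indicator[where B="\<lambda>p. B' (fst p)"]) simp_all
      then show ?thesis
        by (simp add: prod.reindex[OF inj] indicator_times g_def mult_ac)
    qed
    have cyl: "indicator (A0 \<times> ?Cyl) (X \<omega>, SU \<omega>) = (indicator A0 (X \<omega>) * (\<Prod>i\<in>J. indicator (B' i) (S \<omega> (i, User))) :: ennreal)" for \<omega>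
      by (auto simp: prod_indicator_Ball J indicator_def space_PiM)
    have "emeasure \<mu> (A0 \<times> ?Cyl) =
        (\<integral>\<^sup>+\<omega>. (indicator A0 (X \<omega>) * indicator B (Z \<omega>)) * (\<Prod>i\<in>J. indicator (B' i) (S \<omega> (i, User))) \<partial>M)"
      by (subst \<mu>) (simp_all add: cyl mult_ac)
    also have "\<dots> = (\<integral>\<^sup>+\<omega>. g (X \<omega>) * ?b \<partial>M)"
      unfolding law[OF B] by (rule indep_Z_comp) measurable
    \<comment> \<open>With the constant factor separated, a trivial constraint on \<open>Z\<close>
      is inserted so that \<open>law\<close> can be read backwards, turning
      \<open>g (X \<omega>)\<close> into indicators of the link states again.\<close>
    also have "\<dots> = (\<integral>\<^sup>+\<omega>. g (X \<omega>) * indicator (space point_space) (Z \<omega>) \<partial>M) * ?b"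
      using measurable_space[OF EV.Z_measurable]
      by (subst nn_integral_multc[symmetric]) (auto intro!: nn_integral_cong)
    also have "(\<integral>\<^sup>+\<omega>. g (X \<omega>) * indicator (space point_space) (Z \<omega>) \<partial>M) =
        (\<integral>\<^sup>+\<omega>. (indicator A0 (X \<omega>) * indicator (space point_space) (Z \<omega>)) * (\<Prod>i\<in>J. indicator (B' i) (S \<omega> (i, User))) \<partial>M)"
      by (rule law[OF sets.top, symmetric])
    also have "\<dots> = (\<integral>\<^sup>+\<omega>. indicator (A0 \<times> ?Cyl) (X \<omega>, SU \<omega>) \<partial>M)"
      using measurable_space[OF EV.Z_measurable] by (intro nn_integral_cong) (simp add: cyl)
    also have "\<dots> * ?b = (\<integral>\<^sup>+\<omega>. indicator (A0 \<times> ?Cyl) (X \<omega>, SU \<omega>) * ?b \<partial>M)"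
      by (rule nn_integral_multc[symmetric]) measurable
    also have "\<dots> = emeasure \<nu> (A0 \<times> ?Cyl)"
      by (rule \<nu>[symmetric]) measurable
    finally show "emeasure \<mu> (A0 \<times> ?Cyl) = emeasure \<nu> (A0 \<times> ?Cyl)" .
  qed
  have "emeasure (distr M ?U (\<lambda>\<omega>. (X \<omega>, SU \<omega>))) A * emeasure (distr M point_space Z) B = emeasure \<nu> A"
  proof -
    have "emeasure (distr M ?U (\<lambda>\<omega>. (X \<omega>, SU \<omega>))) A = (\<integral>\<^sup>+w. indicator A w \<partial>distr M ?U (\<lambda>\<omega>. (X \<omega>, SU \<omega>)))"
      using A by simp
    also have "\<dots> = (\<integral>\<^sup>+\<omega>. indicator A (X \<omega>, SU \<omega>) \<partial>M)"
      by (subst nn_integral_distr) auto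
    finally show ?thesis
      by (simp add: \<nu> emeasure_distr nn_integral_multc)
  qed
  also have "\<dots> = emeasure \<mu> A" using \<open>\<mu> = \<nu>\<close> by simp
  also have "\<dots> = (\<integral>\<^sup>+w. indicator (A \<times> B) w \<partial>distr M (?U \<Otimes>\<^sub>M point_space) (\<lambda>\<omega>. ((X \<omega>, SU \<omega>), Z \<omega>)))"
    by (subst nn_integral_distr) (auto simp: \<mu> indicator_times)
  also have "\<dots> = emeasure (distr M (?U \<Otimes>\<^sub>M point_space) (\<lambda>\<omega>. ((X \<omega>, SU \<omega>), Z \<omega>))) (A \<times> B)"
    by (rule nn_integral_indicator) simp
  finally show "emeasure (distr M ?U (\<lambda>\<omega>. (X \<omega>, SU \<omega>))) A * emeasure (distr M point_space Z) B =
    emeasure (distr M (?U \<Otimes>\<^sub>M point_space) (\<lambda>\<omega>. ((X \<omega>, SU \<omega>), Z \<omega>))) (A \<times> B)" .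
qed (simp cong: sets_pair_measure_cong)

lemma user_law_measurable:
  "(\<lambda>w. serving_by_user K \<alpha> (fst w) (snd w)) \<in> point_space \<Otimes>\<^sub>M user_link_space \<rightarrow>\<^sub>M count_space UNIV"
  "(\<lambda>w. fst w (serving_by_user K \<alpha> (fst w) (snd w))) \<in> borel_measurable (point_space \<Otimes>\<^sub>M user_link_space)"
  "(\<lambda>w. snd w (serving_by_user K \<alpha> (fst w) (snd w))) \<in> point_space \<Otimes>\<^sub>M user_link_space \<rightarrow>\<^sub>M count_space UNIV"
proof -
  show I: "(\<lambda>w. serving_by_user K \<alpha> (fst w) (snd w)) \<in> point_space \<Otimes>\<^sub>M user_link_space \<rightarrow>\<^sub>M count_space UNIV"
    by (rule serving_by_user_measurable[OF measurable_fst measurable_snd])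
  show "(\<lambda>w. fst w (serving_by_user K \<alpha> (fst w) (snd w))) \<in> borel_measurable (point_space \<Otimes>\<^sub>M user_link_space)"
    by (rule PiM_component_countable[where x=fst, OF measurable_fst I])
  show "(\<lambda>w. snd w (serving_by_user K \<alpha> (fst w) (snd w))) \<in> point_space \<Otimes>\<^sub>M user_link_space \<rightarrow>\<^sub>M count_space UNIV"
    by (rule PiM_component_countable[where x=snd, OF measurable_snd I])
qed

text \<open>Replaces the eavesdroppers by an independent copy \<open>Z \<omega>'\<close>, which
  exposes, for fixed serving link and fading \<open>y\<close>, an innermost integral over the
  Poisson process alone.\<close>

lemma prob_secure_indep:
  "emeasure M secure_event =
   (\<integral>\<^sup>+\<omega>. (\<integral>\<^sup>+y. (\<integral>\<^sup>+\<omega>'. (INF n. \<Prod>k<n. link_cdf (dist (X \<omega> (sv \<omega>)) (Z \<omega>' k)) (Ms * pl \<omega> User * y)) \<partial>M)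
      \<partial>gamma_law (real (N (user_state \<omega>)))) \<partial>M)"
proof -
  let ?U = "point_space \<Otimes>\<^sub>M user_link_space"
  let ?I = "\<lambda>w. serving_by_user K \<alpha> (fst w) (snd w)"
  let ?x = "\<lambda>w. fst w (?I w)" and ?u = "\<lambda>w. snd w (?I w)"
  let ?q = "\<lambda>w (z :: nat \<Rightarrow> real^2) y. (INF n. \<Prod>k<n. link_cdf (dist (?x w) (z k)) (Ms * path_loss K \<alpha> (?u w) (?x w) 0 * y))"
  let ?W = "\<lambda>\<omega>. (X \<omega>, SU \<omega>)"
  define F where "F wz = (\<integral>\<^sup>+y. ?q (fst wz) (snd wz) y \<partial>gamma_law (real (N (?u (fst wz)))))" for wz
  have x: "?x \<in> borel_measurable ?U" and u: "?u \<in> ?U \<rightarrow>\<^sub>M count_space UNIV"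
    by (fact user_law_measurable)+
  have z: "(\<lambda>p. snd (fst p) k) \<in> borel_measurable ((?U \<Otimes>\<^sub>M point_space) \<Otimes>\<^sub>M borel)" for k
    by (rule PiM_component[where x="\<lambda>p. snd (fst p)", OF measurable_compose[OF measurable_fst measurable_snd]])
  note [measurable] = z measurable_compose[OF measurable_compose[OF measurable_fst measurable_fst] x]
    measurable_compose[OF measurable_compose[OF measurable_fst measurable_fst] u]
  have q: "(\<lambda>p. ?q (fst (fst p)) (snd (fst p)) (snd p)) \<in> borel_measurable ((?U \<Otimes>\<^sub>M point_space) \<Otimes>\<^sub>M borel)"
    by (intro borel_measurable_INF borel_measurable_prod_ennreal link_cdf_measurable path_loss_measurable
        borel_measurable_dist borel_measurable_times) (measurable; simp)+
  have F [measurable]: "F \<in> borel_measurable (?U \<Otimes>\<^sub>M point_space)"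
    unfolding F_def
  proof (rule nn_integral_measurable_subprob_algebra2[where N=borel])
    show "(\<lambda>(wz, y). ?q (fst wz) (snd wz) y) \<in> borel_measurable ((?U \<Otimes>\<^sub>M point_space) \<Otimes>\<^sub>M borel)"
      using q by (simp add: case_prod_beta')
    show "(\<lambda>wz. gamma_law (real (N (?u (fst wz))))) \<in> ?U \<Otimes>\<^sub>M point_space \<rightarrow>\<^sub>M subprob_algebra borel"
      by (intro gamma_law_kernel N_measurable N measurable_compose[OF measurable_fst u])
  qed
  have pl_User: "pl \<omega> User = path_loss K \<alpha> (user_state \<omega>) (X \<omega> (sv \<omega>)) 0" for \<omega>
    by (simp add: serving_path_loss_def Let_def)
  interpret Z: prob_space "distr M point_space Z" by (rule prob_space_distr) measurable
  have "emeasure M secure_event = (\<integral>\<^sup>+\<omega>. F (?W \<omega>, Z \<omega>) \<partial>M)"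
    by (subst prob_secure_INF) (simp add: F_def pl_User serving_eq)
  also have "\<dots> = (\<integral>\<^sup>+p. F p \<partial>distr M (?U \<Otimes>\<^sub>M point_space) (\<lambda>\<omega>. (?W \<omega>, Z \<omega>)))"
    by (rule nn_integral_distr[symmetric]) measurable
  also have "\<dots> = (\<integral>\<^sup>+p. F p \<partial>(distr M ?U ?W \<Otimes>\<^sub>M distr M point_space Z))"
    by (simp add: distr_user_Z)
  also have "\<dots> = (\<integral>\<^sup>+w. \<integral>\<^sup>+z. F (w, z) \<partial>distr M point_space Z \<partial>distr M ?U ?W)"
    by (rule Z.nn_integral_fst[symmetric]) simp
  also have "\<dots> = (\<integral>\<^sup>+\<omega>. \<integral>\<^sup>+z. F (?W \<omega>, z) \<partial>distr M point_space Z \<partial>M)"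
  proof (rule nn_integral_distr)
    have "F \<in> borel_measurable (?U \<Otimes>\<^sub>M distr M point_space Z)"
      using F by (simp cong: measurable_cong_sets)
    then show "(\<lambda>w. \<integral>\<^sup>+z. F (w, z) \<partial>distr M point_space Z) \<in> borel_measurable (distr M ?U ?W)"
      using Z.borel_measurable_nn_integral_fst[of F ?U] by simp
  qed measurable
  also have "\<dots> = (\<integral>\<^sup>+\<omega>. \<integral>\<^sup>+\<omega>'. F (?W \<omega>, Z \<omega>') \<partial>M \<partial>M)"
  proof (rule nn_integral_cong)
    fix \<omega> assume "\<omega> \<in> space M"
    then have W: "?W \<omega> \<in> space ?U" by (rule measurable_space[rotated]) measurable
    have "(\<lambda>z. F (?W \<omega>, z)) \<in> borel_measurable point_space"
      by (rule measurable_compose[OF measurable_Pair1'[OF W] F])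
    then show "(\<integral>\<^sup>+z. F (?W \<omega>, z) \<partial>distr M point_space Z) = (\<integral>\<^sup>+\<omega>'. F (?W \<omega>, Z \<omega>') \<partial>M)"
      by (intro nn_integral_distr[OF EV.Z_measurable]) simp
  qed
  also have "\<dots> = (\<integral>\<^sup>+\<omega>. (\<integral>\<^sup>+y. (\<integral>\<^sup>+\<omega>'. ?q (?W \<omega>) (Z \<omega>') y \<partial>M) \<partial>gamma_law (real (N (?u (?W \<omega>))))) \<partial>M)"
  proof (rule nn_integral_cong)
    fix \<omega>
    let ?g = "gamma_law (real (N (SU \<omega> (serving_by_user K \<alpha> (X \<omega>) (SU \<omega>)))))"
    interpret g: prob_space ?g by (rule prob_space_gamma_law[OF N])
    interpret Mg: pair_sigma_finite M ?g ..
    have "(\<lambda>p. ?q (?W \<omega>) (Z (fst p)) (snd p)) \<in> borel_measurable (M \<Otimes>\<^sub>M borel)"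
      by measurable
    then have "(\<lambda>p. ?q (?W \<omega>) (Z (fst p)) (snd p)) \<in> borel_measurable (M \<Otimes>\<^sub>M ?g)"
      by (simp cong: measurable_cong_sets)
    then have "(\<lambda>(\<omega>', y). ?q (?W \<omega>) (Z \<omega>') y) \<in> borel_measurable (M \<Otimes>\<^sub>M ?g)"
      by (simp only: case_prod_beta')
    from Mg.Fubini'[OF this]
    show "(\<integral>\<^sup>+\<omega>'. F (?W \<omega>, Z \<omega>') \<partial>M) = (\<integral>\<^sup>+y. (\<integral>\<^sup>+\<omega>'. ?q (?W \<omega>) (Z \<omega>') y \<partial>M) \<partial>gamma_law (real (N (?u (?W \<omega>)))))"
      unfolding F_def fst_conv snd_conv by simp
  qed
  finally show ?thesis
    unfolding pl_User by (simp add: serving_eq)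
qed

section \<open>The exponent in closed form\<close>

definition inner_tail :: "link_state \<Rightarrow> real \<Rightarrow> real \<Rightarrow> real \<Rightarrow> real" where
  "inner_tail j V t d = indicator {0<..D powr \<alpha> j / (V * K j * t)} (d powr \<alpha> j / (V * K j * t)) *
    gamma_tail (N j) (d powr \<alpha> j / (V * K j * t))"

text \<open>As in \<open>inner_tail\<close>, the comparison of \<open>d\<close> with
  \<open>D\<close> is made after the scaling \<open>d powr \<alpha> j / (V * K j * t)\<close>, so
  that \<open>has_bochner_integral_gamma_tail\<close> applies directly and the cutoff becomes the
  second argument of the incomplete Gamma function.\<close>

definition outer_tail :: "link_state \<Rightarrow> real \<Rightarrow> real \<Rightarrow> real \<Rightarrow> real" where
  "outer_tail j V t d = indicator {D powr \<alpha> j / (V * K j * t)<..} (d powr \<alpha> j / (V * K j * t)) *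
    gamma_tail (N j) (d powr \<alpha> j / (V * K j * t))"

text \<open>
  \<open>exceed_prob (1 / a) d\<close> is the probability that an eavesdropper at distance \<open>d\<close> from the serving
  station receives more than \<open>a\<close>. It vanishes at \<open>d = 0\<close> because \<open>0 powr _ = 0\<close>.
\<close>

definition exceed_prob :: "real \<Rightarrow> real \<Rightarrow> real" where
  "exceed_prob t d = (\<Sum>V\<in>{Ms, ms}. pmf gain V *
    (C * inner_tail LOS V t d + (1 - C) * inner_tail NLOS V t d + outer_tail NLOS V t d))"

lemma exceed_prob_nonneg: "0 < t \<Longrightarrow> 0 \<le> exceed_prob t d"
  unfolding exceed_prob_def inner_tail_def outer_tail_def
  using C gains K by (intro sum_nonneg mult_nonneg_nonneg add_nonneg_nonneg gamma_tail_bounds divide_nonneg_nonneg)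
    (auto intro: less_imp_le)

lemma link_cdf_eq:
  assumes a: "0 < a" and d: "0 \<le> d"
  shows "link_cdf d a = ennreal (1 - exceed_prob (1 / a) d)" and "exceed_prob (1 / a) d \<le> 1"
proof -
  let ?p = "\<lambda>V. pmf gain V"
  have p: "0 \<le> ?p V" for V by simp
  have p1: "?p Ms + ?p ms = 1" using pmf_gain_law[OF \<theta>b ms_ne_Ms] by simp
  have sum_V: "(\<Sum>V\<in>{Ms, ms}. f V) = f Ms + f ms" for f :: "real \<Rightarrow> real"
    using ms_ne_Ms by simp
  have "link_cdf d a = ennreal (1 - exceed_prob (1 / a) d) \<and> exceed_prob (1 / a) d \<le> 1"
  proof (cases "d = 0")
    case True
    have "link_cdf d a = (\<integral>\<^sup>+j. 1 \<partial>measure_pmf (link_law C D d))"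
      unfolding link_cdf_def
    proof (rule nn_integral_cong)
      fix j
      interpret g: prob_space "gamma_law (real (N j))" by (rule prob_space_gamma_law[OF N])
      show "power_cdf gain (N j) (K j * d powr (- \<alpha> j)) a = 1"
        using True a by (simp add: power_cdf_def gain_cdf_def measure_pmf.emeasure_space_1 g.emeasure_space_1)
    qed
    also have "\<dots> = 1" by (simp add: measure_pmf.emeasure_space_1)
    finally have "link_cdf d a = 1" .
    moreover have "inner_tail j V (1 / a) d = 0" "outer_tail j V (1 / a) d = 0" if "0 < V" for j V
    proof -
      have "0 \<le> D powr \<alpha> j / (V * K j * (1 / a))" using that K[of j] a by simp
      then show "outer_tail j V (1 / a) d = 0" unfolding outer_tail_def using True by (simp only: indicator_def) simp
    qed (use True in \<open>simp add: inner_tail_def\<close>)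
    then have "exceed_prob (1 / a) d = 0"
      using gains by (simp add: exceed_prob_def)
    ultimately show ?thesis by simp
  next
    case False
    then have d: "0 < d" using d by simp
    let ?s = "\<lambda>j V. d powr \<alpha> j / (V * K j * (1 / a))"
    let ?P = "\<lambda>j. ?p Ms * gamma_tail (N j) (?s j Ms) + ?p ms * gamma_tail (N j) (?s j ms)"
    have s: "a / (V * (K j * d powr (- \<alpha> j))) = ?s j V" for j V
      using d by (simp add: powr_minus field_simps)
    have pc: "power_cdf gain (N j) (K j * d powr (- \<alpha> j)) a = ennreal (1 - ?P j)" for j
      using power_cdf_gain_law[OF \<theta>b gains N, of "K j * d powr (- \<alpha> j)" a j] K[of j] d a by (simp add: s)
    have s0: "0 \<le> ?s j V" if "0 < V" for j V
      using that K[of j] a by simp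
    have tail: "0 \<le> gamma_tail (N j) (?s j V)" "gamma_tail (N j) (?s j V) \<le> 1" if "0 < V" for j V
      using gamma_tail_bounds s0[OF that] by auto
    have P0: "0 \<le> ?P j" for j
      using tail gains by (intro add_nonneg_nonneg mult_nonneg_nonneg p) auto
    have P1: "?P j \<le> 1" for j
    proof -
      have "?P j \<le> ?p Ms * 1 + ?p ms * 1"
        using tail gains by (intro add_mono mult_left_mono p) auto
      then show ?thesis using p1 by simp
    qed
    \<comment> \<open>The common positive scale cancels, so the scaled cutoffs of
      \<open>inner_tail\<close> and \<open>outer_tail\<close> both amount to comparing
      \<open>d\<close> with \<open>D\<close>.\<close>
    have le: "?s j V \<le> D powr \<alpha> j / (V * K j * (1 / a)) \<longleftrightarrow> d \<le> D" if "0 < V" for j V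
    proof -
      have "0 < V * K j * (1 / a)" using that K[of j] a by simp
      then have "?s j V \<le> D powr \<alpha> j / (V * K j * (1 / a)) \<longleftrightarrow> d powr \<alpha> j \<le> D powr \<alpha> j"
        by (simp only: divide_le_cancel) auto
      also have "\<dots> \<longleftrightarrow> d \<le> D"
        using powr_less_mono2[of "\<alpha> j" D d] powr_mono2[of "\<alpha> j" d D] \<alpha>[of j] D d
        by (cases "d \<le> D") auto
      finally show ?thesis .
    qed
    have spos: "0 < ?s j V" if "0 < V" for j V
      using that K[of j] a d by simp
    have V: "0 < Ms" "0 < ms" using gains by auto
    have inner: "inner_tail j V (1 / a) d = (if d \<le> D then gamma_tail (N j) (?s j V) else 0)" if "0 < V" for j V
      using le[OF that, of j] spos[OF that, of j] by (simp add: inner_tail_def indicator_def)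
    have outer: "outer_tail j V (1 / a) d = (if d \<le> D then 0 else gamma_tail (N j) (?s j V))" if "0 < V" for j V
      using le[OF that, of j] by (simp add: outer_tail_def indicator_def not_le[symmetric])
    have ex: "exceed_prob (1 / a) d = (if d \<le> D then C * ?P LOS + (1 - C) * ?P NLOS else ?P NLOS)"
      unfolding exceed_prob_def sum_V inner[OF V(1)] inner[OF V(2)] outer[OF V(1)] outer[OF V(2)]
      by (simp add: algebra_simps)
    have "link_cdf d a = ennreal (1 - ?P LOS) * ennreal (pmf (link_law C D d) LOS) +
        ennreal (1 - ?P NLOS) * ennreal (pmf (link_law C D d) NLOS)"
      by (simp only: link_cdf_def pc nn_integral_link_law)
    also have "\<dots> = ennreal ((1 - ?P LOS) * pmf (link_law C D d) LOS + (1 - ?P NLOS) * pmf (link_law C D d) NLOS)"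
      using P1[of LOS] P1[of NLOS] by (simp only: ennreal_mult'[symmetric] ennreal_plus[symmetric] pmf_nonneg
          mult_nonneg_nonneg diff_ge_0_iff_ge)
    also have "(1 - ?P LOS) * pmf (link_law C D d) LOS + (1 - ?P NLOS) * pmf (link_law C D d) NLOS = 1 - exceed_prob (1 / a) d"
      unfolding ex pmf_link_law[OF C] by (simp add: algebra_simps)
    finally have "link_cdf d a = ennreal (1 - exceed_prob (1 / a) d)" .
    moreover have "exceed_prob (1 / a) d \<le> 1"
    proof (cases "d \<le> D")
      case True
      have "C * ?P LOS + (1 - C) * ?P NLOS \<le> C * 1 + (1 - C) * 1"
        using C P1 by (intro add_mono mult_left_mono) auto
      then show ?thesis using True by (simp add: ex)
    qed (use P1[of NLOS] in \<open>simp add: ex\<close>)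
    ultimately show ?thesis by blast
  qed
  then show "link_cdf d a = ennreal (1 - exceed_prob (1 / a) d)" "exceed_prob (1 / a) d \<le> 1" by auto
qed

abbreviation "intensity \<equiv> Lambda_E lam_E C D K \<alpha> N Ms ms \<theta>b"

text \<open>Each tail integrates to \<open>2 * pi\<close> times one summand of
  \<open>Omega_in\<close> or \<open>Omega_out\<close>. The integral is the same for all
  \<open>x\<close>, so only the distance of the serving station to the user, not its position,
  remains in the result.\<close>

lemma exceed_prob_integral:
  fixes x :: "real^2"
  assumes t: "0 < t"
  shows "integrable lborel (\<lambda>z. exceed_prob t (dist x z))"
    and "lam_E * (\<integral>z. exceed_prob t (dist x z) \<partial>lborel) = intensity t"
proof -
  let ?p = "\<lambda>V. pmf gain V"
  let ?b = "\<lambda>j V. V * K j * t"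
  let ?c = "\<lambda>j V. (?b j V) powr (2 / \<alpha> j) / \<alpha> j"
  let ?lo = "\<lambda>j V. \<Sum>m<N j. lower_inc_Gamma (real m + 2 / \<alpha> j) (D powr \<alpha> j / ?b j V) / fact m"
  let ?up = "\<lambda>j V. \<Sum>m<N j. upper_inc_Gamma (real m + 2 / \<alpha> j) (D powr \<alpha> j / ?b j V) / fact m"
  have b: "0 < ?b j V" if "0 < V" for j V using that K[of j] t by simp
  have inner: "has_bochner_integral lborel (\<lambda>z. inner_tail j V t (dist x z)) (2 * pi * ?c j V * ?lo j V)" if "0 < V" for j V
    unfolding inner_tail_def lower_inc_Gamma_def
    using has_bochner_integral_gamma_tail[OF \<alpha>[of j] b[OF that, of j], of "{0<..D powr \<alpha> j / ?b j V}" x "N j"]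
    by (simp add: subset_eq)
  have "0 \<le> D powr \<alpha> j / ?b j V" if "0 < V" for j V
    using b[OF that, of j] by simp
  then have outer: "has_bochner_integral lborel (\<lambda>z. outer_tail j V t (dist x z)) (2 * pi * ?c j V * ?up j V)" if "0 < V" for j V
    unfolding outer_tail_def upper_inc_Gamma_def
    using has_bochner_integral_gamma_tail[OF \<alpha>[of j] b[OF that, of j], of "{D powr \<alpha> j / ?b j V<..}" x "N j"] that
    by (auto simp: subset_eq intro: le_less_trans)
  have "has_bochner_integral lborel (\<lambda>z. exceed_prob t (dist x z)) (\<Sum>V\<in>{Ms, ms}. ?p V *
    (C * (2 * pi * ?c LOS V * ?lo LOS V) + (1 - C) * (2 * pi * ?c NLOS V * ?lo NLOS V) + 2 * pi * ?c NLOS V * ?up NLOS V))"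
    unfolding exceed_prob_def using gains
    by (intro has_bochner_integral_sum has_bochner_integral_mult_right has_bochner_integral_add inner outer) auto
  then show "integrable lborel (\<lambda>z. exceed_prob t (dist x z))"
    and "lam_E * (\<integral>z. exceed_prob t (dist x z) \<partial>lborel) = intensity t"
    using ms_ne_Ms by (auto simp: has_bochner_integral_iff Lambda_E_def Let_def Omega_in_def Omega_out_def algebra_simps)
qed

text \<open>The generating functional with \<open>p = 1 - exceed_prob\<close>, the probability that
  an eavesdropper at a given place does not receive more than \<open>a\<close>.\<close>

lemma eavesdroppers_laplace:
  assumes a: "0 < a"
  shows "(\<integral>\<^sup>+\<omega>. (INF n. \<Prod>k<n. link_cdf (dist x (Z \<omega> k)) a) \<partial>M) = ennreal (exp (- intensity (1 / a)))"
proof -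
  have t: "0 < 1 / a" using a by simp
  have "(\<integral>\<^sup>+\<omega>. (INF n. \<Prod>k<n. link_cdf (dist x (Z \<omega> k)) a) \<partial>M) =
      (\<integral>\<^sup>+\<omega>. (INF n. ennreal (\<Prod>k<n. 1 - exceed_prob (1 / a) (dist x (Z \<omega> k)))) \<partial>M)"
    using link_cdf_eq[OF a] by (simp add: prod_ennreal)
  also have "\<dots> = ennreal (exp (- lam_E * (\<integral>z. 1 - (1 - exceed_prob (1 / a) (dist x z)) \<partial>lborel)))"
  proof (rule EV.pgfl)
    have "(\<lambda>z. exceed_prob (1 / a) (dist x z)) \<in> borel_measurable borel"
      using borel_measurable_integrable[OF exceed_prob_integral(1)[OF t, of x]] by simp
    then show "(\<lambda>z. 1 - exceed_prob (1 / a) (dist x z)) \<in> borel_measurable borel" by simp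
  qed (use exceed_prob_nonneg[OF t] link_cdf_eq(2)[OF a] exceed_prob_integral(1)[OF t, of x] in auto)
  finally show ?thesis
    using exceed_prob_integral(2)[OF t, of x] by simp
qed

text \<open>The inner integral of the closed form: the probability of a secure link when the serving
  station has state \<open>j\<close> and distance \<open>r\<close>, with \<open>w\<close> the user's
  fading.\<close>

definition secrecy :: "link_state \<Rightarrow> real \<Rightarrow> real" where
  "secrecy j r = (LINT w:{0<..}|lborel. exp (- intensity (r powr \<alpha> j / (Ms * w * K j))) *
    w ^ (N j - 1) * exp (- w) / Gamma (real (N j)))"

text \<open>Read off from the representation as an integral of a probability; the centre 0 is an
  arbitrary choice.\<close>

lemma intensity_nonneg: "0 < t \<Longrightarrow> 0 \<le> intensity t"
  using exceed_prob_integral(2)[of t 0] EV.l_pos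
  by (auto simp flip: exceed_prob_integral(2)[of t 0] intro!: mult_nonneg_nonneg Bochner_Integration.integral_nonneg exceed_prob_nonneg)

lemma secrecy_measurable [measurable]: "secrecy j \<in> borel_measurable borel"
  unfolding secrecy_def[abs_def] set_lebesgue_integral_def by measurable

lemma
  assumes r: "0 < r"
  shows nn_integral_secrecy:
      "(\<integral>\<^sup>+y. ennreal (exp (- intensity (1 / (Ms * (K j * r powr (- \<alpha> j)) * y)))) \<partial>gamma_law (real (N j))) = ennreal (secrecy j r)"
    and secrecy_nonneg: "0 \<le> secrecy j r" and secrecy_le_1: "secrecy j r \<le> 1"
proof -
  let ?f = "\<lambda>w. indicator {0<..} w *\<^sub>R (exp (- intensity (r powr \<alpha> j / (Ms * w * K j))) *
    w ^ (N j - 1) * exp (- w) / Gamma (real (N j)))"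
  interpret g: prob_space "gamma_law (real (N j))" by (rule prob_space_gamma_law[OF N])
  have Gamma_pos: "0 < Gamma (real (N j))" using N[of j] by (intro Gamma_real_pos) simp
  have f: "?f \<in> borel_measurable lborel" by measurable
  have f0: "0 \<le> ?f w" for w
    using Gamma_pos by (auto simp: indicator_def)
  show s0: "0 \<le> secrecy j r"
    unfolding secrecy_def set_lebesgue_integral_def by (rule Bochner_Integration.integral_nonneg) (rule f0)
  have eq: "(\<integral>\<^sup>+y. ennreal (exp (- intensity (1 / (Ms * (K j * r powr (- \<alpha> j)) * y)))) \<partial>gamma_law (real (N j))) = (\<integral>\<^sup>+y. ennreal (?f y) \<partial>lborel)"
  proof (subst nn_integral_gamma_law[OF N])
    show "(\<lambda>y. ennreal (exp (- intensity (1 / (Ms * (K j * r powr (- \<alpha> j)) * y))))) \<in> borel_measurable borel"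
      by measurable
    have "1 / (Ms * (K j * r powr (- \<alpha> j)) * y) = r powr \<alpha> j / (Ms * y * K j)" for y
      using r by (simp add: powr_minus field_simps)
    then show "(\<integral>\<^sup>+y. ennreal (gamma_density (N j) y) * ennreal (exp (- intensity (1 / (Ms * (K j * r powr (- \<alpha> j)) * y)))) \<partial>lborel) =
      (\<integral>\<^sup>+y. ennreal (?f y) \<partial>lborel)"
      by (intro nn_integral_cong, subst ennreal_mult'[OF gamma_density_nonneg, symmetric])
         (auto simp: gamma_density_def indicator_def mult_ac)
  qed
  \<comment> \<open>For \<open>y > 0\<close> the argument of \<open>intensity\<close> is positive
    and the exponential is at most 1; elsewhere the gamma density vanishes. The bound also supplies
    the finiteness behind \<open>int\<close>.\<close>
  have le1: "(\<integral>\<^sup>+y. ennreal (exp (- intensity (1 / (Ms * (K j * r powr (- \<alpha> j)) * y)))) \<partial>gamma_law (real (N j))) \<le> 1"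
  proof -
    have "ennreal (gamma_density (N j) y) * ennreal (exp (- intensity (1 / (Ms * (K j * r powr (- \<alpha> j)) * y)))) \<le> ennreal (gamma_density (N j) y) * 1" for y
    proof (cases "0 < y")
      case True
      then have "0 < 1 / (Ms * (K j * r powr (- \<alpha> j)) * y)" using gains K[of j] r by simp
      then show ?thesis using intensity_nonneg by (intro mult_left_mono) auto
    qed (simp add: gamma_density_def)
    then have "(\<integral>\<^sup>+y. ennreal (exp (- intensity (1 / (Ms * (K j * r powr (- \<alpha> j)) * y)))) \<partial>gamma_law (real (N j))) \<le>
        (\<integral>\<^sup>+y. 1 \<partial>gamma_law (real (N j)))"
      by (subst (1 2) nn_integral_gamma_law[OF N]) (auto intro!: nn_integral_mono)
    then show ?thesis by (simp add: g.emeasure_space_1)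
  qed
  have int: "integrable lborel ?f"
    using le1 f f0 unfolding eq by (intro integrableI_nonneg) (auto intro: le_less_trans)
  show sec: "(\<integral>\<^sup>+y. ennreal (exp (- intensity (1 / (Ms * (K j * r powr (- \<alpha> j)) * y)))) \<partial>gamma_law (real (N j))) = ennreal (secrecy j r)"
    unfolding eq secrecy_def set_lebesgue_integral_def
    by (rule nn_integral_eq_integral[OF int]) (use f0 in auto)
  show "secrecy j r \<le> 1"
    using le1 unfolding sec by simp
qed

section \<open>Almost sure properties of the serving link and reduction to
  \<open>secrecy\<close>\<close>

abbreviation "R \<omega> \<equiv> norm (X \<omega> (sv \<omega>))"

lemma R_measurable [measurable]: "(\<lambda>\<omega>. R \<omega>) \<in> borel_measurable M"
  by measurable

text \<open>Almost surely no base station at all has its distance in \<open>B\<close>, so the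
  serving one does not either, however its index is chosen.\<close>

lemma R_not_in_null:
  assumes [measurable]: "B \<in> sets borel" and "emeasure lborel B = 0"
  shows "AE \<omega> in M. R \<omega> \<notin> B"
proof -
  have "AE \<omega> in M. \<forall>i. X \<omega> i \<notin> {z. norm z \<in> B}"
    by (rule BS.no_points_null) (use emeasure_norm_null[OF assms] in measurable)
  then show ?thesis by eventually_elim auto
qed

lemma R_pos: "AE \<omega> in M. 0 < R \<omega>"
proof -
  have "AE \<omega> in M. R \<omega> \<notin> {0}" by (rule R_not_in_null) simp_all
  then show ?thesis by eventually_elim simp
qed

lemma H_User_pos: "AE \<omega> in M. 0 < H \<omega> User"
proof -
  have "emeasure (gamma_law (real (N j))) {..0} = 0" for j
    by (simp add: gamma_law_def emeasure_density nn_integral_0_iff_AE indicator_def)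
  then have "(\<integral>\<^sup>+\<omega>. indicator {..0} (H \<omega> User) \<partial>M) = 0"
    using H.nn_integral_law_indicator[of "\<lambda>_. 1" "{User}" "\<lambda>_. {..0}"] by simp
  then have "AE \<omega> in M. indicator {..0} (H \<omega> User) = (0 :: ennreal)"
    by (subst (asm) nn_integral_0_iff_AE) auto
  then show ?thesis by eventually_elim (auto simp: indicator_def split: if_splits)
qed

text \<open>For each base station, the joint probability of being LOS and farther than
  \<open>D\<close> is an integral of link probabilities that vanish there; countably many stations
  give one null set.\<close>

lemma LOS_dist: "AE \<omega> in M. \<forall>i. S \<omega> (i, User) = LOS \<longrightarrow> norm (X \<omega> i) \<le> D"
proof (rule AE_all_countable[THEN iffD2, OF allI])
  fix i
  have meas: "(\<lambda>w. norm (fst w i)) \<in> borel_measurable (point_space \<Otimes>\<^sub>M point_space)"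
    by (rule measurable_compose[OF PiM_component[where x=fst, OF measurable_fst] borel_measurable_norm])
  have A [measurable]: "{w \<in> space (point_space \<Otimes>\<^sub>M point_space). D < norm (fst w i)} \<in> sets (point_space \<Otimes>\<^sub>M point_space)"
    using meas by measurable
  let ?A = "{w \<in> space (point_space \<Otimes>\<^sub>M point_space). D < norm (fst w i)}"
  have W: "(X \<omega>, Z \<omega>) \<in> space (point_space \<Otimes>\<^sub>M point_space)" if "\<omega> \<in> space M" for \<omega>
    using that by (rule measurable_space[OF S.W_measurable])
  have "(\<integral>\<^sup>+\<omega>. indicator ?A (X \<omega>, Z \<omega>) * indicator {LOS} (S \<omega> (i, User)) \<partial>M) =
      (\<integral>\<^sup>+\<omega>. indicator ?A (X \<omega>, Z \<omega>) * emeasure (measure_pmf (link_law C D (norm (X \<omega> i)))) {LOS} \<partial>M)"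
    using S.law_indicator[OF A, of "{(i, User)}" "\<lambda>_. {LOS}"] by simp
  also have "\<dots> = (\<integral>\<^sup>+\<omega>. 0 \<partial>M)"
    by (intro nn_integral_cong) (auto simp: indicator_def emeasure_pmf_single pmf_link_law[OF C])
  also have "\<dots> = 0" by simp
  finally have z: "(\<integral>\<^sup>+\<omega>. indicator ?A (X \<omega>, Z \<omega>) * indicator {LOS} (S \<omega> (i, User)) \<partial>M) = 0" .
  have "(\<lambda>\<omega>. indicator ?A (X \<omega>, Z \<omega>) :: ennreal) \<in> borel_measurable M"
    by (rule measurable_compose[OF S.W_measurable borel_measurable_indicator[OF A]])
  moreover have "(\<lambda>\<omega>. indicator {LOS} (S \<omega> (i, User)) :: ennreal) \<in> borel_measurable M"
    by (rule measurable_compose[OF S.Y_component]) simp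
  ultimately have "(\<lambda>\<omega>. indicator ?A (X \<omega>, Z \<omega>) * indicator {LOS} (S \<omega> (i, User)) :: ennreal) \<in> borel_measurable M"
    by (rule borel_measurable_times_ennreal)
  from nn_integral_0_iff_AE[OF this, THEN iffD1, OF z]
  have "AE \<omega> in M. indicator ?A (X \<omega>, Z \<omega>) * indicator {LOS} (S \<omega> (i, User)) = (0 :: ennreal)" .
  then show "AE \<omega> in M. S \<omega> (i, User) = LOS \<longrightarrow> norm (X \<omega> i) \<le> D"
    using AE_space by eventually_elim (use W in \<open>auto simp: indicator_def split: if_splits\<close>)
qed

text \<open>Almost surely the serving distance and the user's fading are positive, which is what the
  threshold in \<open>eavesdroppers_laplace\<close> requires.\<close>

lemma prob_secure_secrecy: "emeasure M secure_event = (\<integral>\<^sup>+\<omega>. ennreal (secrecy (user_state \<omega>) (R \<omega>)) \<partial>M)"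
  unfolding prob_secure_indep
proof (rule nn_integral_cong_AE, use R_pos in eventually_elim)
  fix \<omega> assume R: "0 < R \<omega>"
  let ?j = "user_state \<omega>"
  have pl: "pl \<omega> User = K ?j * R \<omega> powr (- \<alpha> ?j)"
    by (simp add: serving_path_loss_def Let_def path_loss_def)
  have "(\<integral>\<^sup>+y. (\<integral>\<^sup>+\<omega>'. (INF n. \<Prod>k<n. link_cdf (dist (X \<omega> (sv \<omega>)) (Z \<omega>' k)) (Ms * pl \<omega> User * y)) \<partial>M) \<partial>gamma_law (real (N ?j))) =
      (\<integral>\<^sup>+y. ennreal (exp (- intensity (1 / (Ms * pl \<omega> User * y)))) \<partial>gamma_law (real (N ?j)))"
  proof (rule nn_integral_cong_AE)
    have "AE y in gamma_law (real (N ?j)). 0 < y"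
      unfolding gamma_law_def by (subst AE_density) auto
    then show "AE y in gamma_law (real (N ?j)).
      (\<integral>\<^sup>+\<omega>'. (INF n. \<Prod>k<n. link_cdf (dist (X \<omega> (sv \<omega>)) (Z \<omega>' k)) (Ms * pl \<omega> User * y)) \<partial>M) =
      ennreal (exp (- intensity (1 / (Ms * pl \<omega> User * y))))"
    proof eventually_elim
      case (elim y)
      then have "0 < Ms * pl \<omega> User * y" unfolding pl using gains K[of ?j] R by simp
      then show ?case by (rule eavesdroppers_laplace)
    qed
  qed
  then show "(\<integral>\<^sup>+y. (\<integral>\<^sup>+\<omega>'. (INF n. \<Prod>k<n. link_cdf (dist (X \<omega> (sv \<omega>)) (Z \<omega>' k)) (Ms * pl \<omega> User * y)) \<partial>M) \<partial>gamma_law (real (N ?j))) =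
      ennreal (secrecy ?j (R \<omega>))"
    unfolding pl using nn_integral_secrecy[OF R] by simp
qed

text \<open>Where the user's received power is positive, the ratio is at least 1 exactly when the
  supremum, hence each term, is at most that power. Truncation of negative terms by
  \<open>ennreal\<close> is harmless against a positive bound.\<close>

lemma secure_connectivity_eq: "secure_connectivity M K \<alpha> Ms X Z S H G = prob secure_event"
  unfolding secure_connectivity_def
proof (rule measure_eq_AE)
  show "AE \<omega> in M. (\<omega> \<in> {\<omega>\<in>space M. ennreal (Ms * pl \<omega> User * H \<omega> User) /
      (SUP k. ennreal (G \<omega> k * pl \<omega> (Eve k) * H \<omega> (Eve k))) \<ge> 1}) \<longleftrightarrow> \<omega> \<in> secure_event"
    using R_pos H_User_pos
  proof eventually_elim
    case (elim \<omega>)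
    have "0 < Ms * pl \<omega> User * H \<omega> User"
      using elim gains K by (simp add: serving_path_loss_def Let_def path_loss_def)
    then show ?case
      by (simp add: ennreal_one_le_divide_iff SUP_le_iff ennreal_le_iff)
  qed
qed measurable

section \<open>Decomposition by the state of the serving link\<close>

abbreviation "assoc j \<equiv> assoc_event M K \<alpha> X S j"

lemma assoc_sets [measurable]: "assoc j \<in> sets M"
  unfolding assoc_event_def by measurable

text \<open>Radon-Nikodym: by \<open>R_not_in_null\<close> the conditioned law of the distance is
  absolutely continuous. Its density has integral 1, so it is finite almost everywhere and
  \<open>enn2real\<close> makes it real-valued.\<close>

lemma ex_serving_dist_densities: "\<exists>f. serving_dist_densities M K \<alpha> X S f"
proof -
  have "\<exists>g. measure M (assoc j) > 0 \<longrightarrow> (\<forall>r. 0 \<le> g r) \<and>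
      distributed (uniform_measure M (assoc j)) lborel (\<lambda>\<omega>. R \<omega>) (\<lambda>r. ennreal (g r))" for j
  proof (cases "measure M (assoc j) > 0")
    case True
    let ?U = "uniform_measure M (assoc j)"
    let ?D = "distr ?U lborel (\<lambda>\<omega>. R \<omega>)"
    have em: "emeasure M (assoc j) \<noteq> 0" "emeasure M (assoc j) \<noteq> \<infinity>"
      using True by (auto simp: emeasure_eq_measure)
    interpret U: prob_space ?U by (rule prob_space_uniform_measure[OF em])
    interpret D: prob_space ?D by (rule U.prob_space_distr) simp
    have "absolutely_continuous lborel ?D"
      unfolding absolutely_continuous_def
    proof
      fix B :: "real set" assume B: "B \<in> null_sets lborel"
      then have B': "B \<in> sets borel" "emeasure lborel B = 0" by (auto simp: null_sets_def)
      have "AE \<omega> in ?U. R \<omega> \<notin> B"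
        using em R_not_in_null[OF B'] by (subst AE_uniform_measure) (auto elim: eventually_mono simp: emeasure_eq_measure)
      then have "emeasure ?U {\<omega>\<in>space ?U. R \<omega> \<in> B} = 0"
        by (rule emeasure_eq_0_AE)
      moreover have "emeasure ?D B = emeasure ?U {\<omega>\<in>space ?U. R \<omega> \<in> B}"
        by (rule trans[OF emeasure_distr arg_cong[where f="emeasure ?U"]]) (use B' in auto)
      ultimately have "emeasure ?D B = 0" by simp
      then show "B \<in> null_sets ?D" using B' by (auto simp: null_sets_def)
    qed
    then obtain f where f [measurable]: "f \<in> borel_measurable lborel" and fD: "density lborel f = ?D"
      using sigma_finite_measure.Radon_Nikodym[OF sigma_finite_lborel, of ?D] by auto
    have "(\<integral>\<^sup>+r. f r \<partial>lborel) = emeasure ?D (space ?D)"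
      unfolding fD[symmetric] by (simp add: emeasure_density)
    also have "\<dots> = 1" by (rule D.emeasure_space_1)
    finally have "AE r in lborel. f r \<noteq> \<infinity>"
      by (intro nn_integral_PInf_AE) auto
    then have "density lborel (\<lambda>r. ennreal (enn2real (f r))) = density lborel f"
      by (intro density_cong) (auto elim!: eventually_mono simp: less_top)
    then have "distributed ?U lborel (\<lambda>\<omega>. R \<omega>) (\<lambda>r. ennreal (enn2real (f r)))"
      using fD by (simp add: distributed_def)
    then show ?thesis by (intro exI[of _ "\<lambda>r. enn2real (f r)"]) simp
  qed auto
  then have "\<exists>f. \<forall>j. measure M (assoc j) > 0 \<longrightarrow> (\<forall>r. 0 \<le> f j r) \<and>
      distributed (uniform_measure M (assoc j)) lborel (\<lambda>\<omega>. R \<omega>) (\<lambda>r. ennreal (f j r))"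
    by (intro choice) blast
  then show ?thesis unfolding serving_dist_densities_def .
qed

lemma LOS_density_support:
  assumes f: "serving_dist_densities M K \<alpha> X S f" and pos: "measure M (assoc LOS) > 0"
  shows "AE r in lborel. r \<notin> {0..D} \<longrightarrow> f LOS r = 0"
proof -
  let ?U = "uniform_measure M (assoc LOS)"
  have em: "emeasure M (assoc LOS) \<noteq> 0" "emeasure M (assoc LOS) < \<infinity>"
    using pos by (auto simp: emeasure_eq_measure)
  interpret U: prob_space ?U using em by (intro prob_space_uniform_measure) auto
  have d: "distributed ?U lborel (\<lambda>\<omega>. R \<omega>) (\<lambda>r. ennreal (f LOS r))" and f0: "0 \<le> f LOS r" for r
    using f pos by (auto simp: serving_dist_densities_def)
  have "AE \<omega> in ?U. R \<omega> \<in> {0..D}"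
    using em LOS_dist by (subst AE_uniform_measure) (auto elim!: eventually_mono simp: assoc_event_def)
  then have "AE r in lborel. 0 < ennreal (f LOS r) \<longrightarrow> r \<in> {0..D}"
    by (subst U.distributed_AE2[OF d, symmetric]) auto
  then show ?thesis
    using f0 by (auto elim!: eventually_mono simp: order_less_le)
qed

text \<open>The indicator of \<open>{0<..}\<close> confines \<open>secrecy\<close> to the range
  where its bounds are known. Nonnegativity is recorded as well, because \<open>ennreal\<close> of a
  negative number is 0 and the sum over the states must later be read back as a real
  identity.\<close>

lemma secrecy_assoc_integral:
  assumes f: "serving_dist_densities M K \<alpha> X S f"
  shows "(\<integral>\<^sup>+\<omega>. indicator (assoc j) \<omega> * ennreal (indicator {0<..} (R \<omega>) * secrecy j (R \<omega>)) \<partial>M) =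
    ennreal (measure M (assoc j) * (LINT r:{0<..}|lborel. f j r * secrecy j r))"
    and "0 \<le> measure M (assoc j) * (LINT r:{0<..}|lborel. f j r * secrecy j r)"
proof -
  let ?U = "uniform_measure M (assoc j)"
  let ?s = "\<lambda>r. indicator {0<..} r * secrecy j r"
  have s0: "0 \<le> ?s r" and s1: "?s r \<le> 1" for r
    using secrecy_nonneg secrecy_le_1 by (auto simp: indicator_def)
  have "(\<integral>\<^sup>+\<omega>. indicator (assoc j) \<omega> * ennreal (?s (R \<omega>)) \<partial>M) =
      ennreal (measure M (assoc j) * (LINT r:{0<..}|lborel. f j r * secrecy j r)) \<and>
    0 \<le> measure M (assoc j) * (LINT r:{0<..}|lborel. f j r * secrecy j r)"
  proof (cases "measure M (assoc j) > 0")
    case False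
    then have z: "measure M (assoc j) = 0" using measure_nonneg[of M "assoc j"] by linarith
    then have "AE \<omega> in M. \<omega> \<notin> assoc j"
      by (intro AE_not_in) (auto simp: null_sets_def emeasure_eq_measure)
    then have "(\<integral>\<^sup>+\<omega>. indicator (assoc j) \<omega> * ennreal (?s (R \<omega>)) \<partial>M) = 0"
      by (subst nn_integral_0_iff_AE) (auto elim!: eventually_mono)
    then show ?thesis using z by simp
  next
    case True
    have em: "emeasure M (assoc j) \<noteq> 0" "emeasure M (assoc j) \<noteq> \<infinity>"
      using True by (auto simp: emeasure_eq_measure)
    interpret U: prob_space ?U by (rule prob_space_uniform_measure[OF em])
    have d: "distributed ?U lborel (\<lambda>\<omega>. R \<omega>) (\<lambda>r. ennreal (f j r))" and f0: "0 \<le> f j r" for r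
      using f True by (auto simp: serving_dist_densities_def)
    have "(\<lambda>r. enn2real (ennreal (f j r))) \<in> borel_measurable lborel"
      using distributed_borel_measurable[OF d] by measurable
    then have [measurable]: "f j \<in> borel_measurable borel"
      using f0 by simp
    have dens: "(\<integral>\<^sup>+\<omega>. ennreal (?s (R \<omega>)) \<partial>?U) = (\<integral>\<^sup>+r. ennreal (f j r * ?s r) \<partial>lborel)"
      by (subst distributed_nn_integral[OF d, symmetric]) (auto simp: ennreal_mult' s0 f0 intro!: nn_integral_cong)
    have le1: "(\<integral>\<^sup>+\<omega>. ennreal (?s (R \<omega>)) \<partial>?U) \<le> 1"
    proof -
      have "(\<integral>\<^sup>+\<omega>. ennreal (?s (R \<omega>)) \<partial>?U) \<le> (\<integral>\<^sup>+\<omega>. 1 \<partial>?U)"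
        using s1 by (intro nn_integral_mono) (simp only: ennreal_le_1)
      also have "\<dots> = 1" by (simp only: nn_integral_const U.emeasure_space_1 mult_1)
      finally show ?thesis .
    qed
    have int: "integrable lborel (\<lambda>r. f j r * ?s r)"
      using le1 s0 f0 unfolding dens by (intro integrableI_nonneg) (auto intro: le_less_trans)
    have "(\<integral>\<^sup>+r. ennreal (f j r * ?s r) \<partial>lborel) = ennreal (\<integral>r. f j r * ?s r \<partial>lborel)"
      by (rule nn_integral_eq_integral[OF int]) (use s0 f0 in \<open>auto intro!: mult_nonneg_nonneg\<close>)
    also have "(\<integral>r. f j r * ?s r \<partial>lborel) = (LINT r:{0<..}|lborel. f j r * secrecy j r)"
      unfolding set_lebesgue_integral_def by (intro Bochner_Integration.integral_cong) auto
    finally have LINT: "(\<integral>\<^sup>+\<omega>. ennreal (?s (R \<omega>)) \<partial>?U) = ennreal (LINT r:{0<..}|lborel. f j r * secrecy j r)"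
      unfolding dens .
    let ?I = "\<integral>\<^sup>+\<omega>. ennreal (?s (R \<omega>)) * indicator (assoc j) \<omega> \<partial>M"
    \<comment> \<open>Multiplying by the probability of association cancels the normalisation of the
      uniform measure; this is where the factor \<open>A_j\<close> of the formula arises.\<close>
    have "emeasure M (assoc j) * (\<integral>\<^sup>+\<omega>. ennreal (?s (R \<omega>)) \<partial>?U) = emeasure M (assoc j) * (?I / emeasure M (assoc j))"
      by (subst nn_integral_uniform_measure) auto
    also have "\<dots> = ?I * emeasure M (assoc j) / emeasure M (assoc j)"
      by (simp only: ennreal_times_divide mult.commute)
    also have "\<dots> = ?I"
      by (rule mult_divide_eq_ennreal) (use em in auto)
    finally have "?I = ennreal (measure M (assoc j)) * ennreal (LINT r:{0<..}|lborel. f j r * secrecy j r)"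
      by (simp only: LINT emeasure_eq_measure)
    also have "\<dots> = ennreal (measure M (assoc j) * (LINT r:{0<..}|lborel. f j r * secrecy j r))"
      by (rule ennreal_mult'[symmetric]) simp
    finally have "?I = ennreal (measure M (assoc j) * (LINT r:{0<..}|lborel. f j r * secrecy j r))" .
    moreover have "0 \<le> (LINT r:{0<..}|lborel. f j r * secrecy j r)"
      unfolding set_lebesgue_integral_def
      by (rule Bochner_Integration.integral_nonneg) (use s0 f0 in \<open>auto simp: indicator_def secrecy_nonneg\<close>)
    ultimately show ?thesis
      by (simp only: mult.commute[of "indicator (assoc j) _"]) (simp add: measure_nonneg)
  qed
  then show "(\<integral>\<^sup>+\<omega>. indicator (assoc j) \<omega> * ennreal (indicator {0<..} (R \<omega>) * secrecy j (R \<omega>)) \<partial>M) =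
    ennreal (measure M (assoc j) * (LINT r:{0<..}|lborel. f j r * secrecy j r))"
    and "0 \<le> measure M (assoc j) * (LINT r:{0<..}|lborel. f j r * secrecy j r)" by auto
qed

text \<open>Total probability: the two association events partition the space, and the indicator of
  a positive distance is 1 almost surely.\<close>

theorem secure_connectivity_formula:
  assumes f: "serving_dist_densities M K \<alpha> X S f"
  shows "secure_connectivity M K \<alpha> Ms X Z S H G =
    (\<Sum>j\<in>{LOS, NLOS}. measure M (assoc j) * (LINT r:{0<..}|lborel. f j r * secrecy j r))"
proof -
  let ?t = "\<lambda>j. measure M (assoc j) * (LINT r:{0<..}|lborel. f j r * secrecy j r)"
  let ?s = "\<lambda>j \<omega>. indicator (assoc j) \<omega> * ennreal (indicator {0<..} (R \<omega>) * secrecy j (R \<omega>))"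
  have "ennreal (prob secure_event) = (\<integral>\<^sup>+\<omega>. ennreal (secrecy (user_state \<omega>) (R \<omega>)) \<partial>M)"
    by (simp add: prob_secure_secrecy flip: emeasure_eq_measure)
  also have "\<dots> = (\<integral>\<^sup>+\<omega>. ?s LOS \<omega> + ?s NLOS \<omega> \<partial>M)"
  proof (rule nn_integral_cong_AE, use R_pos AE_space in eventually_elim)
    fix \<omega> assume "0 < R \<omega>" "\<omega> \<in> space M"
    then show "ennreal (secrecy (user_state \<omega>) (R \<omega>)) = ?s LOS \<omega> + ?s NLOS \<omega>"
      by (cases "user_state \<omega>") (auto simp: assoc_event_def)
  qed
  also have "\<dots> = (\<integral>\<^sup>+\<omega>. ?s LOS \<omega> \<partial>M) + (\<integral>\<^sup>+\<omega>. ?s NLOS \<omega> \<partial>M)"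
    by (rule nn_integral_add) measurable
  also have "\<dots> = ennreal (?t LOS + ?t NLOS)"
    unfolding secrecy_assoc_integral(1)[OF f] using secrecy_assoc_integral(2)[OF f] by simp
  finally have "prob secure_event = ?t LOS + ?t NLOS"
    using secrecy_assoc_integral(2)[OF f] by (subst (asm) ennreal_inj) auto
  then show ?thesis by (simp add: secure_connectivity_eq)
qed

end

theorem theorem1:
  fixes M :: "'w measure"
    and lam_B lam_E C D Ms ms \<theta>b :: real
    and K \<alpha> :: "link_state \<Rightarrow> real" and N :: "link_state \<Rightarrow> nat"
    and X Z :: "'w \<Rightarrow> nat \<Rightarrow> real^2"
    and S :: "'w \<Rightarrow> nat \<times> receiver \<Rightarrow> link_state"
    and H :: "'w \<Rightarrow> receiver \<Rightarrow> real"
    and G :: "'w \<Rightarrow> nat \<Rightarrow> real"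
  assumes "prob_space M"
    and "0 < lam_B" "0 < lam_E" "0 < D" "0 \<le> C" "C \<le> 1"
    and "0 < K NLOS" "K NLOS < K LOS" "0 < \<alpha> LOS" "\<alpha> LOS < \<alpha> NLOS"
    and "0 < N LOS" "0 < N NLOS"
    and "0 < ms" "ms < Ms" "0 < \<theta>b" "\<theta>b < 180"
    and base_stations: "homogeneous_ppp M lam_B X"
    and eavesdroppers: "homogeneous_ppp M lam_E Z"
    and "prob_space.indep_var M point_space X point_space Z"
    and blockage: "cond_indep_law M (point_space \<Otimes>\<^sub>M point_space) (\<lambda>\<omega>. (X \<omega>, Z \<omega>)) (count_space UNIV) S
           (\<lambda>(i, v) (x, z). measure_pmf (link_law C D (dist (x i) (receiver_pos z v))))"
    and fading: "cond_indep_law M (point_space \<Otimes>\<^sub>M point_space \<Otimes>\<^sub>M link_state_space)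
           (\<lambda>\<omega>. (X \<omega>, Z \<omega>, S \<omega>)) borel H
           (\<lambda>v (x, z, s). gamma_law (real (N (s (serving K \<alpha> x s, v)))))"
    and antenna_gain: "cond_indep_law M
           (point_space \<Otimes>\<^sub>M point_space \<Otimes>\<^sub>M link_state_space \<Otimes>\<^sub>M PiM UNIV (\<lambda>_. borel))
           (\<lambda>\<omega>. (X \<omega>, Z \<omega>, S \<omega>, H \<omega>)) borel G
           (\<lambda>k _. measure_pmf (gain_law Ms ms \<theta>b))"
  shows "(\<exists>f. serving_dist_densities M K \<alpha> X S f) \<and>
    (\<forall>f. serving_dist_densities M K \<alpha> X S f \<longrightarrow>
       (measure M (assoc_event M K \<alpha> X S LOS) > 0 \<longrightarrow> (AE r in lborel. r \<notin> {0..D} \<longrightarrow> f LOS r = 0)) \<and>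
       secure_connectivity M K \<alpha> Ms X Z S H G =
         (\<Sum>j\<in>{LOS, NLOS}. measure M (assoc_event M K \<alpha> X S j) *
            (LINT r:{0<..}|lborel. f j r *
               (LINT w:{0<..}|lborel.
                  exp (- Lambda_E lam_E C D K \<alpha> N Ms ms \<theta>b (r powr \<alpha> j / (Ms * w * K j)))
                    * w ^ (N j - 1) * exp (- w) / Gamma (real (N j))))))"
proof -
  have K: "0 < K j" and \<alpha>: "0 < \<alpha> j" and N: "0 < N j" for j
    using assms(7-12) by (cases j; simp)+
  interpret prob_space M by fact
  interpret network M lam_B lam_E X Z C D Ms ms \<theta>b K \<alpha> N S H G
    by unfold_locales (use assms K \<alpha> N in auto)
  show ?thesis
    using ex_serving_dist_densities LOS_density_support secure_connectivity_formula
    unfolding secrecy_def by blast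
qed

end
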